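(* Let $g:[0,\infty)\to\mathbb{R}$ be nondecreasing and left-continuous, let $t_0=0$, $x_0\in\mathbb{R}^n$, and let $f,h:[0,\infty)\times\mathbb{R}^n\to\mathbb{R}^n$ be functions satisfying: (A0) For every $t\ge0$, the function $f(t,\cdot)$ is continuous. (A1* ) For every $u\in\mathbb{R}^n$ and every $a>0$, the function $f(\cdot,u)$ is Kurzweil--Stieltjes integrable with respect to $g$ on the interval $[0,a]$. (A2* ) There exists a function $M:[0,\infty)\times[0,\infty)\to[0,\infty)$ such that $M(\cdot,\alpha)$ is Kurzweil--Stieltjes integrable with respect to $g$ on $[0,a]$ for all $\alpha\ge0$ and all $a>0$, the function $M(s,\cdot)$ is nondecreasing for all $s\ge0$, and $\left\|\int_c^d f(s,u)\,\mathrm{d}g(s)\right\|\le\int_c^d M(s,\|u\|)\,\mathrm{d}g(s)$ for all $u\in\mathbb{R}^n$ and all $[c,d]\subseteq[0,\infty)$. (A3* ) For every $v\in\mathbb{R}^n$, the function $h(\cdot,v)$ is bounded and regulated on $[0,\infty)$, and there exists a function $\varphi:[0,\infty)\times[0,\infty)\to[0,\infty)$ such that for every $r\ge0$, $\varphi(\cdot,r)$ is a $\mathfrak{D}$-function satisfying $\varphi(t,r)<t$ for all $t>0$, and $\|h(t,u)-h(t,v)\|\le\varphi(\|u-v\|,r)$ for all $u,v\in\mathbb{R}^n$ with $\|u\|,\|v\|\le r$ and all $t\ge0$. Suppose further that $$\liminf_{N\to\infty}\frac1N\left(\sup_{0\le t<\infty,\ \|u\|\le N}\|h(t,u)\|+\int_0^\infty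 M(s,N)\,\mathrm{d}g(s)\right)<1 .$$ Then there exists a bounded solution $x:[0,\infty)\to\mathbb{R}^n$ of the problem $$x(t)=x_0-h(0,x(0))+h(t,x(t))+\int_0^t f(s,x(s))\,\mathrm{d}g(s),\quad t\ge0,\qquad x(0)=x_0 .$$
   Context: $\mathbb{R}^n$ carries a norm $\|\cdot\|$. A function on $[0,\infty)$ is regulated if it has a (finite) right limit at every $t\ge0$ and a left limit at every $t>0$. Kurzweil--Stieltjes integral: a gauge on $[a,b]$ is a function $\delta:[a,b]\to(0,\infty)$. A tagged partition $a=s_0\le s_1\le\dots\le s_k=b$ with tags $\tau_i\in[s_{i-1},s_i]$ is $\delta$-fine if $[s_{i-1},s_i]\subset(\tau_i-\delta(\tau_i),\tau_i+\delta(\tau_i))$ for all $i$. A function $f:[a,b]\to\mathbb{R}^n$ is Kurzweil--Stieltjes integrable with respect to $g:[a,b]\to\mathbb{R}$ if there is $\mathcal{I}\in\mathbb{R}^n$ such that for every $\varepsilon>0$ there is a gauge $\delta$ on $[a,b]$ with $\left\|\sum_{i=1}^k f(\tau_i)(g(s_i)-g(s_{i-1}))-\mathcal{I}\right\|<\varepsilon$ for all $\delta$-fine tagged partitions of $[a,b]$; then $\int_a^b f\,\mathrm{d}g:=\mathcal{I}$. All integrals are in this sense, and $\int_0^\infty M(s,N)\,\mathrm{d}g(s)=\lim_{t\to\infty}\int_0^t M(s,N)\,\mathrm{d}g(s)$ (possibly $+\infty$). A $\mathfrak{D}$-function is a continuous nondecreasing function $\psi:[0,\infty)\to[0,\infty)$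 with $\psi(0)=0$ and $\psi(s)>0$ for $s>0$. A solution of the problem on $[0,\infty)$ is a regulated function $x:[0,\infty)\to\mathbb{R}^n$ such that $t\mapsto h(t,x(t))$ is regulated, the integral equation holds for all $t\ge0$ (with the integral existing in the Kurzweil--Stieltjes sense), and $x(0)=x_0$. *)

theory Defs
  imports "HOL-Analysis.Analysis"
begin

text \<open>
  Functions on the half-line are represented by total functions on the reals of which only the
  values at arguments \<open>t \<ge> 0\<close> matter.  The norm on \<open>real^'n\<close> is an arbitrary one, passed as a
  parameter \<open>nrm\<close>; continuity, one-sided limits and boundedness do not depend on its choice, so
  for these the library notions are used.
\<close>

definition is_norm :: "('a::real_vector \<Rightarrow> real) \<Rightarrow> bool" where
  "is_norm nrm \<longleftrightarrow>
     (\<forall>u. 0 \<le> nrm u) \<and>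
     (\<forall>u. nrm u = 0 \<longleftrightarrow> u = 0) \<and>
     (\<forall>c u. nrm (c *\<^sub>R u) = \<bar>c\<bar> * nrm u) \<and>
     (\<forall>u v. nrm (u + v) \<le> nrm u + nrm v)"

definition regulated :: "(real \<Rightarrow> 'a::topological_space) \<Rightarrow> bool" where
  "regulated x \<longleftrightarrow>
     (\<forall>t\<ge>0. \<exists>L. (x \<longlongrightarrow> L) (at_right t)) \<and>
     (\<forall>t>0. \<exists>L. (x \<longlongrightarrow> L) (at_left t))"

text \<open>
  A tagged partition of \<open>[a,b]\<close> has \<open>k\<close> subintervals \<open>[s i, s (Suc i)]\<close> with tags \<open>\<tau> i\<close>, \<open>i < k\<close>.
\<close>

definition tagged_partition ::
    "real \<Rightarrow> real \<Rightarrow> nat \<Rightarrow> (nat \<Rightarrow> real) \<Rightarrow> (nat \<Rightarrow> real) \<Rightarrow> bool" where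
  "tagged_partition a b k s \<tau> \<longleftrightarrow>
     s 0 = a \<and> s k = b \<and>
     (\<forall>i<k. s i \<le> s (Suc i) \<and> \<tau> i \<in> {s i..s (Suc i)})"

definition fine_partition ::
    "(real \<Rightarrow> real) \<Rightarrow> nat \<Rightarrow> (nat \<Rightarrow> real) \<Rightarrow> (nat \<Rightarrow> real) \<Rightarrow> bool" where
  "fine_partition \<delta> k s \<tau> \<longleftrightarrow>
     (\<forall>i<k. {s i..s (Suc i)} \<subseteq> {\<tau> i - \<delta> (\<tau> i)<..<\<tau> i + \<delta> (\<tau> i)})"

definition has_ks_integral ::
    "('a::real_vector \<Rightarrow> real) \<Rightarrow> (real \<Rightarrow> 'a) \<Rightarrow> (real \<Rightarrow> real) \<Rightarrow> real \<Rightarrow> real \<Rightarrow> 'a \<Rightarrow> bool" where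
  "has_ks_integral nrm f g a b I \<longleftrightarrow>
     (\<forall>\<epsilon>>0. \<exists>\<delta>. (\<forall>t\<in>{a..b}. 0 < \<delta> t) \<and>
        (\<forall>k s \<tau>. tagged_partition a b k s \<tau> \<and> fine_partition \<delta> k s \<tau> \<longrightarrow>
           nrm ((\<Sum>i<k. (g (s (Suc i)) - g (s i)) *\<^sub>R f (\<tau> i)) - I) < \<epsilon>))"

definition ks_integrable ::
    "('a::real_vector \<Rightarrow> real) \<Rightarrow> (real \<Rightarrow> 'a) \<Rightarrow> (real \<Rightarrow> real) \<Rightarrow> real \<Rightarrow> real \<Rightarrow> bool" where
  "ks_integrable nrm f g a b \<longleftrightarrow> (\<exists>I. has_ks_integral nrm f g a b I)"

definition ks_integral ::
    "('a::real_vector \<Rightarrow> real) \<Rightarrow> (real \<Rightarrow> 'a) \<Rightarrow> (real \<Rightarrow> real) \<Rightarrow> real \<Rightarrow> real \<Rightarrow> 'a" where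
  "ks_integral nrm f g a b = (THE I. has_ks_integral nrm f g a b I)"

text \<open>
  Only meant for integrands that are nonnegative and integrable on every \<open>[0,t]\<close>, with \<open>g\<close>
  nondecreasing: then the limit exists in \<open>ereal\<close>, possibly \<open>\<infinity>\<close>.
\<close>

definition ks_integral_infinity :: "(real \<Rightarrow> real) \<Rightarrow> (real \<Rightarrow> real) \<Rightarrow> ereal" where
  "ks_integral_infinity m g = Lim at_top (\<lambda>t. ereal (ks_integral abs m g 0 t))"

definition D_function :: "(real \<Rightarrow> real) \<Rightarrow> bool" where
  "D_function \<psi> \<longleftrightarrow>
     continuous_on {0..} \<psi> \<and> mono_on {0..} \<psi> \<and> \<psi> ` {0..} \<subseteq> {0..} \<and>
     \<psi> 0 = 0 \<and> (\<forall>s>0. 0 < \<psi> s)"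

definition is_solution ::
    "(real^'n \<Rightarrow> real) \<Rightarrow> (real \<Rightarrow> real) \<Rightarrow> (real \<Rightarrow> real^'n \<Rightarrow> real^'n) \<Rightarrow>
     (real \<Rightarrow> real^'n \<Rightarrow> real^'n) \<Rightarrow> real^'n \<Rightarrow> (real \<Rightarrow> real^'n) \<Rightarrow> bool" where
  "is_solution nrm g f h x0 x \<longleftrightarrow>
     regulated x \<and>
     regulated (\<lambda>t. h t (x t)) \<and>
     (\<forall>t\<ge>0. ks_integrable nrm (\<lambda>s. f s (x s)) g 0 t \<and>
        x t = x0 - h 0 (x 0) + h t (x t) + ks_integral nrm (\<lambda>s. f s (x s)) g 0 t) \<and>
     x 0 = x0"

end

theory Submission
  imports Defs "HOL-Library.Diagonal_Subsequence"
begin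

text \<open>
  Why the theorem holds.  Put \<open>c = x0 - h 0 x0\<close>.  The growth condition supplies a radius \<open>N\<close> such that
  \<open>nrm c\<close>, the supremum \<open>a\<close> of \<open>nrm (h t u)\<close> over \<open>nrm u \<le> N\<close>, and the total mass \<open>A\<close> of
  \<open>M(\<cdot>,N)\<close> together do not exceed \<open>N\<close> (\<open>liminf_growth_selects_radius\<close>).  For every \<open>t\<close> and every \<open>z\<close>
  with \<open>nrm (z - c) \<le> A\<close>, the map \<open>v \<mapsto> z + h t v\<close> sends the compact ball of radius \<open>N\<close> into itself
  and strictly decreases distances, so that it has exactly one fixed point \<open>v = R t z\<close> there
  (\<open>fixed_point_exists\<close>).  Writing \<open>x t = R t (y t)\<close>, the functional term disappears and the
  equation becomes \<open>y t = c + \<integral>\<^sub>0\<^sup>t f s (R s (y s)) dg s\<close>, whose right-hand side satisfies Caratheodory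
  conditions.  At \<open>t = 0\<close> it yields \<open>x 0 = R 0 c = x0\<close>.

  The increments of \<open>y\<close> are bounded by those of the nondecreasing function \<open>t \<mapsto> \<integral>\<^sub>0\<^sup>t M(\<cdot>,N) dg\<close>.  The
  Euler polygons of the equation for \<open>y\<close> obey the same bound, hence have a pointwise convergent
  subsequence, and dominated convergence identifies the limit as a solution
  (\<open>integral_equation_solvable\<close>).

  Dominated convergence and differentiation of indefinite integrals are needed for the
  Kurzweil--Stieltjes integral.  They are inherited from the Henstock--Kurzweil integral by the time change
  \<open>\<integral>\<^sub>a\<^sup>b f dg = \<integral> f (\<gamma> y) dy\<close> over \<open>[g a, g b]\<close>, with \<open>\<gamma> y = sup {t. g t \<le> y}\<close>; both integrals exist as
  soon as one does.  A direct comparison of partitions would be awkward, since points inside a jump of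
  \<open>g\<close> are not values of \<open>g\<close> and plateaus of \<open>g\<close> collapse to points.  Therefore integrability is first
  recast in a variational form (\<open>ward\<close>) in which the local error \<open>f \<tau> \<Delta>g - \<Delta>\<Phi>\<close> is dominated by the
  increment of a nondecreasing function of small total variation; this condition is local at every tag and
  transforms well (\<open>ward_forward\<close>, \<open>ward_backward\<close>).

  Finally, the hypothesis on \<open>M\<close> only bounds integrals of \<open>f(\<cdot>,u)\<close>.  Differentiating after the time change
  turns it into a pointwise bound off a null set (\<open>domination_off_null_set\<close>), which is what dominated
  convergence requires.
\<close>

section \<open>Variational form of the Stieltjes and Henstock--Kurzweil integrals\<close>

text \<open>
  Ward's form of the integral: \<open>\<Phi>\<close> is an indefinite integral of \<open>f\<close> with respect to \<open>g\<close> if, for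
  error functions \<open>\<xi>\<close> of arbitrarily small total increment, the increments of \<open>\<xi>\<close> dominate the errors of
  all fine tagged subintervals.  Errors are compared interval by interval, so the condition is local at
  every tag and involves no partitions.
\<close>
definition ward_error :: "(real \<Rightarrow> 'a::real_normed_vector) \<Rightarrow> (real \<Rightarrow> real) \<Rightarrow> (real \<Rightarrow> 'a) \<Rightarrow>
    real \<Rightarrow> real \<Rightarrow> (real \<Rightarrow> real) \<Rightarrow> (real \<Rightarrow> real) \<Rightarrow> bool"
  where "ward_error f g \<Phi> a b \<xi> \<delta> \<longleftrightarrow> mono_on {a..b} \<xi> \<and> (\<forall>\<tau>. 0 < \<delta> \<tau>) \<and>
    (\<forall>\<tau> s t. a \<le> s \<longrightarrow> s \<le> \<tau> \<longrightarrow> \<tau> \<le> t \<longrightarrow> t \<le> b \<longrightarrow> \<tau> - \<delta> \<tau> < s \<longrightarrow> t < \<tau> + \<delta> \<tau> \<longrightarrow>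
        norm ((g t - g s) *\<^sub>R f \<tau> - (\<Phi> t - \<Phi> s)) \<le> \<xi> t - \<xi> s)"

definition ward :: "(real \<Rightarrow> 'a::real_normed_vector) \<Rightarrow> (real \<Rightarrow> real) \<Rightarrow> (real \<Rightarrow> 'a) \<Rightarrow> real \<Rightarrow> real \<Rightarrow> bool"
  where "ward f g \<Phi> a b \<longleftrightarrow> (\<forall>\<epsilon>>0. \<exists>\<xi> \<delta>. ward_error f g \<Phi> a b \<xi> \<delta> \<and> \<xi> b - \<xi> a \<le> \<epsilon>)"

lemma ward_errorD:
  assumes "ward_error f g \<Phi> a b \<xi> \<delta>"
  shows "mono_on {a..b} \<xi>" "0 < \<delta> \<tau>"
    "a \<le> s \<Longrightarrow> s \<le> \<tau> \<Longrightarrow> \<tau> \<le> t \<Longrightarrow> t \<le> b \<Longrightarrow> \<tau> - \<delta> \<tau> < s \<Longrightarrow> t < \<tau> + \<delta> \<tau> \<Longrightarrow>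
        norm ((g t - g s) *\<^sub>R f \<tau> - (\<Phi> t - \<Phi> s)) \<le> \<xi> t - \<xi> s"
  using assms unfolding ward_error_def by simp_all

lemma ward_errorI:
  assumes "mono_on {a..b} \<xi>"
    and "\<forall>\<tau>\<in>{a..b}. \<exists>d>0. \<forall>s t. a \<le> s \<and> s \<le> \<tau> \<and> \<tau> \<le> t \<and> t \<le> b \<and> \<tau> - d < s \<and> t < \<tau> + d \<longrightarrow>
        norm ((g t - g s) *\<^sub>R f \<tau> - (\<Phi> t - \<Phi> s)) \<le> \<xi> t - \<xi> s"
  shows "\<exists>\<delta>. ward_error f g \<Phi> a b \<xi> \<delta>"
proof -
  from bchoice[OF assms(2)] obtain \<delta> where d: "\<forall>\<tau>\<in>{a..b}. 0 < \<delta> \<tau> \<and> (\<forall>s t. a \<le> s \<and> s \<le> \<tau> \<and> \<tau> \<le> t \<and> t \<le> b \<and> \<tau> - \<delta> \<tau> < s \<and> t < \<tau> + \<delta> \<tau> \<longrightarrow>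
        norm ((g t - g s) *\<^sub>R f \<tau> - (\<Phi> t - \<Phi> s)) \<le> \<xi> t - \<xi> s)" ..
  show ?thesis
    by (rule exI[of _ "\<lambda>\<tau>. if \<tau> \<in> {a..b} then \<delta> \<tau> else 1"]) (use assms(1) d in \<open>auto simp: ward_error_def\<close>)
qed

lemma ward_gauge: "ward f g \<Phi> a b \<Longrightarrow> \<epsilon> > 0 \<Longrightarrow> \<exists>\<xi> \<delta>. ward_error f g \<Phi> a b \<xi> \<delta> \<and> \<xi> b - \<xi> a \<le> \<epsilon>"
  unfolding ward_def by blast

text \<open>
  An interval with tag \<open>\<tau>\<close> splits at \<open>\<tau>\<close>, hence estimates on either side of the tag suffice.  The constant
  \<open>K\<close> lets the proofs add up several error functions without rescaling \<open>\<epsilon>\<close>.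
\<close>
lemma ward_one_sidedI:
  fixes f \<Phi> :: "real \<Rightarrow> 'a::real_normed_vector"
  assumes "K > 0"
    and *: "\<And>\<epsilon>. \<epsilon> > 0 \<Longrightarrow> \<exists>\<xi>. mono_on {a..b} \<xi> \<and> \<xi> b - \<xi> a \<le> K * \<epsilon> \<and> (\<forall>\<tau>\<in>{a..b}.
        (\<exists>d>0. \<forall>s. a \<le> s \<and> s < \<tau> \<and> \<tau> - d < s \<longrightarrow> norm ((g \<tau> - g s) *\<^sub>R f \<tau> - (\<Phi> \<tau> - \<Phi> s)) \<le> \<xi> \<tau> - \<xi> s) \<and>
        (\<exists>d>0. \<forall>t. \<tau> < t \<and> t \<le> b \<and> t < \<tau> + d \<longrightarrow> norm ((g t - g \<tau>) *\<^sub>R f \<tau> - (\<Phi> t - \<Phi> \<tau>)) \<le> \<xi> t - \<xi> \<tau>))"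
  shows "ward f g \<Phi> a b"
  unfolding ward_def
proof (intro allI impI)
  fix \<epsilon> :: real assume "\<epsilon> > 0"
  then have "\<epsilon> / K > 0" using \<open>K > 0\<close> by simp
  from *[OF this] obtain \<xi> where c: "mono_on {a..b} \<xi>" "\<xi> b - \<xi> a \<le> \<epsilon>" 
    and L: "\<And>\<tau>. \<tau>\<in>{a..b} \<Longrightarrow> \<exists>d>0. \<forall>s. a \<le> s \<and> s < \<tau> \<and> \<tau> - d < s \<longrightarrow> norm ((g \<tau> - g s) *\<^sub>R f \<tau> - (\<Phi> \<tau> - \<Phi> s)) \<le> \<xi> \<tau> - \<xi> s"
    and R: "\<And>\<tau>. \<tau>\<in>{a..b} \<Longrightarrow> \<exists>d>0. \<forall>t. \<tau> < t \<and> t \<le> b \<and> t < \<tau> + d \<longrightarrow> norm ((g t - g \<tau>) *\<^sub>R f \<tau> - (\<Phi> t - \<Phi> \<tau>)) \<le> \<xi> t - \<xi> \<tau>"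
    using \<open>K > 0\<close> by auto
  have "\<exists>\<delta>. ward_error f g \<Phi> a b \<xi> \<delta>"
  proof (rule ward_errorI[OF c(1)], rule ballI)
    fix \<tau> assume t: "\<tau> \<in> {a..b}"
    obtain d1 where d1: "d1 > 0" "\<And>s. a \<le> s \<Longrightarrow> s < \<tau> \<Longrightarrow> \<tau> - d1 < s \<Longrightarrow> norm ((g \<tau> - g s) *\<^sub>R f \<tau> - (\<Phi> \<tau> - \<Phi> s)) \<le> \<xi> \<tau> - \<xi> s"
      using L[OF t] by auto
    obtain d2 where d2: "d2 > 0" "\<And>u. \<tau> < u \<Longrightarrow> u \<le> b \<Longrightarrow> u < \<tau> + d2 \<Longrightarrow> norm ((g u - g \<tau>) *\<^sub>R f \<tau> - (\<Phi> u - \<Phi> \<tau>)) \<le> \<xi> u - \<xi> \<tau>"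
      using R[OF t] by auto
    show "\<exists>d>0. \<forall>s t. a \<le> s \<and> s \<le> \<tau> \<and> \<tau> \<le> t \<and> t \<le> b \<and> \<tau> - d < s \<and> t < \<tau> + d \<longrightarrow>
        norm ((g t - g s) *\<^sub>R f \<tau> - (\<Phi> t - \<Phi> s)) \<le> \<xi> t - \<xi> s"
    proof (intro exI[of _ "min d1 d2"] conjI allI impI)
      fix s u assume A: "a \<le> s \<and> s \<le> \<tau> \<and> \<tau> \<le> u \<and> u \<le> b \<and> \<tau> - min d1 d2 < s \<and> u < \<tau> + min d1 d2"
      have 1: "norm ((g \<tau> - g s) *\<^sub>R f \<tau> - (\<Phi> \<tau> - \<Phi> s)) \<le> \<xi> \<tau> - \<xi> s"
        using A d1(2)[of s] by (cases "s = \<tau>") auto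
      have 2: "norm ((g u - g \<tau>) *\<^sub>R f \<tau> - (\<Phi> u - \<Phi> \<tau>)) \<le> \<xi> u - \<xi> \<tau>"
        using A d2(2)[of u] by (cases "u = \<tau>") auto
      have "(g u - g s) *\<^sub>R f \<tau> - (\<Phi> u - \<Phi> s) = ((g \<tau> - g s) *\<^sub>R f \<tau> - (\<Phi> \<tau> - \<Phi> s)) + ((g u - g \<tau>) *\<^sub>R f \<tau> - (\<Phi> u - \<Phi> \<tau>))"
        by (simp add: algebra_simps)
      also have "norm \<dots> \<le> (\<xi> \<tau> - \<xi> s) + (\<xi> u - \<xi> \<tau>)"
        using 1 2 norm_triangle_mono by blast
      finally show "norm ((g u - g s) *\<^sub>R f \<tau> - (\<Phi> u - \<Phi> s)) \<le> \<xi> u - \<xi> s" by simp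
    qed (use d1 d2 in auto)
  qed
  then show "\<exists>\<xi> \<delta>. ward_error f g \<Phi> a b \<xi> \<delta> \<and> \<xi> b - \<xi> a \<le> \<epsilon>" using c(2) by blast
qed

lemma tagged_partition_mono:
  assumes "tagged_partition a b k s \<tau>" "i \<le> j" "j \<le> k"
  shows "s i \<le> s j"
proof -
  have "j \<le> k \<longrightarrow> s i \<le> s j" using \<open>i \<le> j\<close>
  proof (induction rule: dec_induct)
    case (step n)
    show ?case
    proof
      assume "Suc n \<le> k"
      then have "s n \<le> s (Suc n)" "s i \<le> s n" using assms(1) step unfolding tagged_partition_def by auto
      then show "s i \<le> s (Suc n)" by simp
    qed
  qed auto
  then show ?thesis using assms by auto
qed

text \<open>
  The increments of \<open>\<xi>\<close> telescope along a partition.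
\<close>
lemma ward_imp_has_ks_integral:
  assumes "ward f g \<Phi> a b"
  shows "has_ks_integral norm f g a b (\<Phi> b - \<Phi> a)"
  unfolding has_ks_integral_def
proof (intro allI impI)
  fix \<epsilon> :: real assume e: "\<epsilon> > 0"
  then have "\<epsilon>/2 > 0" by simp
  from ward_gauge[OF assms this] obtain \<xi> \<delta>
    where E: "ward_error f g \<Phi> a b \<xi> \<delta>" "\<xi> b - \<xi> a \<le> \<epsilon>/2" by blast
  note c = ward_errorD(1)[OF E(1)] E(2) ward_errorD(2)[OF E(1)] and est = ward_errorD(3)[OF E(1)]
  show "\<exists>\<delta>. (\<forall>t\<in>{a..b}. 0 < \<delta> t) \<and>
        (\<forall>k s \<tau>. tagged_partition a b k s \<tau> \<and> fine_partition \<delta> k s \<tau> \<longrightarrow>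
           norm ((\<Sum>i<k. (g (s (Suc i)) - g (s i)) *\<^sub>R f (\<tau> i)) - (\<Phi> b - \<Phi> a)) < \<epsilon>)"
  proof (intro exI[of _ \<delta>] conjI allI impI ballI c)
    fix k s \<tau> assume "tagged_partition a b k s \<tau> \<and> fine_partition \<delta> k s \<tau>"
    then have p: "tagged_partition a b k s \<tau>" and fi: "fine_partition \<delta> k s \<tau>" by auto
    have ends: "s 0 = a" "s k = b" using p by (auto simp: tagged_partition_def)
    have tel: "(\<Sum>i<k. F (s (Suc i)) - F (s i)) = F b - F a" for F :: "real \<Rightarrow> 'z::real_normed_vector"
      using sum_lessThan_telescope[of "\<lambda>i. F (s i)" k] ends by simp
    have "(\<Sum>i<k. (g (s (Suc i)) - g (s i)) *\<^sub>R f (\<tau> i)) - (\<Phi> b - \<Phi> a)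
       = (\<Sum>i<k. (g (s (Suc i)) - g (s i)) *\<^sub>R f (\<tau> i) - (\<Phi> (s (Suc i)) - \<Phi> (s i)))"
      by (simp only: sum_subtractf[of _ "\<lambda>i. \<Phi> (s (Suc i)) - \<Phi> (s i)"] tel)
    also have "norm \<dots> \<le> (\<Sum>i<k. \<xi> (s (Suc i)) - \<xi> (s i))"
    proof (rule sum_norm_le)
      fix i assume "i \<in> {..<k}"
      then have i: "i < k" by simp
      have "a \<le> s i" "s (Suc i) \<le> b"
        using tagged_partition_mono[OF p, of 0 i] tagged_partition_mono[OF p, of "Suc i" k] i ends by auto
      moreover have t: "s i \<le> \<tau> i" "\<tau> i \<le> s (Suc i)" using p i by (auto simp: tagged_partition_def)
      moreover have "{s i..s (Suc i)} \<subseteq> {\<tau> i - \<delta> (\<tau> i)<..<\<tau> i + \<delta> (\<tau> i)}"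
        using fi i by (auto simp: fine_partition_def)
      then have "\<tau> i - \<delta> (\<tau> i) < s i" "s (Suc i) < \<tau> i + \<delta> (\<tau> i)"
        using t by (auto simp: subset_eq)
      ultimately show "norm ((g (s (Suc i)) - g (s i)) *\<^sub>R f (\<tau> i) - (\<Phi> (s (Suc i)) - \<Phi> (s i))) \<le> \<xi> (s (Suc i)) - \<xi> (s i)"
        using est by blast
    qed
    also have "\<dots> < \<epsilon>" using c e tel[of \<xi>] by simp
    finally show "norm ((\<Sum>i<k. (g (s (Suc i)) - g (s i)) *\<^sub>R f (\<tau> i)) - (\<Phi> b - \<Phi> a)) < \<epsilon>" .
  qed
qed

text \<open>
  The Riemann--Stieltjes sums of fine tagged partitions of \<open>[u,v]\<close>, built from left to right.  As an
  inductive relation they can be concatenated without any index arithmetic.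
\<close>
inductive fine_sum :: "(real \<Rightarrow> real) \<Rightarrow> (real \<Rightarrow> real) \<Rightarrow> (real \<Rightarrow> real) \<Rightarrow> real \<Rightarrow> real \<Rightarrow> real \<Rightarrow> bool"
  for f g \<delta> u where
  empty: "fine_sum f g \<delta> u u 0"
| snoc: "fine_sum f g \<delta> u v X \<Longrightarrow> v \<le> \<tau> \<Longrightarrow> \<tau> \<le> w \<Longrightarrow> \<tau> - \<delta> \<tau> < v \<Longrightarrow> w < \<tau> + \<delta> \<tau> \<Longrightarrow>
     fine_sum f g \<delta> u w (X + (g w - g v) * f \<tau>)"

lemma fine_sum_append:
  assumes "fine_sum f g \<delta> v w Y" "fine_sum f g \<delta> u v X"
  shows "fine_sum f g \<delta> u w (X + Y)"
  using assms(1)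
proof induction
  case empty then show ?case using assms(2) by simp
next
  case (snoc v' Y \<tau> w)
  from fine_sum.snoc[OF this(6) this(2-5)] show ?case by (simp add: add.assoc)
qed

lemma fine_sum_le: "fine_sum f g \<delta> u v X \<Longrightarrow> u \<le> v"
  by (induction rule: fine_sum.induct) auto

lemma fine_sum_gauge_mono:
  assumes "fine_sum f g \<delta> u v X" "\<And>t. \<delta> t \<le> \<delta>' t"
  shows "fine_sum f g \<delta>' u v X"
  using assms(1)
proof induction
  case (snoc v X \<tau> w)
  then show ?case using assms(2)[of \<tau>] by (intro fine_sum.snoc) auto
qed (rule fine_sum.empty)

text \<open>
  Cousin's lemma.
\<close>
lemma fine_sum_exists:
  assumes "u \<le> v" "\<And>t. u \<le> t \<Longrightarrow> t \<le> v \<Longrightarrow> 0 < \<delta> t"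
  shows "\<exists>X. fine_sum f g \<delta> u v X"
proof -
  define \<delta>' where "\<delta>' t = \<delta> (max u (min v t))" for t
  have "\<exists>X. fine_sum f g \<delta>' u v X"
    using \<open>u \<le> v\<close>
  proof (induct rule: Bolzano)
    case (trans a b c)
    then show ?case using fine_sum_append by blast
  next
    case (local x)
    then have "\<delta> x > 0" using assms by auto
    show ?case
    proof (rule exI[of _ "\<delta> x"], intro conjI allI impI)
      fix a b assume "a \<le> x \<and> x \<le> b \<and> b - a < \<delta> x"
      moreover have "\<delta>' x = \<delta> x" using local by (auto simp: \<delta>'_def)
      ultimately have "fine_sum f g \<delta>' a b (0 + (g b - g a) * f x)"
        by (intro fine_sum.snoc[OF fine_sum.empty]) auto
      then show "\<exists>X. fine_sum f g \<delta>' a b X" ..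
    qed (rule \<open>\<delta> x > 0\<close>)
  qed
  then obtain X where X: "fine_sum f g \<delta>' u v X" ..
  have "fine_sum f g \<delta>' u w X \<Longrightarrow> w \<le> v \<Longrightarrow> fine_sum f g \<delta> u w X" for w X
  proof (induction rule: fine_sum.induct)
    case (snoc v' X \<tau> w)
    have "\<delta>' \<tau> = \<delta> \<tau>" using snoc.hyps snoc.prems fine_sum_le by (fastforce simp: \<delta>'_def)
    then show ?case using snoc by (intro fine_sum.snoc) auto
  qed (rule fine_sum.empty)
  then show ?thesis using X by blast
qed

lemma fine_sum_imp_partition:
  assumes "fine_sum f g \<delta> a b X"
  shows "\<exists>k s \<tau>. tagged_partition a b k s \<tau> \<and> fine_partition \<delta> k s \<tau> \<and>
     X = (\<Sum>i<k. (g (s (Suc i)) - g (s i)) *\<^sub>R f (\<tau> i))"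
  using assms
proof induction
  case empty
  show ?case by (rule exI[of _ 0], rule exI[of _ "\<lambda>_. a"]) (auto simp: tagged_partition_def fine_partition_def)
next
  case (snoc v X \<tau>' w)
  then obtain k s \<tau> where "tagged_partition a v k s \<tau>" "fine_partition \<delta> k s \<tau>"
     "X = (\<Sum>i<k. (g (s (Suc i)) - g (s i)) *\<^sub>R f (\<tau> i))" by blast
  then show ?case using snoc.hyps(2-)
    by (intro exI[of _ "Suc k"] exI[of _ "s(Suc k := w)"] exI[of _ "\<tau>(k := \<tau>')"])
      (auto simp: tagged_partition_def fine_partition_def less_Suc_eq)
qed

text \<open>
  For a gauge \<open>D n\<close> that belongs to the error \<open>1/(n+1)\<close>, let \<open>U n t\<close> and \<open>L n t\<close> be the supremum and
  infimum of all fine sums over \<open>[a,t]\<close>.  Every fine sum over \<open>[s,t]\<close> lies between the increments of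
  \<open>L n\<close> and of \<open>U n\<close> over \<open>[s,t]\<close>, because fine sums concatenate.  In particular this holds for the single
  term \<open>f \<tau> (g t - g s)\<close>, and in the limit for the increment of the indefinite integral \<open>\<Phi>\<close>.  So
  \<open>U n - L n\<close> is the required error function; its total increment is at most \<open>4/(n+1)\<close>, since two fine sums
  over \<open>[a,t]\<close> extend by the same fine sum over \<open>[t,b]\<close>.
\<close>
lemma has_ks_integral_imp_ward:
  fixes f :: "real \<Rightarrow> real"
  assumes I: "has_ks_integral abs f g a b I" and "a \<le> b"
  obtains \<Phi> where "ward f g \<Phi> a b" "\<Phi> b - \<Phi> a = I"
proof -
  define e where "e n = inverse (real (Suc n))" for n
  have e0: "e n > 0" for n by (simp add: e_def)
  have elim: "e \<longlonglongrightarrow> 0" unfolding e_def by (rule LIMSEQ_inverse_real_of_nat)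
  have "\<exists>\<delta>. \<forall>n. (\<forall>t\<in>{a..b}. 0 < \<delta> n t) \<and>
        (\<forall>k s \<tau>. tagged_partition a b k s \<tau> \<and> fine_partition (\<delta> n) k s \<tau> \<longrightarrow>
           \<bar>(\<Sum>i<k. (g (s (Suc i)) - g (s i)) *\<^sub>R f (\<tau> i)) - I\<bar> < e n)"
    using I e0 unfolding has_ks_integral_def by (intro choice allI) blast
  then obtain \<delta> where pos: "\<And>n t. t \<in> {a..b} \<Longrightarrow> 0 < \<delta> n t" and
     \<delta>: "\<And>n k s \<tau>. tagged_partition a b k s \<tau> \<Longrightarrow> fine_partition (\<delta> n) k s \<tau> \<Longrightarrow>
           \<bar>(\<Sum>i<k. (g (s (Suc i)) - g (s i)) *\<^sub>R f (\<tau> i)) - I\<bar> < e n" by blast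
  \<comment> \<open>gauges decreasing in \<open>n\<close>, so that the sets of fine sums are nested\<close>
  define D where "D n t = Min ((\<lambda>i. \<delta> i t) ` {..n})" for n t
  have Dpos: "0 < D n t" if "t \<in> {a..b}" for n t
    using pos that unfolding D_def by (subst Min_gr_iff) auto
  have Dle: "D n t \<le> D m t" if "m \<le> n" for m n t
    unfolding D_def using that by (intro Min_antimono) auto
  have D\<delta>: "D n t \<le> \<delta> n t" for n t unfolding D_def by (intro Min_le) auto
  define S where "S n u v = {X. fine_sum f g (D n) u v X}" for n u v
  have S_close: "\<bar>X - I\<bar> < e n" if "X \<in> S n a b" for n X
  proof -
    have "fine_sum f g (\<delta> n) a b X" using that D\<delta> unfolding S_def by (auto intro: fine_sum_gauge_mono)
    from fine_sum_imp_partition[OF this] show ?thesis using \<delta> by blast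
  qed
  have S_ne: "S n u v \<noteq> {}" if "a \<le> u" "u \<le> v" "v \<le> b" for n u v
    using fine_sum_exists[of u v "D n" f g] Dpos that unfolding S_def by auto
  have S_app: "X + Y \<in> S n u w" if "X \<in> S n u v" "Y \<in> S n v w" for X Y n u v w
    using that fine_sum_append unfolding S_def by blast
  have S_mono: "S n u v \<subseteq> S m u v" if "m \<le> n" for m n u v
    using Dle[OF that] unfolding S_def by (auto intro: fine_sum_gauge_mono)
  have S_diam: "\<bar>X - Y\<bar> \<le> 2 * e n" if XY: "X \<in> S n a t" "Y \<in> S n a t" "a \<le> t" "t \<le> b" for X Y n t
  proof -
    obtain Z where Z: "Z \<in> S n t b" using S_ne[of t b n] XY by auto
    have "\<bar>X + Z - I\<bar> < e n" "\<bar>Y + Z - I\<bar> < e n" using S_close[OF S_app[OF XY(1) Z]] S_close[OF S_app[OF XY(2) Z]] by auto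
    then show ?thesis by linarith
  qed
  define x where "x n t = (SOME X. X \<in> S n a t)" for n t
  have x: "x n t \<in> S n a t" if "a \<le> t" "t \<le> b" for n t
    using S_ne[of a t n] that unfolding x_def by (auto intro: someI)
  have xd: "\<bar>X - x m t\<bar> \<le> 2 * e n" if "X \<in> S n a t" "a \<le> t" "t \<le> b" "n \<le> m" for X n m t
    using S_diam[of X n t "x m t"] x[of t m] S_mono[of n m a t] that by auto
  have conv: "convergent (\<lambda>n. x n t)" if "a \<le> t" "t \<le> b" for t
  proof -
    have "Cauchy (\<lambda>n. x n t)"
    proof (rule metric_CauchyI)
      fix r :: real assume "r > 0"
      then obtain M where M: "e M < r / 4"
        using order_tendstoD(2)[OF elim, of "r/4"] by (auto simp: eventually_sequentially)
      show "\<exists>M. \<forall>m\<ge>M. \<forall>n\<ge>M. dist (x m t) (x n t) < r"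
      proof (intro exI[of _ M] allI impI)
        fix m n assume "M \<le> m" "M \<le> n"
        then have "\<bar>x M t - x m t\<bar> \<le> 2 * e M" "\<bar>x M t - x n t\<bar> \<le> 2 * e M" using xd[OF x] that by auto
        then show "dist (x m t) (x n t) < r" using M unfolding dist_real_def by linarith
      qed
    qed
    then show ?thesis by (rule Cauchy_convergent)
  qed
  define \<Phi> where "\<Phi> t = lim (\<lambda>n. x n t)" for t
  have lim: "(\<lambda>n. x n t) \<longlonglongrightarrow> \<Phi> t" if "a \<le> t" "t \<le> b" for t
    using conv[OF that] unfolding \<Phi>_def by (simp add: convergent_LIMSEQ_iff)
  have \<Phi>_close: "\<bar>X - \<Phi> t\<bar> \<le> 2 * e n" if "X \<in> S n a t" "a \<le> t" "t \<le> b" for X n t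
  proof (rule LIMSEQ_le_const2)
    show "(\<lambda>m. \<bar>X - x m t\<bar>) \<longlonglongrightarrow> \<bar>X - \<Phi> t\<bar>" by (intro tendsto_intros lim that)
  qed (use xd that in blast)
  define U where "U n t = Sup (S n a t)" for n t
  define L where "L n t = Inf (S n a t)" for n t
  have bdd: "bdd_above (S n a t)" "bdd_below (S n a t)" if "a \<le> t" "t \<le> b" for n t
  proof -
    have "\<Phi> t - 2 * e n \<le> X \<and> X \<le> \<Phi> t + 2 * e n" if "X \<in> S n a t" for X
      using \<Phi>_close[OF that \<open>a \<le> t\<close> \<open>t \<le> b\<close>] by linarith
    then show "bdd_above (S n a t)" "bdd_below (S n a t)"
      unfolding bdd_above_def bdd_below_def by blast+
  qed
  have Uinc: "Z \<le> U n t - U n s" if "Z \<in> S n s t" "a \<le> s" "s \<le> t" "t \<le> b" for Z n s t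
  proof -
    have "U n s \<le> U n t - Z" unfolding U_def
    proof (rule cSup_least)
      fix X assume "X \<in> S n a s"
      then have "X + Z \<in> S n a t" using S_app that by blast
      then have "X + Z \<le> Sup (S n a t)" using bdd that by (intro cSup_upper) auto
      then show "X \<le> Sup (S n a t) - Z" by simp
    qed (use S_ne that in auto)
    then show ?thesis by simp
  qed
  have Linc: "L n t - L n s \<le> Z" if "Z \<in> S n s t" "a \<le> s" "s \<le> t" "t \<le> b" for Z n s t
  proof -
    have "L n t - Z \<le> L n s" unfolding L_def
    proof (rule cInf_greatest)
      fix X assume "X \<in> S n a s"
      then have "X + Z \<in> S n a t" using S_app that by blast
      then have "Inf (S n a t) \<le> X + Z" using bdd that by (intro cInf_lower) auto
      then show "Inf (S n a t) - Z \<le> X" by simp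
    qed (use S_ne that in auto)
    then show ?thesis by simp
  qed
  have \<Phi>inc: "L n t - L n s \<le> \<Phi> t - \<Phi> s \<and> \<Phi> t - \<Phi> s \<le> U n t - U n s" if st: "a \<le> s" "s \<le> t" "t \<le> b" for n s t
  proof -
    have *: "L n t - L n s - 4 * e m \<le> \<Phi> t - \<Phi> s \<and> \<Phi> t - \<Phi> s \<le> U n t - U n s + 4 * e m" if "m \<ge> n" for m
    proof -
      obtain X Z where X: "X \<in> S m a s" and Z: "Z \<in> S m s t" using S_ne[of a s m] S_ne[of s t m] st by auto
      have "\<bar>X - \<Phi> s\<bar> \<le> 2 * e m" "\<bar>X + Z - \<Phi> t\<bar> \<le> 2 * e m"
        using \<Phi>_close[OF X] \<Phi>_close[OF S_app[OF X Z]] st by auto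
      moreover have "Z \<in> S n s t" using S_mono[OF that] Z by auto
      ultimately show ?thesis using Uinc[of Z n s t] Linc[of Z n s t] st by linarith
    qed
    have l1: "(\<lambda>m. L n t - L n s - 4 * e m) \<longlonglongrightarrow> L n t - L n s - 4 * 0"
     and l2: "(\<lambda>m. U n t - U n s + 4 * e m) \<longlonglongrightarrow> U n t - U n s + 4 * 0" by (intro tendsto_intros elim)+
    show ?thesis
      using LIMSEQ_le_const2[OF l1, of "\<Phi> t - \<Phi> s"] LIMSEQ_le_const[OF l2, of "\<Phi> t - \<Phi> s"] * by auto
  qed
  show ?thesis
  proof
    show "ward f g \<Phi> a b" unfolding ward_def
    proof (intro allI impI)
      fix \<epsilon> :: real assume "\<epsilon> > 0"
      then obtain n where n: "e n < \<epsilon> / 4"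
        using order_tendstoD(2)[OF elim, of "\<epsilon>/4"] by (auto simp: eventually_sequentially)
      define \<xi> where "\<xi> t = U n t - L n t" for t
      have "mono_on {a..b} \<xi>" unfolding mono_on_def \<xi>_def
      proof (intro allI impI)
        fix s t assume "s \<in> {a..b} \<and> t \<in> {a..b} \<and> s \<le> t"
        then show "U n s - L n s \<le> U n t - L n t" using \<Phi>inc[of s t n] by auto
      qed
      moreover have "\<xi> b - \<xi> a \<le> \<epsilon>"
      proof -
        have "U n b \<le> \<Phi> b + 2 * e n" unfolding U_def
          by (rule cSup_least) (use S_ne[of a b n] \<open>a \<le> b\<close> \<Phi>_close[of _ n b] in \<open>fastforce simp: abs_le_iff\<close>)+
        moreover have "L n b \<ge> \<Phi> b - 2 * e n" unfolding L_def
          by (rule cInf_greatest) (use S_ne[of a b n] \<open>a \<le> b\<close> \<Phi>_close[of _ n b] in \<open>fastforce simp: abs_le_iff\<close>)+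
        moreover have "L n a \<le> x n a" "x n a \<le> U n a" unfolding L_def U_def
          using bdd[of a n] x[of a n] \<open>a \<le> b\<close> by (auto intro: cInf_lower cSup_upper)
        ultimately show ?thesis using n unfolding \<xi>_def by linarith
      qed
      moreover have "\<exists>d>0. \<forall>s t. a \<le> s \<and> s \<le> \<tau> \<and> \<tau> \<le> t \<and> t \<le> b \<and> \<tau> - d < s \<and> t < \<tau> + d \<longrightarrow>
        norm ((g t - g s) *\<^sub>R f \<tau> - (\<Phi> t - \<Phi> s)) \<le> \<xi> t - \<xi> s" if "\<tau> \<in> {a..b}" for \<tau>
      proof (intro exI[of _ "D n \<tau>"] conjI allI impI Dpos that)
        fix s t assume st: "a \<le> s \<and> s \<le> \<tau> \<and> \<tau> \<le> t \<and> t \<le> b \<and> \<tau> - D n \<tau> < s \<and> t < \<tau> + D n \<tau>"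
        then have "fine_sum f g (D n) s t (0 + (g t - g s) * f \<tau>)"
          by (intro fine_sum.snoc[OF fine_sum.empty]) auto
        then have Z: "(g t - g s) * f \<tau> \<in> S n s t" by (simp add: S_def)
        have "a \<le> s" "s \<le> t" "t \<le> b" using st by auto
        from Uinc[OF Z this] Linc[OF Z this] \<Phi>inc[OF this, of n]
        show "norm ((g t - g s) *\<^sub>R f \<tau> - (\<Phi> t - \<Phi> s)) \<le> \<xi> t - \<xi> s" 
          unfolding \<xi>_def real_norm_def real_scaleR_def abs_le_iff by linarith
      qed
      ultimately show "\<exists>\<xi> \<delta>. ward_error f g \<Phi> a b \<xi> \<delta> \<and> \<xi> b - \<xi> a \<le> \<epsilon>"
        using ward_errorI[of a b \<xi> g f \<Phi>] by blast
    qed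
    have "\<Phi> a = 0"
    proof -
      have "0 \<in> S n a a" for n unfolding S_def by (simp add: fine_sum.empty)
      then have "\<bar>0 - \<Phi> a\<bar> \<le> 2 * e n" for n using \<Phi>_close \<open>a \<le> b\<close> by blast
      then have "\<bar>0 - \<Phi> a\<bar> \<le> 2 * 0" by (intro LIMSEQ_le_const[OF tendsto_mult[OF tendsto_const elim]]) auto
      then show ?thesis by simp
    qed
    moreover have "\<Phi> b = I"
    proof -
      have "\<bar>I - x n b\<bar> \<le> e n" for n using S_close[OF x[of b n]] \<open>a \<le> b\<close> by auto
      moreover have "(\<lambda>n. \<bar>I - x n b\<bar>) \<longlonglongrightarrow> \<bar>I - \<Phi> b\<bar>" using \<open>a \<le> b\<close> by (intro tendsto_intros lim) auto
      ultimately have "\<bar>I - \<Phi> b\<bar> \<le> 0" by (intro LIMSEQ_le[OF _ elim]) auto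
      then show ?thesis by simp
    qed
    ultimately show "\<Phi> b - \<Phi> a = I" by simp
  qed
qed

lemma ward_imp_has_integral:
  fixes f :: "real \<Rightarrow> 'a::real_normed_vector"
  assumes w: "ward f (\<lambda>y. y) \<Phi> a b" and "a \<le> b"
  shows "(f has_integral (\<Phi> b - \<Phi> a)) {a..b}"
  unfolding has_integral_real
proof (intro allI impI)
  fix \<epsilon> :: real assume e: "\<epsilon> > 0"
  then have "\<epsilon>/2 > 0" by simp
  from ward_gauge[OF w this] obtain \<xi> \<delta>
    where E: "ward_error f (\<lambda>y. y) \<Phi> a b \<xi> \<delta>" "\<xi> b - \<xi> a \<le> \<epsilon>/2" by blast
  note c = ward_errorD(1)[OF E(1)] E(2) ward_errorD(2)[OF E(1)] and est = ward_errorD(3)[OF E(1)]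
  show "\<exists>\<gamma>. gauge \<gamma> \<and> (\<forall>\<D>. \<D> tagged_division_of {a..b} \<and> \<gamma> fine \<D> \<longrightarrow>
      norm ((\<Sum>(x,K)\<in>\<D>. measure lborel K *\<^sub>R f x) - (\<Phi> b - \<Phi> a)) < \<epsilon>)"
  proof (intro exI[of _ "\<lambda>x. ball x (\<delta> x)"] conjI allI impI)
    show "gauge (\<lambda>x. ball x (\<delta> x))" using c(3) by (simp add: gauge_def)
    fix \<D> assume "\<D> tagged_division_of {a..b} \<and> (\<lambda>x. ball x (\<delta> x)) fine \<D>"
    then have D: "\<D> tagged_division_of {a..b}" and fi: "(\<lambda>x. ball x (\<delta> x)) fine \<D>" by auto
    have "(\<Sum>(x,K)\<in>\<D>. measure lborel K *\<^sub>R f x) - (\<Phi> b - \<Phi> a) =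
       (\<Sum>(x,K)\<in>\<D>. measure lborel K *\<^sub>R f x) - (\<Sum>(x,K)\<in>\<D>. \<Phi> (Sup K) - \<Phi> (Inf K))"
      using additive_tagged_division_1[OF \<open>a \<le> b\<close> D, of \<Phi>] by simp
    also have "\<dots> = (\<Sum>(x,K)\<in>\<D>. measure lborel K *\<^sub>R f x - (\<Phi> (Sup K) - \<Phi> (Inf K)))"
      by (simp add: sum_subtractf[symmetric] split_def)
    also have "norm \<dots> \<le> (\<Sum>(x,K)\<in>\<D>. \<xi> (Sup K) - \<xi> (Inf K))"
    proof (rule sum_norm_le, clarify)
      fix x K assume xK: "(x, K) \<in> \<D>"
      obtain s t where K: "K = {s..t}" using tagged_division_ofD(4)[OF D xK] by auto
      have x: "x \<in> K" "K \<subseteq> {a..b}" using tagged_division_ofD(2,3)[OF D xK] .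
      have "K \<subseteq> ball x (\<delta> x)" using fi xK by (auto simp: fine_def)
      then have "s \<in> ball x (\<delta> x)" "t \<in> ball x (\<delta> x)" using x K by (auto simp del: mem_ball)
      then have "x - \<delta> x < s" "t < x + \<delta> x" by (auto simp: dist_real_def)
      moreover have "s \<le> x" "x \<le> t" "a \<le> s" "t \<le> b" using x K by auto
      moreover have "Sup K = t" "Inf K = s" "measure lborel K = t - s" using K \<open>s \<le> x\<close> \<open>x \<le> t\<close> by auto
      ultimately show "norm (measure lborel K *\<^sub>R f x - (\<Phi> (Sup K) - \<Phi> (Inf K))) \<le> \<xi> (Sup K) - \<xi> (Inf K)"
        using est[of s x t] by simp
    qed
    also have "\<dots> = \<xi> b - \<xi> a" by (rule additive_tagged_division_1[OF \<open>a \<le> b\<close> D])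
    also have "\<dots> < \<epsilon>" using c e by simp
    finally show "norm ((\<Sum>(x,K)\<in>\<D>. measure lborel K *\<^sub>R f x) - (\<Phi> b - \<Phi> a)) < \<epsilon>" .
  qed
qed

text \<open>
  By Henstock's lemma the sums of \<open>norm (content K *\<^sub>R f x - integral K f)\<close> over fine partial divisions of
  \<open>[a,t]\<close> are small; their supremum, as a function of \<open>t\<close>, is the error function.  It is
  monotone because a partial division of \<open>[a,s]\<close> is also one of \<open>[a,t]\<close>.
\<close>
lemma integrable_imp_ward:
  fixes f :: "real \<Rightarrow> 'a::euclidean_space"
  assumes int: "f integrable_on {a..b}" and "a \<le> b"
  shows "ward f (\<lambda>y. y) (\<lambda>y. integral {a..y} f) a b"
  unfolding ward_def
proof (intro allI impI)
  fix \<epsilon> :: real assume "\<epsilon> > 0"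
  have "f integrable_on cbox a b" using int by simp
  have "\<exists>\<gamma>. gauge \<gamma> \<and> (\<forall>p. p tagged_partial_division_of {a..b} \<longrightarrow> \<gamma> fine p \<longrightarrow>
             sum (\<lambda>(x,k). norm(measure lborel k *\<^sub>R f x - integral k f)) p < \<epsilon>)"
  proof (rule Henstock_lemma[OF \<open>f integrable_on cbox a b\<close> \<open>\<epsilon> > 0\<close>])
    fix \<gamma> assume g: "gauge \<gamma>" and "\<And>p. p tagged_partial_division_of cbox a b \<Longrightarrow> \<gamma> fine p \<Longrightarrow>
             sum (\<lambda>(x,k). norm(measure lborel k *\<^sub>R f x - integral k f)) p < \<epsilon>"
    from this(2)[unfolded box_real] show ?thesis
      by (intro exI[of _ \<gamma>] conjI allI impI g)
  qed
  then obtain \<gamma> where *: "gauge \<gamma> \<and> (\<forall>p. p tagged_partial_division_of {a..b} \<longrightarrow> \<gamma> fine p \<longrightarrow>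
             sum (\<lambda>(x,k). norm(measure lborel k *\<^sub>R f x - integral k f)) p < \<epsilon>)" ..
  note g = conjunct1[OF *] and hen = conjunct2[OF *, rule_format]
  define S where "S t = {sum (\<lambda>(x,k). norm(measure lborel k *\<^sub>R f x - integral k f)) p | p. p tagged_partial_division_of {a..t} \<and> \<gamma> fine p}" for t
  define \<xi> where "\<xi> t = Sup (S t)" for t
  have sub: "S s \<subseteq> S t" if "s \<le> t" for s t
  proof -
    have "p tagged_partial_division_of {a..t}" if "p tagged_partial_division_of {a..s}" for p
    proof -
      have "{a..s} \<subseteq> {a..t}" using \<open>s \<le> t\<close> by auto
      with that show ?thesis unfolding tagged_partial_division_of_def by (meson subset_trans)
    qed
    then show ?thesis unfolding S_def by blast
  qed
  have z: "0 \<in> S t" for t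
    unfolding S_def by (rule CollectI, rule exI[of _ "{}"]) (auto simp: tagged_partial_division_of_def fine_def)
  have le: "X \<le> \<epsilon>" if "X \<in> S t" "t \<le> b" for X t
  proof -
    have "X \<in> S b" using that sub by blast
    then show ?thesis using hen unfolding S_def by fastforce
  qed
  then have bdd: "bdd_above (S t)" if "t \<le> b" for t
    unfolding bdd_above_def using that by blast
  have mono: "mono_on {a..b} \<xi>" unfolding mono_on_def \<xi>_def
    proof (intro allI impI cSup_subset_mono)
      fix s t assume "s \<in> {a..b} \<and> t \<in> {a..b} \<and> s \<le> t"
      then show "S s \<noteq> {}" "bdd_above (S t)" "S s \<subseteq> S t" using z[of s] bdd sub by auto
    qed
  have "0 \<le> \<xi> a" unfolding \<xi>_def using z bdd \<open>a \<le> b\<close> by (intro cSup_upper) auto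
  moreover have "\<xi> b \<le> \<epsilon>" unfolding \<xi>_def by (rule cSup_least) (use z le in auto)
  ultimately have tot: "\<xi> b - \<xi> a \<le> \<epsilon>" by simp
  have "\<exists>\<delta>. ward_error f (\<lambda>y. y) (\<lambda>y. integral {a..y} f) a b \<xi> \<delta>"
  proof (rule ward_errorI[OF mono], rule ballI)
    fix \<tau> assume "\<tau> \<in> {a..b}"
    obtain d where d: "d > 0" "ball \<tau> d \<subseteq> \<gamma> \<tau>"
      using g by (meson gauge_def open_contains_ball)
    show "\<exists>d>0. \<forall>s t. a \<le> s \<and> s \<le> \<tau> \<and> \<tau> \<le> t \<and> t \<le> b \<and> \<tau> - d < s \<and> t < \<tau> + d \<longrightarrow>
        norm ((t - s) *\<^sub>R f \<tau> - (integral {a..t} f - integral {a..s} f)) \<le> \<xi> t - \<xi> s"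
    proof (intro exI[of _ d] conjI d allI impI)
      fix s t assume st: "a \<le> s \<and> s \<le> \<tau> \<and> \<tau> \<le> t \<and> t \<le> b \<and> \<tau> - d < s \<and> t < \<tau> + d"
      have "integral {a..s} f + integral {s..t} f = integral {a..t} f"
        using st by (intro Henstock_Kurzweil_Integration.integral_combine integrable_subinterval_real[OF int]) auto
      then have eq: "norm ((t - s) *\<^sub>R f \<tau> - (integral {a..t} f - integral {a..s} f)) =
        norm (measure lborel {s..t} *\<^sub>R f \<tau> - integral {s..t} f)" (is "?l = ?r")
      proof -
        have "integral {s..t} f = integral {a..t} f - integral {a..s} f"
          using \<open>integral {a..s} f + integral {s..t} f = integral {a..t} f\<close> by (metis add_diff_cancel_left')
        then show ?thesis using st by simp
      qed
      show "?l \<le> \<xi> t - \<xi> s"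
      proof (cases "s = t")
        case False
        then have "s < t" using st by auto
        have "\<xi> s \<le> \<xi> t - ?r" unfolding \<xi>_def[of s]
        proof (rule cSup_least)
          fix X assume "X \<in> S s"
          then obtain p where p: "p tagged_partial_division_of {a..s}" "\<gamma> fine p" 
            and X: "X = sum (\<lambda>(x,k). norm(measure lborel k *\<^sub>R f x - integral k f)) p" unfolding S_def by auto
          have K: "K \<subseteq> {a..s}" if "(x, K) \<in> p" for x K using p(1) that by (auto simp: tagged_partial_division_of_def)
          have nin: "(\<tau>, {s..t}) \<notin> p" using K[of \<tau> "{s..t}"] \<open>s < t\<close> by auto
          have int0: "interior {s..t} \<inter> interior K = {}" if "(x, K) \<in> p" for x K
            using interior_mono[OF K[OF that]] by auto
          have "insert (\<tau>, {s..t}) p tagged_partial_division_of {a..t}"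
            unfolding tagged_partial_division_of_def
          proof (intro conjI allI impI)
            show "finite (insert (\<tau>, {s..t}) p)" using p(1) by (auto simp: tagged_partial_division_of_def)
          next
            fix x K assume "(x, K) \<in> insert (\<tau>, {s..t}) p"
            then show "x \<in> K" "K \<subseteq> {a..t}" "\<exists>u v. K = cbox u v"
              using p(1) st K by (fastforce simp: tagged_partial_division_of_def)+
          next
            fix x1 K1 x2 K2
            assume "(x1, K1) \<in> insert (\<tau>, {s..t}) p \<and> (x2, K2) \<in> insert (\<tau>, {s..t}) p \<and> (x1, K1) \<noteq> (x2, K2)"
            then consider "(x1, K1) \<in> p" "(x2, K2) \<in> p" "(x1, K1) \<noteq> (x2, K2)" | "(x1,K1) \<in> p" "K2 = {s..t}" | "(x2,K2) \<in> p" "K1 = {s..t}"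
              by auto
            then show "interior K1 \<inter> interior K2 = {}"
              using int0 p(1) by cases (auto simp: tagged_partial_division_of_def)
          qed
          moreover have "\<gamma> fine insert (\<tau>, {s..t}) p"
          proof -
            have "{s..t} \<subseteq> ball \<tau> d" using st by (auto simp: dist_real_def)
            then show ?thesis using p(2) d by (auto simp: fine_def)
          qed
          ultimately have "sum (\<lambda>(x,k). norm(measure lborel k *\<^sub>R f x - integral k f)) (insert (\<tau>, {s..t}) p) \<in> S t"
            unfolding S_def by blast
          moreover have "sum (\<lambda>(x,k). norm(measure lborel k *\<^sub>R f x - integral k f)) (insert (\<tau>, {s..t}) p) = ?r + X"
            using nin X p(1) by (subst sum.insert) (auto simp: tagged_partial_division_of_def)
          ultimately have "?r + X \<le> \<xi> t" unfolding \<xi>_def using bdd st by (intro cSup_upper) auto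
          then show "X \<le> \<xi> t - ?r" by simp
        qed (use z in auto)
        then show ?thesis using eq by simp
      qed simp
    qed
  qed
  then show "\<exists>\<xi> \<delta>. ward_error f (\<lambda>y. y) (\<lambda>y. integral {a..y} f) a b \<xi> \<delta> \<and> \<xi> b - \<xi> a \<le> \<epsilon>"
    using tot by blast
qed

section \<open>Time change: from Stieltjes integrals to Henstock--Kurzweil integrals\<close>

lemma countable_imp_negligible: "countable (S :: real set) \<Longrightarrow> negligible S"
  using countable_imp_null_set_lborel null_sets_completionI negligible_iff_null_sets by blast

text \<open>
  Errors at countably many tags can always be absorbed.  This handles the tags at which \<open>g\<close> has a plateau.
\<close>
lemma ward_countable_support:
  fixes k :: "real \<Rightarrow> real"
  assumes "countable {y. k y \<noteq> 0}" "a \<le> b"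
  shows "ward k (\<lambda>y. y) (\<lambda>_. 0) a b"
proof -
  have 0: "(k has_integral 0) {a..y}" for y
    by (rule has_integral_negligible[OF countable_imp_negligible[OF assms(1)]]) auto
  have "integral {a..y} k = 0" for y using integral_unique[OF 0] .
  moreover have "k integrable_on {a..b}" using 0 by blast
  ultimately show ?thesis using integrable_imp_ward[of k a b] \<open>a \<le> b\<close> by simp
qed

lemma scaled_difference_bound:
  fixes u v w x y z :: "'a::real_normed_vector"
  assumes "norm (r *\<^sub>R x - u) \<le> A" "norm (s *\<^sub>R x - v) \<le> B" "norm ((r - s) *\<^sub>R y - (u - v)) \<le> C"
  shows "norm ((r - s) *\<^sub>R (x - y)) \<le> A + B + C"
proof -
  have "(r - s) *\<^sub>R (x - y) = (r *\<^sub>R x - u) - (s *\<^sub>R x - v) - ((r - s) *\<^sub>R y - (u - v))"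
    by (simp add: algebra_simps)
  then show ?thesis using assms norm_triangle_ineq4[of "r *\<^sub>R x - u" "s *\<^sub>R x - v"]
      norm_triangle_ineq4[of "(r *\<^sub>R x - u) - (s *\<^sub>R x - v)" "(r - s) *\<^sub>R y - (u - v)"] by simp
qed

text \<open>
  If \<open>g\<close> is constant on \<open>(p,t]\<close>, the integral over \<open>[p,t]\<close> only sees the jump of \<open>g\<close> at \<open>p\<close>: away from
  \<open>p\<close> the local increments of \<open>\<Phi>\<close> are bounded by those of \<open>\<xi>\<close>, and bisection makes this global.
\<close>
lemma ward_const_integrator:
  fixes f \<Phi> :: "real \<Rightarrow> 'a::real_normed_vector"
  assumes w: "ward f g \<Phi> a b" and p: "a \<le> p" "p < t" "t \<le> b" and const: "\<And>s. p < s \<Longrightarrow> s \<le> t \<Longrightarrow> g s = g t"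
  shows "\<Phi> t - \<Phi> p = (g t - g p) *\<^sub>R f p"
proof -
  have "norm ((g t - g p) *\<^sub>R f p - (\<Phi> t - \<Phi> p)) \<le> \<epsilon>" if "\<epsilon> > 0" for \<epsilon>
  proof -
    from ward_gauge[OF w that] obtain \<xi> \<delta>
    where E: "ward_error f g \<Phi> a b \<xi> \<delta>" "\<xi> b - \<xi> a \<le> \<epsilon>" by blast
  note mono = ward_errorD(1)[OF E(1)] and tot = E(2) and pos = ward_errorD(2)[OF E(1)] and est = ward_errorD(3)[OF E(1)]
    obtain t' where t': "p < t'" "t' < t" "t' < p + \<delta> p"
      using dense[of p "min t (p + \<delta> p)"] pos[of p] p by auto
    have "t' \<le> t" using t' by simp
    then have "norm (\<Phi> t - \<Phi> t') \<le> \<xi> t - \<xi> t'"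
    proof -
      have "t' \<le> t' \<and> t \<le> t \<longrightarrow> norm (\<Phi> t - \<Phi> t') \<le> \<xi> t - \<xi> t'"
        using \<open>t' \<le> t\<close>
      proof (induct rule: Bolzano[where P = "\<lambda>u v. t' \<le> u \<and> v \<le> t \<longrightarrow> norm (\<Phi> v - \<Phi> u) \<le> \<xi> v - \<xi> u"])
        case (trans u v w)
        show ?case
        proof
          assume "t' \<le> u \<and> w \<le> t"
          then have "norm (\<Phi> v - \<Phi> u) \<le> \<xi> v - \<xi> u" "norm (\<Phi> w - \<Phi> v) \<le> \<xi> w - \<xi> v" using trans by auto
          then show "norm (\<Phi> w - \<Phi> u) \<le> \<xi> w - \<xi> u"
            using norm_triangle_ineq[of "\<Phi> w - \<Phi> v" "\<Phi> v - \<Phi> u"] by simp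
        qed
      next
        case (local x)
        show ?case
        proof (rule exI[of _ "\<delta> x"], intro conjI allI impI pos)
          fix u v assume A: "u \<le> x \<and> x \<le> v \<and> v - u < \<delta> x" "t' \<le> u \<and> v \<le> t"
          then have "g v = g u" using const[of u] const[of v] t' by auto
          then show "norm (\<Phi> v - \<Phi> u) \<le> \<xi> v - \<xi> u" using est[of u x v] A t' p by (auto simp: norm_minus_commute)
        qed
      qed
      then show ?thesis by simp
    qed
    moreover have "norm ((g t' - g p) *\<^sub>R f p - (\<Phi> t' - \<Phi> p)) \<le> \<xi> t' - \<xi> p"
      using est[of p p t'] t' p pos[of p] by auto
    moreover have "g t' = g t" using const[of t'] t' by auto
    ultimately have "norm ((g t - g p) *\<^sub>R f p - (\<Phi> t - \<Phi> p)) \<le> \<xi> t - \<xi> p"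
      using norm_triangle_ineq4[of "(g t' - g p) *\<^sub>R f p - (\<Phi> t' - \<Phi> p)" "\<Phi> t - \<Phi> t'"] by (simp add: algebra_simps)
    also have "\<dots> \<le> \<xi> b - \<xi> a"
      using mono_onD[OF mono, of a p] mono_onD[OF mono, of t b] p by auto
    finally show ?thesis using tot by simp
  qed
  then have "norm ((g t - g p) *\<^sub>R f p - (\<Phi> t - \<Phi> p)) \<le> 0" by (rule field_le_epsilon[of _ 0, simplified])
  then show ?thesis by simp
qed

text \<open>
  The parameter \<open>q\<close> is the last time at which \<open>g\<close> does not exceed a given level, specified through the
  Galois connection between times and levels.  It is constant on the gap \<open>[g t, g (t+)]\<close> left by
  a jump and skips over plateaus.
\<close>
locale time_change =
  fixes g q :: "real \<Rightarrow> real" and a b :: real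
  assumes ab: "a \<le> b"
    and mono: "mono_on {a..b} g"
    and left_cont: "\<And>t. a < t \<Longrightarrow> t \<le> b \<Longrightarrow> continuous (at_left t) g"
    and galois: "\<And>y t. y \<in> {g a..g b} \<Longrightarrow> t \<in> {a..b} \<Longrightarrow> t \<le> q y \<longleftrightarrow> g t \<le> y"
    and q_in: "\<And>y. y \<in> {g a..g b} \<Longrightarrow> q y \<in> {a..b}"
begin

lemma g_mono: "a \<le> s \<Longrightarrow> s \<le> t \<Longrightarrow> t \<le> b \<Longrightarrow> g s \<le> g t"
  using mono_onD[OF mono, of s t] by auto

lemma g_ab: "g a \<le> g b" using g_mono ab by auto

lemma g_in: "t \<in> {a..b} \<Longrightarrow> g t \<in> {g a..g b}" using g_mono by auto

lemma g_left:
  assumes "a < t" "t \<le> b" "e > 0"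
  shows "\<exists>d>0. \<forall>s. a \<le> s \<and> t - d < s \<and> s < t \<longrightarrow> g t - e < g s"
proof -
  have "(g \<longlongrightarrow> g t) (at_left t)" using left_cont[OF assms(1,2)] by (simp add: continuous_within)
  then have "\<forall>\<^sub>F s in at_left t. g t - e < g s" using \<open>e > 0\<close> by (intro order_tendstoD) auto
  then obtain r where "r < t" "\<And>s. r < s \<Longrightarrow> s < t \<Longrightarrow> g t - e < g s"
    unfolding eventually_at_left_field by auto
  then show ?thesis by (intro exI[of _ "t - r"]) auto
qed

lemma gq_le: "y \<in> {g a..g b} \<Longrightarrow> g (q y) \<le> y"
  using galois[of y "q y"] q_in[of y] by auto

lemma q_less: "y \<in> {g a..g b} \<Longrightarrow> t \<in> {a..b} \<Longrightarrow> q y < t \<longleftrightarrow> y < g t"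
  using galois[of y t] by auto

lemma q_mono: "y \<in> {g a..g b} \<Longrightarrow> y' \<in> {g a..g b} \<Longrightarrow> y \<le> y' \<Longrightarrow> q y \<le> q y'"
  using galois[of y' "q y"] gq_le[of y] q_in[of y] by auto

text \<open>
  The first time at which \<open>g\<close> reaches the level \<open>y\<close>.  It differs from \<open>q y\<close> exactly at the levels of
  plateaus, of which there are countably many.
\<close>
definition p :: "real \<Rightarrow> real" where "p y = Inf {t\<in>{a..b}. y \<le> g t}"

lemma p_le: "t \<in> {a..b} \<Longrightarrow> y \<le> g t \<Longrightarrow> p y \<le> t"
  unfolding p_def by (intro cInf_lower) (auto intro: bdd_belowI[of _ a])

lemma p_in: assumes "y \<in> {g a..g b}" shows "p y \<in> {a..b}"
proof -
  have "a \<le> p y" unfolding p_def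
    by (rule cInf_greatest) (use assms ab in auto)
  then show ?thesis using p_le[of b y] assms ab by auto
qed

lemma less_p: "t \<in> {a..b} \<Longrightarrow> t < p y \<Longrightarrow> g t < y"
  using p_le[of t y] by force

lemma p_less: 
  assumes "y \<in> {g a..g b}" "t \<in> {a..b}" "p y < t" shows "y \<le> g t"
proof -
  have "\<exists>s\<in>{t\<in>{a..b}. y \<le> g t}. s < t"
    using assms ab unfolding p_def by (subst (asm) cInf_less_iff) (auto intro: bdd_belowI[of _ a])
  then show ?thesis using g_mono[of _ t] assms(2) by force
qed

lemma gp_le: assumes "y \<in> {g a..g b}" shows "g (p y) \<le> y"
proof (cases "p y = a")
  case False
  then have pa: "a < p y" "p y \<le> b" using p_in[OF assms] by auto
  show ?thesis
  proof (rule ccontr)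
    assume "\<not> ?thesis"
    then have "g (p y) - y > 0" by simp
    from g_left[OF pa this] obtain d where d: "d > 0" "\<And>s. a \<le> s \<Longrightarrow> p y - d < s \<Longrightarrow> s < p y \<Longrightarrow> y < g s" by auto
    obtain s where "max a (p y - d) < s" "s < p y" using dense[of "max a (p y - d)" "p y"] pa d by auto
    then show False using d(2)[of s] less_p[of s y] pa by auto
  qed
qed (use assms in auto)

lemma p_le_q: "y \<in> {g a..g b} \<Longrightarrow> p y \<le> q y"
  using galois[of y "p y"] gp_le[of y] p_in[of y] by auto

lemma g_between:
  assumes "y \<in> {g a..g b}" "p y < t" "t \<le> q y"
  shows "g t = y"
proof -
  have "t \<in> {a..b}" using assms p_in[of y] q_in[of y] by auto
  then show ?thesis using p_less[of y t] galois[of y t] assms by auto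
qed

lemma countable_plateaus: "countable {y \<in> {g a..g b}. p y < q y}"
proof -
  let ?C = "{y \<in> {g a..g b}. p y < q y}"
  have "\<exists>r\<in>\<rat>. p y < r \<and> r < q y" if "y \<in> ?C" for y
    using Rats_dense_in_real[of "p y" "q y"] that by auto
  then obtain r where r: "\<And>y. y \<in> ?C \<Longrightarrow> r y \<in> \<rat> \<and> p y < r y \<and> r y < q y" by metis
  have "g (r y) = y" if "y \<in> ?C" for y using r[OF that] g_between[of y "r y"] that by auto
  then have "inj_on r ?C" by (intro inj_on_inverseI[of _ g])
  moreover have "r ` ?C \<subseteq> \<rat>" using r by blast
  then have "countable (r ` ?C)" using countable_rat by (rule countable_subset)
  ultimately show ?thesis by (rule countable_image_inj_on[rotated])
qed

text \<open>
  At the level of a plateau, subintervals to the left of the level come from times near \<open>p y\<close> and those to the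
  right of it from times near \<open>q y\<close>; this weight measures the discrepancy between the two tags.
\<close>
definition plateau_weight :: "(real \<Rightarrow> 'a::real_normed_vector) \<Rightarrow> real \<Rightarrow> real"
  where "plateau_weight f y = (if y \<in> {g a..g b} then norm (f (p y) - f (q y)) else 0)"

lemma ward_plateau_weight: "ward (plateau_weight f) (\<lambda>y. y) (\<lambda>_. 0) (g a) (g b)"
proof (rule ward_countable_support[OF _ g_ab])
  have "plateau_weight f y = 0" if "y \<notin> {y \<in> {g a..g b}. p y < q y}" for y
    using that p_le_q[of y] unfolding plateau_weight_def by (cases "p y = q y") auto
  then have "{y. plateau_weight f y \<noteq> 0} \<subseteq> {y \<in> {g a..g b}. p y < q y}" by blast
  then show "countable {y. plateau_weight f y \<noteq> 0}" by (rule countable_subset[OF _ countable_plateaus])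
qed

text \<open>
  Left of a tag \<open>\<tau>\<close> the increments of \<open>g\<close> are small by left-continuity, so the estimate at the level
  \<open>g \<tau>\<close> applies, up to the plateau weight.  Right of \<open>\<tau>\<close>, let \<open>L = g (\<tau>+)\<close>.  On the gap \<open>[g \<tau>, L)\<close> the
  transformed integrand is the constant \<open>f \<tau>\<close>, hence contributes no error, and on \<open>[L, g t]\<close> the
  estimate at the level \<open>L\<close> applies.
\<close>
lemma ward_backward:
  fixes f :: "real \<Rightarrow> 'a::euclidean_space"
  assumes int: "(\<lambda>y. f (q y)) integrable_on {g a..g b}"
  shows "ward f g (\<lambda>t. integral {g a..g t} (\<lambda>y. f (q y))) a b"
proof (rule ward_one_sidedI[of 2])
  define F where "F y = f (q y)" for y
  define \<Psi> where "\<Psi> y = integral {g a..y} F" for y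
  have wF: "ward F (\<lambda>y. y) \<Psi> (g a) (g b)"
    unfolding \<Psi>_def F_def by (rule integrable_imp_ward[OF int g_ab])
  have intF: "F integrable_on {g a..g b}" using int unfolding F_def .
  fix \<epsilon> :: real assume "\<epsilon> > 0"
  from ward_gauge[OF wF this] obtain \<xi> \<delta>
    where E: "ward_error F (\<lambda>y. y) \<Psi> (g a) (g b) \<xi> \<delta>" "\<xi> (g b) - \<xi> (g a) \<le> \<epsilon>" by blast
  note \<xi> = ward_errorD(1)[OF E(1)] E(2) ward_errorD(2)[OF E(1)] and est = ward_errorD(3)[OF E(1)]
  from ward_gauge[OF ward_plateau_weight \<open>\<epsilon> > 0\<close>, of f] obtain \<xi>0 \<delta>0
    where E0: "ward_error (plateau_weight f) (\<lambda>y. y) (\<lambda>_. 0) (g a) (g b) \<xi>0 \<delta>0" "\<xi>0 (g b) - \<xi>0 (g a) \<le> \<epsilon>" by blast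
  note \<xi>0 = ward_errorD(1)[OF E0(1)] E0(2) ward_errorD(2)[OF E0(1)]
    and est0 = ward_errorD(3)[OF E0(1), unfolded diff_zero]
  define X where "X t = \<xi> (g t) + \<xi>0 (g t)" for t
  have \<xi>m: "\<xi> (g s) \<le> \<xi> (g t)" "\<xi>0 (g s) \<le> \<xi>0 (g t)" if "a \<le> s" "s \<le> t" "t \<le> b" for s t
    using that g_in[of s] g_in[of t] g_mono[OF that] mono_onD[OF \<xi>(1)] mono_onD[OF \<xi>0(1)] by auto
  have Xmono: "X s \<le> X t" if "a \<le> s" "s \<le> t" "t \<le> b" for s t
    using \<xi>m[OF that] unfolding X_def by simp
  show "\<exists>\<xi>. mono_on {a..b} \<xi> \<and> \<xi> b - \<xi> a \<le> 2 * \<epsilon> \<and> (\<forall>\<tau>\<in>{a..b}.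
        (\<exists>d>0. \<forall>s. a \<le> s \<and> s < \<tau> \<and> \<tau> - d < s \<longrightarrow> norm ((g \<tau> - g s) *\<^sub>R f \<tau> - (integral {g a..g \<tau>} (\<lambda>y. f (q y)) - integral {g a..g s} (\<lambda>y. f (q y)))) \<le> \<xi> \<tau> - \<xi> s) \<and>
        (\<exists>d>0. \<forall>t. \<tau> < t \<and> t \<le> b \<and> t < \<tau> + d \<longrightarrow> norm ((g t - g \<tau>) *\<^sub>R f \<tau> - (integral {g a..g t} (\<lambda>y. f (q y)) - integral {g a..g \<tau>} (\<lambda>y. f (q y)))) \<le> \<xi> t - \<xi> \<tau>))"
    unfolding F_def[symmetric] \<Psi>_def[symmetric]
  proof (rule exI[of _ X], intro conjI ballI)
    show "mono_on {a..b} X" by (rule mono_onI) (use Xmono in auto)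
    show "X b - X a \<le> 2 * \<epsilon>" using \<xi>(2) \<xi>0(2) unfolding X_def by simp
  next
    fix \<tau> assume \<tau>: "\<tau> \<in> {a..b}"
    define \<eta> where "\<eta> = g \<tau>"
    have \<eta>: "\<eta> \<in> {g a..g b}" unfolding \<eta>_def by (rule g_in[OF \<tau>])
    show "\<exists>d>0. \<forall>s. a \<le> s \<and> s < \<tau> \<and> \<tau> - d < s \<longrightarrow> norm ((g \<tau> - g s) *\<^sub>R f \<tau> - (\<Psi> (g \<tau>) - \<Psi> (g s))) \<le> X \<tau> - X s"
    proof (cases "\<exists>s1. a \<le> s1 \<and> s1 < \<tau> \<and> g s1 = \<eta>")
      case True
      then obtain s1 where s1: "a \<le> s1" "s1 < \<tau>" "g s1 = \<eta>" by blast
      have "g s = g \<tau>" if "s1 < s" "s < \<tau>" for s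
        using that s1 g_mono[of s1 s] g_mono[of s \<tau>] \<tau> unfolding \<eta>_def by auto
      then show ?thesis using s1 Xmono \<tau> by (intro exI[of _ "\<tau> - s1"]) auto
    next
      case False
      then have lt: "g s < \<eta>" if "a \<le> s" "s < \<tau>" for s
        using that g_mono[of s \<tau>] \<tau> unfolding \<eta>_def by force
      have "p \<eta> = \<tau>"
      proof (rule antisym)
        show "p \<eta> \<le> \<tau>" using p_le[of \<tau> \<eta>] \<tau> unfolding \<eta>_def by simp
        show "\<tau> \<le> p \<eta>" unfolding p_def
          by (rule cInf_greatest) (use \<tau> lt in \<open>auto simp: \<eta>_def not_less[symmetric]\<close>)
      qed
      show ?thesis
      proof (cases "\<tau> = a")
        case True then show ?thesis by (intro exI[of _ 1]) auto
      next
        case False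
        have "min (\<delta> \<eta>) (\<delta>0 \<eta>) > 0" using \<xi>(3) \<xi>0(3) by simp
        from g_left[OF _ _ this, of \<tau>] obtain d where d: "d > 0"
          "\<And>s. a \<le> s \<Longrightarrow> \<tau> - d < s \<Longrightarrow> s < \<tau> \<Longrightarrow> g \<tau> - min (\<delta> \<eta>) (\<delta>0 \<eta>) < g s" using False \<tau> by auto
        show ?thesis
        proof (intro exI[of _ d] conjI d allI impI)
          fix s assume s: "a \<le> s \<and> s < \<tau> \<and> \<tau> - d < s"
          then have c: "\<eta> - \<delta> \<eta> < g s" "\<eta> - \<delta>0 \<eta> < g s" using d(2)[of s] unfolding \<eta>_def by auto
          have l: "g a \<le> g s" "g s \<le> \<eta>" "\<eta> \<le> g b" using s \<tau> g_mono unfolding \<eta>_def by auto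
          have 1: "norm ((\<eta> - g s) *\<^sub>R F \<eta> - (\<Psi> \<eta> - \<Psi> (g s))) \<le> \<xi> \<eta> - \<xi> (g s)"
            using est[of "g s" \<eta> \<eta>] c l \<xi>(3)[of \<eta>] by auto
          have "norm ((\<eta> - g s) *\<^sub>R plateau_weight f \<eta>) \<le> \<xi>0 \<eta> - \<xi>0 (g s)"
            using est0[of "g s" \<eta> \<eta>] c l \<xi>0(3)[of \<eta>] by auto
          then have 2: "norm ((\<eta> - g s) *\<^sub>R (f \<tau> - F \<eta>)) \<le> \<xi>0 \<eta> - \<xi>0 (g s)"
            unfolding plateau_weight_def F_def using \<eta> \<open>p \<eta> = \<tau>\<close> by simp
          have "(\<eta> - g s) *\<^sub>R f \<tau> - (\<Psi> \<eta> - \<Psi> (g s)) = ((\<eta> - g s) *\<^sub>R F \<eta> - (\<Psi> \<eta> - \<Psi> (g s))) + (\<eta> - g s) *\<^sub>R (f \<tau> - F \<eta>)"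
            by (simp add: algebra_simps)
          also have "norm \<dots> \<le> (\<xi> \<eta> - \<xi> (g s)) + (\<xi>0 \<eta> - \<xi>0 (g s))"
            by (rule norm_triangle_mono[OF 1 2])
          finally have "norm ((\<eta> - g s) *\<^sub>R f \<tau> - (\<Psi> \<eta> - \<Psi> (g s))) \<le> (\<xi> \<eta> - \<xi> (g s)) + (\<xi>0 \<eta> - \<xi>0 (g s))" .
          then show "norm ((g \<tau> - g s) *\<^sub>R f \<tau> - (\<Psi> (g \<tau>) - \<Psi> (g s))) \<le> X \<tau> - X s"
            unfolding X_def \<eta>_def by simp
        qed
      qed
    qed
    show "\<exists>d>0. \<forall>t. \<tau> < t \<and> t \<le> b \<and> t < \<tau> + d \<longrightarrow> norm ((g t - g \<tau>) *\<^sub>R f \<tau> - (\<Psi> (g t) - \<Psi> (g \<tau>))) \<le> X t - X \<tau>"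
    proof (cases "\<tau> = b \<or> (\<exists>t1. \<tau> < t1 \<and> t1 \<le> b \<and> g t1 = \<eta>)")
      case True
      then consider "\<tau> = b" | t1 where "\<tau> < t1" "t1 \<le> b" "g t1 = \<eta>" by blast
      then show ?thesis
      proof cases
        case 1 then show ?thesis by (intro exI[of _ 1]) auto
      next
        case 2
        have "g t = g \<tau>" if "\<tau> < t" "t < t1" for t
          using that 2 g_mono[of \<tau> t] g_mono[of t t1] \<tau> unfolding \<eta>_def by auto
        then show ?thesis using 2 Xmono \<tau> by (intro exI[of _ "t1 - \<tau>"]) auto
      qed
    next
      case False
      then have "\<tau> < b" using \<tau> by auto
      have gt: "\<eta> < g t" if "\<tau> < t" "t \<le> b" for t
        using False that g_mono[of \<tau> t] \<tau> unfolding \<eta>_def by force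
      define L where "L = Inf (g ` {\<tau><..b})"
      have ne: "g ` {\<tau><..b} \<noteq> {}" using \<open>\<tau> < b\<close> by auto
      have bdd: "bdd_below (g ` {\<tau><..b})" using gt by (intro bdd_belowI[of _ \<eta>]) (auto intro: less_imp_le)
      have L1: "L \<le> g t" if "\<tau> < t" "t \<le> b" for t
        unfolding L_def using that bdd by (intro cInf_lower) auto
      have L2: "\<eta> \<le> L" unfolding L_def using ne gt by (intro cInf_greatest) (auto intro: less_imp_le)
      have Lin: "L \<in> {g a..g b}" using L2 L1[of b] \<eta> \<open>\<tau> < b\<close> by auto
      have qeq: "q y = \<tau>" if "y \<in> {g a..g b}" "\<eta> \<le> y" "\<And>t. \<tau> < t \<Longrightarrow> t \<le> b \<Longrightarrow> y < g t" for y
      proof (rule antisym)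
        show "\<tau> \<le> q y" using galois[of y \<tau>] that \<tau> unfolding \<eta>_def by auto
        show "q y \<le> \<tau>"
        proof (rule ccontr)
          assume "\<not> q y \<le> \<tau>"
          then have "y < g (q y)" using that(3)[of "q y"] q_in[OF that(1)] by auto
          then show False using gq_le[OF that(1)] by simp
        qed
      qed
      have jump: "\<Psi> L - \<Psi> \<eta> = (L - \<eta>) *\<^sub>R f \<tau>"
      proof -
        have "integral {g a..\<eta>} F + integral {\<eta>..L} F = integral {g a..L} F"
          using \<eta> Lin L2 by (intro Henstock_Kurzweil_Integration.integral_combine integrable_subinterval_real[OF intF]) auto
        then have "\<Psi> L - \<Psi> \<eta> = integral {\<eta>..L} F" unfolding \<Psi>_def by (metis add_diff_cancel_left')
        also have "\<dots> = integral {\<eta>..L} (\<lambda>_. f \<tau>)"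
        proof (rule integral_spike[of "{L}"])
          fix y assume "y \<in> {\<eta>..L} - {L}"
          then have y: "\<eta> \<le> y" "y < L" by auto
          have "q y = \<tau>" using y L1 Lin \<eta> by (intro qeq) (auto intro: less_le_trans)
          then show "f \<tau> = F y" unfolding F_def by simp
        qed auto
        also have "\<dots> = (L - \<eta>) *\<^sub>R f \<tau>" using L2 by simp
        finally show ?thesis .
      qed
      show ?thesis
      proof (cases "\<exists>t1. \<tau> < t1 \<and> t1 \<le> b \<and> g t1 = L")
        case True
        then obtain t1 where t1: "\<tau> < t1" "t1 \<le> b" "g t1 = L" by blast
        have "g t = L" if "\<tau> < t" "t < t1" for t
          using L1[of t] g_mono[of t t1] that t1 \<tau> by auto
        then show ?thesis using t1 Xmono \<tau> jump unfolding \<eta>_def by (intro exI[of _ "t1 - \<tau>"]) auto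
      next
        case False
        have "q L = \<tau>" using L1 L2 Lin False by (intro qeq) (auto simp: order.strict_iff_order)
        then have FL: "F L = f \<tau>" unfolding F_def by simp
        have "\<exists>x\<in>g ` {\<tau><..b}. x < L + \<delta> L"
          using ne bdd \<xi>(3)[of L] unfolding L_def by (subst cInf_less_iff[symmetric]) auto
        then obtain t1 where t1: "\<tau> < t1" "t1 \<le> b" "g t1 < L + \<delta> L" by auto
        show ?thesis
        proof (rule exI[of _ "t1 - \<tau>"], intro conjI allI impI)
          fix t assume t: "\<tau> < t \<and> t \<le> b \<and> t < \<tau> + (t1 - \<tau>)"
          then have "g t \<le> g t1" using g_mono[of t t1] \<tau> t1 by auto
          then have "norm ((g t - L) *\<^sub>R F L - (\<Psi> (g t) - \<Psi> L)) \<le> \<xi> (g t) - \<xi> L"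
            using est[of L L "g t"] L1[of t] Lin t t1 g_mono[of t b] \<tau> \<xi>(3)[of L] by auto
          moreover have eq: "(g t - g \<tau>) *\<^sub>R f \<tau> - (\<Psi> (g t) - \<Psi> (g \<tau>)) = (g t - L) *\<^sub>R F L - (\<Psi> (g t) - \<Psi> L)"
            using jump unfolding FL \<eta>_def by (simp add: algebra_simps)
          moreover have "\<xi> (g \<tau>) \<le> \<xi> L" using mono_onD[OF \<xi>(1) \<eta> Lin L2] unfolding \<eta>_def .
          moreover have "\<xi>0 (g \<tau>) \<le> \<xi>0 (g t)" using \<xi>m[of \<tau> t] t \<tau> by auto
          ultimately show "norm ((g t - g \<tau>) *\<^sub>R f \<tau> - (\<Psi> (g t) - \<Psi> (g \<tau>))) \<le> X t - X \<tau>"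
            unfolding X_def eq by linarith
        qed (use t1 in auto)
      qed
    qed
  qed
qed simp

text \<open>
  The transformed indefinite integral agrees with \<open>\<Phi>\<close> at the levels \<open>g t\<close> and is affine on the gaps
  left by jumps.  For a subinterval from the tag \<open>\<eta>\<close> to a level \<open>y\<close> that lies in the gap at a time \<open>t\<close> other
  than \<open>\<tau> = q \<eta>\<close>, there appears the extra term \<open>(y - g t) (f \<tau> - f t)\<close>.  It is controlled by comparing the
  estimates for the tags \<open>\<tau>\<close> and \<open>t\<close> on \<open>[t,t']\<close> for \<open>t' > t\<close> close to \<open>t\<close>, where \<open>y < g t'\<close>; this
  produces the right limit \<open>\<xi>p t\<close> of the error function \<open>\<xi>\<close>.
\<close>
lemma ward_forward:
  fixes f \<Phi> :: "real \<Rightarrow> 'a::real_normed_vector"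
  assumes w: "ward f g \<Phi> a b"
  shows "ward (\<lambda>y. f (q y)) (\<lambda>y. y) (\<lambda>y. \<Phi> (q y) + (y - g (q y)) *\<^sub>R f (q y)) (g a) (g b)"
proof (rule ward_one_sidedI[of 7])
  define \<Psi> where "\<Psi> y = \<Phi> (q y) + (y - g (q y)) *\<^sub>R f (q y)" for y
  fix \<epsilon> :: real assume "\<epsilon> > 0"
  from ward_gauge[OF w this] obtain \<xi> \<delta>
    where E: "ward_error f g \<Phi> a b \<xi> \<delta>" "\<xi> b - \<xi> a \<le> \<epsilon>" by blast
  note \<xi> = ward_errorD(1)[OF E(1)] E(2) ward_errorD(2)[OF E(1)] and est = ward_errorD(3)[OF E(1)]
  from ward_gauge[OF ward_plateau_weight \<open>\<epsilon> > 0\<close>, of f] obtain \<xi>0 \<delta>0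
    where E0: "ward_error (plateau_weight f) (\<lambda>y. y) (\<lambda>_. 0) (g a) (g b) \<xi>0 \<delta>0" "\<xi>0 (g b) - \<xi>0 (g a) \<le> \<epsilon>" by blast
  note \<xi>0 = ward_errorD(1)[OF E0(1)] E0(2) ward_errorD(2)[OF E0(1)]
    and est0 = ward_errorD(3)[OF E0(1), unfolded diff_zero]
  have \<xi>m: "\<xi> s \<le> \<xi> t" if "a \<le> s" "s \<le> t" "t \<le> b" for s t
    using that mono_onD[OF \<xi>(1), of s t] by auto
  define \<xi>p where "\<xi>p t = (if t < b then Inf (\<xi> ` {t<..b}) else \<xi> b)" for t
  have p_upper: "\<xi>p s \<le> \<xi> t" if "a \<le> s" "s < t" "t \<le> b" for s t
  proof -
    have "bdd_below (\<xi> ` {s<..b})" using \<xi>m that by (intro bdd_belowI[of _ "\<xi> s"]) auto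
    then show ?thesis unfolding \<xi>p_def using that by (auto intro: cInf_lower)
  qed
  have p_lower: "c \<le> \<xi>p t" if "a \<le> t" "t \<le> b" "c \<le> \<xi> b" "\<And>t'. t < t' \<Longrightarrow> t' \<le> b \<Longrightarrow> c \<le> \<xi> t'" for c t
    unfolding \<xi>p_def using that by (auto intro: cInf_greatest)
  have p_ge: "\<xi> t \<le> \<xi>p t" if "a \<le> t" "t \<le> b" for t using p_lower[of t "\<xi> t"] \<xi>m that by auto
  have p_le_b: "\<xi>p t \<le> \<xi> b" if "a \<le> t" "t \<le> b" for t
    using p_upper[of t b] that by (cases "t = b") (auto simp: \<xi>p_def)
  have p_mono: "\<xi>p s \<le> \<xi>p t" if "a \<le> s" "s \<le> t" "t \<le> b" for s t
    using p_upper[of s t] p_ge[of t] that by (cases "s = t") auto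
  \<comment> \<open>both \<open>\<xi> \<circ> q\<close> and \<open>\<xi>p \<circ> q\<close> are needed: over \<open>[\<eta>,y]\<close> as above they increase together by at least
    \<open>\<xi>p t - \<xi> \<tau>\<close>, because \<open>\<xi>p \<tau> \<le> \<xi> t\<close>\<close>
  define X where "X y = 3 * (\<xi> (q y) + \<xi>p (q y)) + \<xi>0 y" for y
  have Xmono: "X y \<le> X y'" if "y \<in> {g a..g b}" "y' \<in> {g a..g b}" "y \<le> y'" for y y'
    using \<xi>m[of "q y" "q y'"] p_mono[of "q y" "q y'"] q_mono[OF that] q_in[OF that(1)] q_in[OF that(2)]
      mono_onD[OF \<xi>0(1) that] unfolding X_def by auto
  show "\<exists>\<xi>. mono_on {g a..g b} \<xi> \<and> \<xi> (g b) - \<xi> (g a) \<le> 7 * \<epsilon> \<and> (\<forall>\<tau>\<in>{g a..g b}.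
        (\<exists>d>0. \<forall>s. g a \<le> s \<and> s < \<tau> \<and> \<tau> - d < s \<longrightarrow> norm ((\<tau> - s) *\<^sub>R f (q \<tau>) - ((\<Phi> (q \<tau>) + (\<tau> - g (q \<tau>)) *\<^sub>R f (q \<tau>)) - (\<Phi> (q s) + (s - g (q s)) *\<^sub>R f (q s)))) \<le> \<xi> \<tau> - \<xi> s) \<and>
        (\<exists>d>0. \<forall>t. \<tau> < t \<and> t \<le> g b \<and> t < \<tau> + d \<longrightarrow> norm ((t - \<tau>) *\<^sub>R f (q \<tau>) - ((\<Phi> (q t) + (t - g (q t)) *\<^sub>R f (q t)) - (\<Phi> (q \<tau>) + (\<tau> - g (q \<tau>)) *\<^sub>R f (q \<tau>)))) \<le> \<xi> t - \<xi> \<tau>))"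
    unfolding \<Psi>_def[symmetric]
  proof (rule exI[of _ X], intro conjI ballI)
    show "mono_on {g a..g b} X" by (rule mono_onI) (use Xmono in auto)
    have qa: "q (g a) \<in> {a..b}" "q (g b) \<in> {a..b}" using q_in g_ab by auto
    have "\<xi> a \<le> \<xi> (q (g a))" "\<xi> (q (g b)) \<le> \<xi> b" using \<xi>m[of a "q (g a)"] \<xi>m[of "q (g b)" b] qa by auto
    moreover have "\<xi> (q (g a)) \<le> \<xi>p (q (g a))" "\<xi>p (q (g b)) \<le> \<xi> b" using p_ge p_le_b qa by auto
    ultimately show "X (g b) - X (g a) \<le> 7 * \<epsilon>" using \<xi>(2) \<xi>0(2) unfolding X_def by argo
  next
    fix \<eta> assume \<eta>: "\<eta> \<in> {g a..g b}"
    define \<tau> where "\<tau> = q \<eta>"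
    have \<tau>: "\<tau> \<in> {a..b}" "g \<tau> \<le> \<eta>" unfolding \<tau>_def using q_in[OF \<eta>] gq_le[OF \<eta>] by auto
    show "\<exists>d>0. \<forall>t. \<eta> < t \<and> t \<le> g b \<and> t < \<eta> + d \<longrightarrow> norm ((t - \<eta>) *\<^sub>R f (q \<eta>) - (\<Psi> t - \<Psi> \<eta>)) \<le> X t - X \<eta>"
    proof -
      have "\<exists>d>0. \<forall>y. \<eta> < y \<and> y \<le> g b \<and> y < \<eta> + d \<longrightarrow> q y < \<tau> + \<delta> \<tau>"
      proof (cases "\<tau> = b")
        case True
        then have "q y < \<tau> + \<delta> \<tau>" if "\<eta> < y" "y \<le> g b" for y
          using that q_in[of y] \<eta> \<xi>(3)[of \<tau>] by auto
        then show ?thesis by (intro exI[of _ 1]) auto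
      next
        case False
        then obtain t1 where t1: "\<tau> < t1" "t1 < b" "t1 < \<tau> + \<delta> \<tau>" 
          using dense[of \<tau> "min b (\<tau> + \<delta> \<tau>)"] \<tau> \<xi>(3)[of \<tau>] by auto
        have "\<eta> < g t1" using q_less[OF \<eta>, of t1] t1 \<tau> unfolding \<tau>_def by auto
        moreover have "q y < t1" if "\<eta> < y" "y \<le> g b" "y < g t1" for y
          using q_less[of y t1] that t1 \<tau> \<eta> by auto
        ultimately show ?thesis using t1 by (intro exI[of _ "g t1 - \<eta>"]) fastforce
      qed
      then obtain d where d: "d > 0" "\<And>y. \<eta> < y \<Longrightarrow> y \<le> g b \<Longrightarrow> y < \<eta> + d \<Longrightarrow> q y < \<tau> + \<delta> \<tau>" by blast
      show ?thesis
      proof (intro exI[of _ d] conjI d allI impI)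
        fix y assume y: "\<eta> < y \<and> y \<le> g b \<and> y < \<eta> + d"
        then have y_in: "y \<in> {g a..g b}" using \<eta> by auto
        define t where "t = q y"
        have t: "t \<in> {a..b}" "g t \<le> y" "\<tau> \<le> t" "t < \<tau> + \<delta> \<tau>"
          unfolding t_def using q_in[OF y_in] gq_le[OF y_in] q_mono[OF \<eta> y_in] d(2)[of y] y by (auto simp: \<tau>_def)
        show "norm ((y - \<eta>) *\<^sub>R f (q \<eta>) - (\<Psi> y - \<Psi> \<eta>)) \<le> X y - X \<eta>"
        proof (cases "t = \<tau>")
          case True
          then have "(y - \<eta>) *\<^sub>R f (q \<eta>) - (\<Psi> y - \<Psi> \<eta>) = 0"
            unfolding \<Psi>_def t_def[symmetric] \<tau>_def[symmetric] by (simp add: algebra_simps)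
          then show ?thesis using Xmono[OF \<eta> y_in] y by simp
        next
          case False
          then have "\<tau> < t" using t by simp
          have main: "norm ((g t - g \<tau>) *\<^sub>R f \<tau> - (\<Phi> t - \<Phi> \<tau>)) \<le> \<xi> t - \<xi> \<tau>"
            using est[of \<tau> \<tau> t] \<tau> t \<xi>(3)[of \<tau>] by auto
          define c where "c = norm ((y - g t) *\<^sub>R (f \<tau> - f t))"
          have "c / 2 + \<xi> \<tau> \<le> \<xi>p t"
          proof (rule p_lower)
            have near: "c / 2 + \<xi> \<tau> \<le> \<xi> t'" if "t < t'" "t' \<le> b" "t' < t + \<delta> t" "t' < \<tau> + \<delta> \<tau>" for t'
            proof -
              have "y < g t'" using q_less[OF y_in, of t'] that t unfolding t_def by auto
              then have "c \<le> norm ((g t' - g t) *\<^sub>R (f \<tau> - f t))"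
                unfolding c_def norm_scaleR using t by (intro mult_right_mono) auto
              also have "(g t' - g t) = (g t' - g \<tau>) - (g t - g \<tau>)" by simp
              also have "norm (((g t' - g \<tau>) - (g t - g \<tau>)) *\<^sub>R (f \<tau> - f t)) \<le> (\<xi> t' - \<xi> \<tau>) + (\<xi> t - \<xi> \<tau>) + (\<xi> t' - \<xi> t)"
              proof (rule scaled_difference_bound[OF _ main])
                show "norm ((g t' - g \<tau>) *\<^sub>R f \<tau> - (\<Phi> t' - \<Phi> \<tau>)) \<le> \<xi> t' - \<xi> \<tau>"
                  using est[of \<tau> \<tau> t'] \<tau> t that \<xi>(3)[of \<tau>] by auto
                have "norm ((g t' - g t) *\<^sub>R f t - (\<Phi> t' - \<Phi> t)) \<le> \<xi> t' - \<xi> t"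
                  using est[of t t t'] t that \<xi>(3)[of t] by auto
                then show "norm ((g t' - g \<tau> - (g t - g \<tau>)) *\<^sub>R f t - (\<Phi> t' - \<Phi> \<tau> - (\<Phi> t - \<Phi> \<tau>))) \<le> \<xi> t' - \<xi> t"
                  by simp
              qed
              finally show ?thesis by simp
            qed
            have far: "c / 2 + \<xi> \<tau> \<le> \<xi> t'" if tt: "t < t'" "t' \<le> b" for t'
            proof -
              obtain t'' where "t < t''" "t'' < t'" "t'' < t + \<delta> t" "t'' < \<tau> + \<delta> \<tau>"
                using dense[of t "min t' (min (t + \<delta> t) (\<tau> + \<delta> \<tau>))"] tt t \<xi>(3)[of t] by auto
              then show ?thesis using near[of t''] \<xi>m[of t'' t'] tt t by auto
            qed
            then show "\<And>t'. t < t' \<Longrightarrow> t' \<le> b \<Longrightarrow> c / 2 + \<xi> \<tau> \<le> \<xi> t'" .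
            show "c / 2 + \<xi> \<tau> \<le> \<xi> b"
            proof (cases "t = b")
              case True
              then have "c = 0" unfolding c_def using y t by auto
              then show ?thesis using \<xi>m[of \<tau> b] \<tau> by auto
            qed (use far t in auto)
          qed (use t in auto)
          then have c: "norm ((y - g t) *\<^sub>R (f \<tau> - f t)) \<le> 2 * (\<xi>p t - \<xi> \<tau>)" unfolding c_def by simp
          have "(y - \<eta>) *\<^sub>R f (q \<eta>) - (\<Psi> y - \<Psi> \<eta>) = ((g t - g \<tau>) *\<^sub>R f \<tau> - (\<Phi> t - \<Phi> \<tau>)) + (y - g t) *\<^sub>R (f \<tau> - f t)"
            unfolding \<Psi>_def t_def[symmetric] \<tau>_def[symmetric] by (simp add: algebra_simps)
          also have "norm \<dots> \<le> (\<xi> t - \<xi> \<tau>) + 2 * (\<xi>p t - \<xi> \<tau>)"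
            by (rule norm_triangle_mono[OF main c])
          finally have fin: "norm ((y - \<eta>) *\<^sub>R f (q \<eta>) - (\<Psi> y - \<Psi> \<eta>)) \<le> (\<xi> t - \<xi> \<tau>) + 2 * (\<xi>p t - \<xi> \<tau>)" .
          have "\<xi> t \<le> \<xi>p t" "\<xi>p \<tau> \<le> \<xi> t" "\<xi>0 \<eta> \<le> \<xi>0 y" "\<xi> \<tau> \<le> \<xi> t"
            using p_ge[of t] p_upper[of \<tau> t] mono_onD[OF \<xi>0(1) \<eta> y_in] \<xi>m[of \<tau> t] y t \<tau> \<open>\<tau> < t\<close> by auto
          then show ?thesis using fin unfolding X_def t_def[symmetric] \<tau>_def[symmetric] by argo
        qed
      qed
    qed
    show "\<exists>d>0. \<forall>y. g a \<le> y \<and> y < \<eta> \<and> \<eta> - d < y \<longrightarrow> norm ((\<eta> - y) *\<^sub>R f (q \<eta>) - (\<Psi> \<eta> - \<Psi> y)) \<le> X \<eta> - X y"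
    proof -
      \<comment> \<open>to the left of the level \<open>\<eta>\<close> the relevant tag is the first time \<open>p \<eta>\<close>\<close>
      define r where "r = p \<eta>"
      have r: "r \<in> {a..b}" "g r \<le> \<eta>" "r \<le> \<tau>" unfolding r_def \<tau>_def using p_in[OF \<eta>] gp_le[OF \<eta>] p_le_q[OF \<eta>] .
      have between: "g t = \<eta>" if "r < t" "t \<le> \<tau>" for t using g_between[OF \<eta>] that unfolding r_def \<tau>_def by auto
      have \<Psi>\<eta>: "\<Psi> \<eta> = \<Phi> r + (\<eta> - g r) *\<^sub>R f r"
      proof (cases "r = \<tau>")
        case True then show ?thesis unfolding \<Psi>_def \<tau>_def[symmetric] by simp
      next
        case False
        then have "r < \<tau>" using r by simp
        have "\<Phi> \<tau> - \<Phi> r = (g \<tau> - g r) *\<^sub>R f r"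
          using \<open>r < \<tau>\<close> r \<tau> between by (intro ward_const_integrator[OF w]) auto
        moreover have "g \<tau> = \<eta>" using between[of \<tau>] \<open>r < \<tau>\<close> by simp
        ultimately show ?thesis unfolding \<Psi>_def \<tau>_def[symmetric] by (simp add: algebra_simps)
      qed
      have "\<exists>d>0. \<forall>y. g a \<le> y \<and> y < \<eta> \<and> \<eta> - d < y \<longrightarrow> q y \<le> r \<and> norm ((\<eta> - y) *\<^sub>R f r - (\<Psi> \<eta> - \<Psi> y)) \<le> 3 * (\<xi> r - \<xi> (q y))"
      proof (cases "g r < \<eta>")
        case True
        show ?thesis
        proof (rule exI[of _ "\<eta> - g r"], intro conjI allI impI)
          fix y assume y: "g a \<le> y \<and> y < \<eta> \<and> \<eta> - (\<eta> - g r) < y"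
          then have y_in: "y \<in> {g a..g b}" using \<eta> by auto
          have "r \<le> q y" using galois[OF y_in r(1)] y by simp
          moreover have "q y \<le> r"
          proof (rule ccontr)
            assume "\<not> q y \<le> r"
            then have "\<eta> \<le> g (q y)" using p_less[OF \<eta> q_in[OF y_in]] unfolding r_def by simp
            then show False using gq_le[OF y_in] y by simp
          qed
          ultimately have qy: "q y = r" by simp
          show "q y \<le> r" using qy by simp
          have "(\<eta> - y) *\<^sub>R f r - (\<Psi> \<eta> - \<Psi> y) = 0"
            unfolding \<Psi>\<eta> unfolding \<Psi>_def qy by (simp add: algebra_simps)
          then show "norm ((\<eta> - y) *\<^sub>R f r - (\<Psi> \<eta> - \<Psi> y)) \<le> 3 * (\<xi> r - \<xi> (q y))" using qy by simp
        qed (use True in auto)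
      next
        case False
        then have gr: "g r = \<eta>" using r by simp
        show ?thesis
        proof (cases "r = a")
          case True
          then show ?thesis using gr by (intro exI[of _ 1]) auto
        next
          case False
          define t1 where "t1 = max a (r - \<delta> r / 2)"
          have t1: "a \<le> t1" "t1 < r" "r - \<delta> r < t1" unfolding t1_def using False r \<xi>(3)[of r] by (auto simp: max_def)
          have "g t1 < \<eta>" using less_p[of t1 \<eta>] t1 r unfolding r_def by auto
          show ?thesis
          proof (rule exI[of _ "\<eta> - g t1"], intro conjI allI impI)
            fix y assume y: "g a \<le> y \<and> y < \<eta> \<and> \<eta> - (\<eta> - g t1) < y"
            then have y_in: "y \<in> {g a..g b}" using \<eta> by auto
            define s where "s = q y"
            have s: "s \<in> {a..b}" "g s \<le> y" unfolding s_def using q_in[OF y_in] gq_le[OF y_in] .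
            have "s < r" using q_less[OF y_in r(1)] gr y unfolding s_def by simp
            have "t1 \<le> s" using galois[OF y_in, of t1] t1 r y unfolding s_def by auto
            show "q y \<le> r" using \<open>s < r\<close> unfolding s_def by simp
            have main: "norm ((g r - g s) *\<^sub>R f r - (\<Phi> r - \<Phi> s)) \<le> \<xi> r - \<xi> s"
              using est[of s r r] s r \<open>s < r\<close> \<open>t1 \<le> s\<close> t1 \<xi>(3)[of r] by auto
            obtain t' where t': "s < t'" "t' < r" "t' < s + \<delta> s"
              using dense[of s "min r (s + \<delta> s)"] \<open>s < r\<close> \<xi>(3)[of s] by auto
            have "y < g t'" using q_less[OF y_in, of t'] t' s r unfolding s_def by auto
            then have "norm ((y - g s) *\<^sub>R (f r - f s)) \<le> norm ((g t' - g s) *\<^sub>R (f r - f s))"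
              unfolding norm_scaleR using s by (intro mult_right_mono) auto
            also have "g t' - g s = (g r - g s) - (g r - g t')" by simp
            also have "norm (((g r - g s) - (g r - g t')) *\<^sub>R (f r - f s)) \<le> (\<xi> r - \<xi> s) + (\<xi> r - \<xi> t') + (\<xi> t' - \<xi> s)"
            proof (rule scaled_difference_bound[OF main])
              show "norm ((g r - g t') *\<^sub>R f r - (\<Phi> r - \<Phi> t')) \<le> \<xi> r - \<xi> t'"
                using est[of t' r r] s r t' \<open>t1 \<le> s\<close> t1 \<xi>(3)[of r] by auto
              have "norm ((g t' - g s) *\<^sub>R f s - (\<Phi> t' - \<Phi> s)) \<le> \<xi> t' - \<xi> s"
                using est[of s s t'] s r t' \<xi>(3)[of s] by auto
              then show "norm ((g r - g s - (g r - g t')) *\<^sub>R f s - (\<Phi> r - \<Phi> s - (\<Phi> r - \<Phi> t'))) \<le> \<xi> t' - \<xi> s"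
                by simp
            qed
            finally have c: "norm ((y - g s) *\<^sub>R (f r - f s)) \<le> 2 * (\<xi> r - \<xi> s)" by simp
            have "(\<eta> - y) *\<^sub>R f r - (\<Psi> \<eta> - \<Psi> y) = ((g r - g s) *\<^sub>R f r - (\<Phi> r - \<Phi> s)) - (y - g s) *\<^sub>R (f r - f s)"
              unfolding \<Psi>\<eta> unfolding \<Psi>_def s_def[symmetric] gr by (simp add: algebra_simps)
            also have "norm \<dots> \<le> (\<xi> r - \<xi> s) + 2 * (\<xi> r - \<xi> s)"
              using norm_triangle_ineq4 main c by (rule order_trans[OF _ add_mono])
            finally show "norm ((\<eta> - y) *\<^sub>R f r - (\<Psi> \<eta> - \<Psi> y)) \<le> 3 * (\<xi> r - \<xi> (q y))" unfolding s_def by simp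
          qed (use \<open>g t1 < \<eta>\<close> in auto)
        qed
      qed
      then obtain d where d: "d > 0" "\<And>y. g a \<le> y \<Longrightarrow> y < \<eta> \<Longrightarrow> \<eta> - d < y \<Longrightarrow> q y \<le> r"
        "\<And>y. g a \<le> y \<Longrightarrow> y < \<eta> \<Longrightarrow> \<eta> - d < y \<Longrightarrow> norm ((\<eta> - y) *\<^sub>R f r - (\<Psi> \<eta> - \<Psi> y)) \<le> 3 * (\<xi> r - \<xi> (q y))"
        by blast
      show ?thesis
      proof (rule exI[of _ "min d (\<delta>0 \<eta>)"], intro conjI allI impI)
        fix y assume y: "g a \<le> y \<and> y < \<eta> \<and> \<eta> - min d (\<delta>0 \<eta>) < y"
        then have y_in: "y \<in> {g a..g b}" using \<eta> by auto
        have 1: "norm ((\<eta> - y) *\<^sub>R f r - (\<Psi> \<eta> - \<Psi> y)) \<le> 3 * (\<xi> r - \<xi> (q y))" using d(3)[of y] y by auto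
        have "norm ((\<eta> - y) *\<^sub>R plateau_weight f \<eta>) \<le> \<xi>0 \<eta> - \<xi>0 y"
          using est0[of y \<eta> \<eta>] y \<eta> \<xi>0(3)[of \<eta>] by auto
        then have 2: "norm ((\<eta> - y) *\<^sub>R (f r - f \<tau>)) \<le> \<xi>0 \<eta> - \<xi>0 y"
          unfolding plateau_weight_def r_def \<tau>_def using \<eta> by simp
        have "(\<eta> - y) *\<^sub>R f (q \<eta>) - (\<Psi> \<eta> - \<Psi> y) = ((\<eta> - y) *\<^sub>R f r - (\<Psi> \<eta> - \<Psi> y)) - (\<eta> - y) *\<^sub>R (f r - f \<tau>)"
          unfolding \<tau>_def by (simp add: algebra_simps)
        also have "norm \<dots> \<le> 3 * (\<xi> r - \<xi> (q y)) + (\<xi>0 \<eta> - \<xi>0 y)"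
          using norm_triangle_ineq4 1 2 by (rule order_trans[OF _ add_mono])
        finally have fin: "norm ((\<eta> - y) *\<^sub>R f (q \<eta>) - (\<Psi> \<eta> - \<Psi> y)) \<le> 3 * (\<xi> r - \<xi> (q y)) + (\<xi>0 \<eta> - \<xi>0 y)" .
        have "\<xi> r \<le> \<xi> (q \<eta>)" using \<xi>m[of r \<tau>] r \<tau> unfolding \<tau>_def by auto
        moreover have "\<xi>p (q y) \<le> \<xi>p (q \<eta>)"
          using p_mono[of "q y" "q \<eta>"] q_mono[OF y_in \<eta>] q_in[OF y_in] q_in[OF \<eta>] y by auto
        ultimately show "norm ((\<eta> - y) *\<^sub>R f (q \<eta>) - (\<Psi> \<eta> - \<Psi> y)) \<le> X \<eta> - X y"
          using fin unfolding X_def by argo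
      qed (use d \<xi>0(3)[of \<eta>] in auto)
    qed
  qed
qed simp

text \<open>
  The first implication is restricted to real integrands because the error function was obtained from suprema
  and infima of sums; vector integrands are treated componentwise.
\<close>
lemma has_ks_integral_real_iff:
  fixes f :: "real \<Rightarrow> real"
  shows "has_ks_integral abs f g a b I \<longleftrightarrow> ((\<lambda>y. f (q y)) has_integral I) {g a..g b}"
proof
  assume "has_ks_integral abs f g a b I"
  then obtain \<Phi> where w: "ward f g \<Phi> a b" and I: "\<Phi> b - \<Phi> a = I" 
    using has_ks_integral_imp_ward[OF _ ab] by blast
  have end_eq: "\<Phi> (q (g t)) + (g t - g (q (g t))) *\<^sub>R f (q (g t)) = \<Phi> t" if t: "t \<in> {a..b}" for t
  proof -
    have qt: "t \<le> q (g t)" "q (g t) \<in> {a..b}" "g (q (g t)) \<le> g t"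
      using galois[OF g_in[OF t] t] q_in[OF g_in[OF t]] gq_le[OF g_in[OF t]] by auto
    then have geq: "g s = g t" if "t \<le> s" "s \<le> q (g t)" for s
      using g_mono[of t s] g_mono[of s "q (g t)"] t that by auto
    have "\<Phi> (q (g t)) = \<Phi> t"
    proof (cases "t = q (g t)")
      case False
      have "\<Phi> (q (g t)) - \<Phi> t = (g (q (g t)) - g t) *\<^sub>R f t"
      proof (rule ward_const_integrator[OF w])
        show "g s = g (q (g t))" if "t < s" "s \<le> q (g t)" for s
          using geq[of s] geq[of "q (g t)"] that by simp
      qed (use False qt t in auto)
      then show ?thesis using geq[of "q (g t)"] qt by simp
    qed simp
    then show ?thesis using geq[of "q (g t)"] qt by simp
  qed
  show "((\<lambda>y. f (q y)) has_integral I) {g a..g b}"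
    using ward_imp_has_integral[OF ward_forward[OF w] g_ab] end_eq[of a] end_eq[of b] ab I by simp
next
  assume h: "((\<lambda>y. f (q y)) has_integral I) {g a..g b}"
  then have "ward f g (\<lambda>t. integral {g a..g t} (\<lambda>y. f (q y))) a b" by (intro ward_backward) blast
  from ward_imp_has_ks_integral[OF this] show "has_ks_integral abs f g a b I"
    using integral_unique[OF h] by (simp add: real_norm_def[abs_def])
qed

end

section \<open>Arbitrary norms and integrators on the half-line\<close>

lemma is_norm_zero: "is_norm nrm \<Longrightarrow> nrm 0 = 0"
  and is_norm_ge_0: "is_norm nrm \<Longrightarrow> 0 \<le> nrm u"
  and is_norm_scaleR: "is_norm nrm \<Longrightarrow> nrm (c *\<^sub>R u) = \<bar>c\<bar> * nrm u"
  and is_norm_triangle: "is_norm nrm \<Longrightarrow> nrm (u + v) \<le> nrm u + nrm v"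
  and is_norm_eq_0: "is_norm nrm \<Longrightarrow> nrm u = 0 \<longleftrightarrow> u = 0"
  unfolding is_norm_def by blast+

lemma is_norm_minus: "is_norm nrm \<Longrightarrow> nrm (- u) = nrm u"
  using is_norm_scaleR[of nrm "-1" u] by simp

lemma is_norm_minus_commute: "is_norm nrm \<Longrightarrow> nrm (u - v) = nrm (v - u)"
  using is_norm_minus[of nrm "u - v"] by simp

lemma is_norm_triangle_diff: "is_norm nrm \<Longrightarrow> nrm (u - w) \<le> nrm (u - v) + nrm (v - w)"
  using is_norm_triangle[of nrm "u - v" "v - w"] by simp

lemma is_norm_sum: "is_norm nrm \<Longrightarrow> nrm (\<Sum>i\<in>A. f i) \<le> (\<Sum>i\<in>A. nrm (f i))"
proof (induction A rule: infinite_finite_induct)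
  case (insert x F)
  then show ?case using is_norm_triangle[of nrm "f x" "\<Sum>i\<in>F. f i"] by simp
qed (simp_all add: is_norm_zero)

lemma is_norm_le_norm:
  fixes nrm :: "'a::euclidean_space \<Rightarrow> real"
  assumes n: "is_norm nrm"
  shows "\<exists>C>0. \<forall>u. nrm u \<le> C * norm u"
proof (intro exI conjI allI)
  show "1 + (\<Sum>b\<in>Basis. nrm b) > 0" using is_norm_ge_0[OF n] by (simp add: sum_nonneg add_pos_nonneg)
  fix u :: 'a
  have "nrm u = nrm (\<Sum>b\<in>Basis. (u \<bullet> b) *\<^sub>R b)" by (simp add: euclidean_representation)
  also have "\<dots> \<le> (\<Sum>b\<in>Basis. \<bar>u \<bullet> b\<bar> * nrm b)"
    using is_norm_sum[OF n, of "\<lambda>b. (u \<bullet> b) *\<^sub>R b" Basis] by (simp add: is_norm_scaleR[OF n])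
  also have "\<dots> \<le> (\<Sum>b\<in>Basis. norm u * nrm b)"
    by (intro sum_mono mult_right_mono Basis_le_norm is_norm_ge_0[OF n])
  also have "\<dots> \<le> (1 + (\<Sum>b\<in>Basis. nrm b)) * norm u"
    by (simp add: sum_distrib_left[symmetric] algebra_simps)
  finally show "nrm u \<le> (1 + (\<Sum>b\<in>Basis. nrm b)) * norm u" .
qed

lemma is_norm_continuous:
  fixes nrm :: "'a::euclidean_space \<Rightarrow> real"
  assumes n: "is_norm nrm"
  shows "continuous_on S nrm"
proof -
  obtain C where C: "C > 0" "\<And>u. nrm u \<le> C * norm u" using is_norm_le_norm[OF n] by blast
  have "dist (nrm v) (nrm u) \<le> C * dist v u" for u v
  proof -
    have "nrm u \<le> nrm v + nrm (u - v)" "nrm v \<le> nrm u + nrm (v - u)"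
      using is_norm_triangle[OF n, of v "u - v"] is_norm_triangle[OF n, of u "v - u"] by simp_all
    then have "dist (nrm v) (nrm u) \<le> nrm (v - u)"
      using is_norm_minus_commute[OF n, of u v] by (auto simp: dist_real_def abs_le_iff)
    then show ?thesis using C(2)[of "v - u"] by (simp add: dist_norm)
  qed
  then have "C-lipschitz_on S nrm" using C(1) by (intro lipschitz_onI) auto
  then show ?thesis by (rule lipschitz_on_continuous_on)
qed

lemma is_norm_tendsto:
  fixes X :: "'b \<Rightarrow> 'a::euclidean_space"
  assumes "is_norm nrm" "(X \<longlongrightarrow> l) F"
  shows "((\<lambda>t. nrm (X t)) \<longlongrightarrow> nrm l) F"
  using continuous_on_tendsto_compose[OF is_norm_continuous[OF assms(1), of UNIV] assms(2)] by simp

lemma norm_le_is_norm: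
  fixes nrm :: "'a::euclidean_space \<Rightarrow> real"
  assumes n: "is_norm nrm"
  shows "\<exists>C>0. \<forall>u. norm u \<le> C * nrm u"
proof -
  have "sphere (0::'a) 1 \<noteq> {}" by simp
  then obtain u0 where u0: "u0 \<in> sphere (0::'a) 1" "\<And>u. u \<in> sphere 0 1 \<Longrightarrow> nrm u0 \<le> nrm u"
    using continuous_attains_inf[OF compact_sphere _ is_norm_continuous[OF n]] by blast
  have pos: "nrm u0 > 0" using is_norm_ge_0[OF n, of u0] is_norm_eq_0[OF n, of u0] u0(1) by force
  show ?thesis
  proof (intro exI conjI allI)
    show "inverse (nrm u0) > 0" using pos by simp
    fix u :: 'a
    show "norm u \<le> inverse (nrm u0) * nrm u"
    proof (cases "u = 0")
      case False
      have "nrm u0 \<le> nrm (u /\<^sub>R norm u)" using False by (intro u0(2)) auto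
      also have "\<dots> = nrm u / norm u" using False by (simp add: is_norm_scaleR[OF n] field_simps)
      finally show ?thesis using False pos by (simp add: field_simps)
    qed (simp add: is_norm_zero[OF n])
  qed
qed

text \<open>
  Used with the coordinate functionals, and with the identity for two equivalent norms.
\<close>
lemma has_ks_integral_linear_image:
  assumes ks: "has_ks_integral nrm f g a b I" and T: "linear T" and C: "C > 0" "\<And>u. nrm' (T u) \<le> C * nrm u"
  shows "has_ks_integral nrm' (\<lambda>t. T (f t)) g a b (T I)"
  unfolding has_ks_integral_def
proof (intro allI impI)
  fix \<epsilon> :: real assume "\<epsilon> > 0"
  then have "\<epsilon> / C > 0" using C(1) by simp
  from ks[unfolded has_ks_integral_def, THEN spec, THEN mp, OF this]
  obtain \<delta> where *: "(\<forall>t\<in>{a..b}. 0 < \<delta> t) \<and>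
    (\<forall>k s \<tau>. tagged_partition a b k s \<tau> \<and> fine_partition \<delta> k s \<tau> \<longrightarrow>
           nrm ((\<Sum>i<k. (g (s (Suc i)) - g (s i)) *\<^sub>R f (\<tau> i)) - I) < \<epsilon> / C)" ..
  note d = conjunct1[OF *] conjunct2[OF *, THEN spec, THEN spec, THEN spec, THEN mp]
  show "\<exists>\<delta>. (\<forall>t\<in>{a..b}. 0 < \<delta> t) \<and>
        (\<forall>k s \<tau>. tagged_partition a b k s \<tau> \<and> fine_partition \<delta> k s \<tau> \<longrightarrow>
           nrm' ((\<Sum>i<k. (g (s (Suc i)) - g (s i)) *\<^sub>R T (f (\<tau> i))) - T I) < \<epsilon>)"
  proof (intro exI[of _ \<delta>] conjI d allI impI)
    fix k s \<tau> assume "tagged_partition a b k s \<tau> \<and> fine_partition \<delta> k s \<tau>"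
    from d(2)[OF this] have lt: "C * nrm ((\<Sum>i<k. (g (s (Suc i)) - g (s i)) *\<^sub>R f (\<tau> i)) - I) < \<epsilon>"
      using C(1) by (simp add: field_simps)
    have eq: "(\<Sum>i<k. (g (s (Suc i)) - g (s i)) *\<^sub>R T (f (\<tau> i))) - T I =
      T ((\<Sum>i<k. (g (s (Suc i)) - g (s i)) *\<^sub>R f (\<tau> i)) - I)"
      by (simp add: linear_diff[OF T] linear_sum[OF T] linear_scale[OF T])
    show "nrm' ((\<Sum>i<k. (g (s (Suc i)) - g (s i)) *\<^sub>R T (f (\<tau> i))) - T I) < \<epsilon>"
      unfolding eq by (rule le_less_trans[OF C(2) lt])
  qed
qed

lemma (in time_change) has_ks_integral_iff:
  fixes f :: "real \<Rightarrow> 'a::euclidean_space"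
  assumes n: "is_norm nrm"
  shows "has_ks_integral nrm f g a b I \<longleftrightarrow> ((\<lambda>y. f (q y)) has_integral I) {g a..g b}"
proof
  assume ks: "has_ks_integral nrm f g a b I"
  obtain C where C: "C > 0" "\<And>u. norm u \<le> C * nrm u" using norm_le_is_norm[OF n] by blast
  have "has_ks_integral abs (\<lambda>t. f t \<bullet> e) g a b (I \<bullet> e)" if e: "e \<in> Basis" for e
    using Basis_le_norm[OF e] C(2)
    by (intro has_ks_integral_linear_image[OF ks _ C(1)]) (auto intro: bounded_linear.linear bounded_linear_inner_left order_trans)
  then show "((\<lambda>y. f (q y)) has_integral I) {g a..g b}"
    by (subst has_integral_componentwise_iff)
      (auto simp: has_ks_integral_real_iff)
next
  assume h: "((\<lambda>y. f (q y)) has_integral I) {g a..g b}"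
  then have "ward f g (\<lambda>t. integral {g a..g t} (\<lambda>y. f (q y))) a b" by (intro ward_backward) blast
  from ward_imp_has_ks_integral[OF this] have ks: "has_ks_integral norm f g a b I"
    using integral_unique[OF h] by simp
  obtain C where "C > 0" "\<And>u. nrm u \<le> C * norm u" using is_norm_le_norm[OF n] by blast
  with has_ks_integral_linear_image[where T = "\<lambda>u. u", OF ks linear_ident] show "has_ks_integral nrm f g a b I" .
qed

locale integrator =
  fixes g :: "real \<Rightarrow> real"
  assumes g_mono_on: "mono_on {0..} g"
    and g_left_continuous: "\<And>t. 0 < t \<Longrightarrow> continuous (at_left t) g"
begin

text \<open>
  The supremum ranges over a bounded set exactly for the levels in the set \<open>J\<close> below, which therefore
  carries all statements about \<open>\<gamma>\<close>; at a maximum of \<open>g\<close> the value is meaningless, but a single level is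
  negligible.
\<close>
definition \<gamma> :: "real \<Rightarrow> real" where "\<gamma> y = Sup {t. 0 \<le> t \<and> g t \<le> y}"

definition J :: "real set" where "J = {y. g 0 \<le> y \<and> (\<exists>b\<ge>0. y < g b)}"

lemma mono: "0 \<le> s \<Longrightarrow> s \<le> t \<Longrightarrow> g s \<le> g t"
  using mono_onD[OF g_mono_on, of s t] by auto

lemma tendsto_left:
  assumes "\<And>n. 0 \<le> a n" "\<And>n. a n \<le> t" "a \<longlonglongrightarrow> t"
  shows "(\<lambda>n. g (a n)) \<longlonglongrightarrow> g t"
proof (cases "t = 0")
  case True
  then have "a n = t" for n using assms(1,2)[of n] by auto
  then show ?thesis by simp
next
  case False
  then have "0 < t" using assms(1,2)[of 0] by auto
  have "(g \<longlongrightarrow> g t) (at_left t)" using g_left_continuous[OF \<open>0 < t\<close>] by (simp add: continuous_within)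
  show ?thesis
  proof (rule tendstoI)
    fix e :: real assume "e > 0"
    then have "\<forall>\<^sub>F s in at_left t. dist (g s) (g t) < e" using \<open>(g \<longlongrightarrow> g t) (at_left t)\<close> by (rule tendstoD[rotated])
    then obtain r where r: "r < t" "\<And>s. r < s \<Longrightarrow> s < t \<Longrightarrow> dist (g s) (g t) < e"
      unfolding eventually_at_left_field by auto
    have "\<forall>\<^sub>F n in sequentially. r < a n" using order_tendstoD(1)[OF assms(3) r(1)] .
    then show "\<forall>\<^sub>F n in sequentially. dist (g (a n)) (g t) < e"
    proof eventually_elim
      case (elim n)
      then show ?case using r(2)[of "a n"] assms(2)[of n] \<open>e > 0\<close> by (cases "a n = t") auto
    qed
  qed
qed

lemma \<gamma>_galois:
  assumes y: "y \<in> J" and t: "0 \<le> t"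
  shows "t \<le> \<gamma> y \<longleftrightarrow> g t \<le> y"
proof -
  let ?S = "{t. 0 \<le> t \<and> g t \<le> y}"
  obtain b where b: "0 \<le> b" "y < g b" using y unfolding J_def by auto
  have ne: "0 \<in> ?S" using y unfolding J_def by auto
  have ub: "s \<le> b" if "s \<in> ?S" for s using that b mono[of b s] by force
  then have bdd: "bdd_above ?S" by (auto simp: bdd_above_def)
  show ?thesis
  proof
    assume "g t \<le> y"
    then show "t \<le> \<gamma> y" unfolding \<gamma>_def using t bdd by (intro cSup_upper) auto
  next
    assume le: "t \<le> \<gamma> y"
    have less: "g s \<le> y" if s: "0 \<le> s" "s < \<gamma> y" for s
    proof -
      have "\<exists>u\<in>?S. s < u" using s less_cSup_iff[OF _ bdd, of s] ne unfolding \<gamma>_def by blast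
      then obtain u where "u \<in> ?S" "s < u" by blast
      then show ?thesis using mono[of s u] s by auto
    qed
    show "g t \<le> y"
    proof (cases "t < \<gamma> y \<or> t = 0")
      case True then show ?thesis using less t y unfolding J_def by auto
    next
      case False
      define a where "a n = max 0 (t - inverse (real (Suc n)))" for n
      have "a \<longlonglongrightarrow> max 0 (t - 0)" unfolding a_def
        by (intro tendsto_intros LIMSEQ_inverse_real_of_nat)
      then have "a \<longlonglongrightarrow> t" using t by simp
      have a: "0 \<le> a n" "a n < t" for n unfolding a_def using False t by auto
      have "(\<lambda>n. g (a n)) \<longlonglongrightarrow> g t" using a \<open>a \<longlonglongrightarrow> t\<close> by (intro tendsto_left) (auto intro: less_imp_le)
      moreover have "g (a n) \<le> y" for n using less[of "a n"] a[of n] le by auto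
      ultimately show ?thesis by (intro LIMSEQ_le_const2) auto
    qed
  qed
qed

lemma \<gamma>_nonneg: "y \<in> J \<Longrightarrow> 0 \<le> \<gamma> y"
  using \<gamma>_galois[of y 0] unfolding J_def by auto

lemma \<gamma>_less: "y \<in> J \<Longrightarrow> 0 \<le> t \<Longrightarrow> \<gamma> y < t \<longleftrightarrow> y < g t"
  using \<gamma>_galois[of y t] by auto

lemma g_\<gamma>_le: "y \<in> J \<Longrightarrow> g (\<gamma> y) \<le> y"
  using \<gamma>_galois[of y "\<gamma> y"] \<gamma>_nonneg by auto

lemma in_J: "0 \<le> a \<Longrightarrow> 0 \<le> b \<Longrightarrow> g a \<le> y \<Longrightarrow> y < g b \<Longrightarrow> y \<in> J"
  unfolding J_def using mono[of 0 a] by auto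

text \<open>
  At the top level \<open>g b\<close> the global inverse \<open>\<gamma>\<close> may exceed \<open>b\<close>, so it is replaced by \<open>b\<close> there.
\<close>
lemma time_change:
  assumes "0 \<le> a" "a \<le> b"
  shows "time_change g (\<lambda>y. if y < g b then \<gamma> y else b) a b"
proof
  show "mono_on {a..b} g" using g_mono_on assms by (auto intro: mono_on_subset)
  show "continuous (at_left t) g" if "a < t" "t \<le> b" for t using that assms g_left_continuous by auto
  show "t \<le> (if y < g b then \<gamma> y else b) \<longleftrightarrow> g t \<le> y" if "y \<in> {g a..g b}" "t \<in> {a..b}" for y t
    using \<gamma>_galois[of y t] in_J[of a b y] that assms mono[of t b] by auto
  show "(if y < g b then \<gamma> y else b) \<in> {a..b}" if "y \<in> {g a..g b}" for y
    using \<gamma>_galois[of y a] \<gamma>_less[of y b] in_J[of a b y] that assms by auto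
qed fact

lemma has_ks_integral_iff:
  fixes f :: "real \<Rightarrow> 'a::euclidean_space"
  assumes n: "is_norm nrm" and "0 \<le> a" "a \<le> b"
  shows "has_ks_integral nrm f g a b I \<longleftrightarrow> ((\<lambda>y. f (\<gamma> y)) has_integral I) {g a..g b}"
  unfolding time_change.has_ks_integral_iff[OF time_change[OF assms(2,3)] n]
  by (rule has_integral_spike_eq[of "{g b}"]) auto

lemma ks_integral_eq:
  fixes f :: "real \<Rightarrow> 'a::euclidean_space"
  assumes "is_norm nrm" "0 \<le> a" "a \<le> b" "(\<lambda>y. f (\<gamma> y)) integrable_on {g a..g b}"
  shows "ks_integral nrm f g a b = integral {g a..g b} (\<lambda>y. f (\<gamma> y))"
  unfolding ks_integral_def has_ks_integral_iff[OF assms(1-3)]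
  using integrable_integral[OF assms(4)] by (auto intro: has_integral_unique)

lemma ks_integrable_iff:
  fixes f :: "real \<Rightarrow> 'a::euclidean_space"
  assumes "is_norm nrm" "0 \<le> a" "a \<le> b"
  shows "ks_integrable nrm f g a b \<longleftrightarrow> (\<lambda>y. f (\<gamma> y)) integrable_on {g a..g b}"
  unfolding ks_integrable_def has_ks_integral_iff[OF assms] integrable_on_def ..

end

section \<open>Pointwise domination and measurability\<close>

lemma indefinite_integral_diff:
  fixes F :: "real \<Rightarrow> 'a::banach"
  assumes "F integrable_on {a..b}" "a \<le> u" "u \<le> v" "v \<le> b"
  shows "integral {a..v} F - integral {a..u} F = integral {u..v} F"
proof -
  have "integral {a..u} F + integral {u..v} F = integral {a..v} F"
    using assms by (intro Henstock_Kurzweil_Integration.integral_combine integrable_subinterval_real[OF assms(1)]) auto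
  then show ?thesis by (metis add_diff_cancel_left')
qed

text \<open>
  Indefinite integrals are differentiable almost everywhere.  Right difference quotients along sequences are
  the form in which this is used: the available levels are \<open>g (d k)\<close> for times \<open>d k\<close> decreasing to a
  given time.
\<close>
lemma indefinite_integral_right_quotient:
  fixes F :: "real \<Rightarrow> 'a::euclidean_space"
  assumes "F integrable_on {a..b}"
  shows "\<exists>Z. negligible Z \<and> (\<forall>y\<in>{a..b} - Z. \<forall>u. (\<forall>n::nat. y < u n \<and> u n \<le> b) \<longrightarrow> u \<longlonglongrightarrow> y \<longrightarrow>
    (\<lambda>n. integral {y..u n} F /\<^sub>R (u n - y)) \<longlonglongrightarrow> F y)"
proof -
  define F' where "F' x = (if x \<in> {a..b} then F x else 0)" for x
  have "F' integrable_on UNIV" unfolding F'_def by (subst integrable_restrict_UNIV) (rule assms)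
  then have "F' integrable_on cbox c d" for c d by (rule integrable_on_subcbox) auto
  from integrable_ccontinuous_explicit[OF this] obtain Z where Z: "negligible Z"
    "\<And>x e. x \<notin> Z \<Longrightarrow> 0 < e \<Longrightarrow> \<exists>d>0. \<forall>h. 0 < h \<and> h < d \<longrightarrow>
                         norm(integral (cbox x (x + h *\<^sub>R One)) F' /\<^sub>R h ^ DIM(real) - F' x) < e" by blast
  show ?thesis
  proof (rule exI[of _ Z], intro conjI Z(1) ballI allI impI)
    fix y u assume y: "y \<in> {a..b} - Z" and u: "\<forall>n::nat. y < u n \<and> u n \<le> b" and lim: "u \<longlonglongrightarrow> y"
    show "(\<lambda>n. integral {y..u n} F /\<^sub>R (u n - y)) \<longlonglongrightarrow> F y"
    proof (rule metric_LIMSEQ_I)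
      fix e :: real assume "e > 0"
      then obtain d where d: "d > 0" "\<And>h. 0 < h \<Longrightarrow> h < d \<Longrightarrow> norm(integral {y..y + h} F' /\<^sub>R h - F' y) < e"
        using Z(2)[of y e] y by auto
      obtain N where N: "\<And>n. n \<ge> N \<Longrightarrow> dist (u n) y < d" using metric_LIMSEQ_D[OF lim d(1)] by auto
      have "dist (integral {y..u n} F /\<^sub>R (u n - y)) (F y) < e" if "n \<ge> N" for n
      proof -
        have "integral {y..u n} F' = integral {y..u n} F"
          using u[rule_format, of n] y unfolding F'_def by (intro integral_cong) auto
        then show ?thesis using d(2)[of "u n - y"] N[OF that] u[rule_format, of n] y 
          unfolding F'_def by (auto simp: dist_norm)
      qed
      then show "\<exists>N. \<forall>n\<ge>N. dist (integral {y..u n} F /\<^sub>R (u n - y)) (F y) < e" by blast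
    qed
  qed
qed

text \<open>
  The integral bound is available between levels of the form \<open>g c\<close> and \<open>g d\<close> only, and need not hold on subintervals
  of a gap left by a jump.  At a level \<open>y\<close> with \<open>\<tau> = \<gamma> y\<close> take levels \<open>u k = g (d k)\<close> with
  \<open>d k\<close> decreasing to \<open>\<tau>\<close>, and let \<open>L\<close> be their limit.  If \<open>L = y\<close>, difference quotients over
  \<open>[y, u k]\<close> give the bound for almost all such \<open>y\<close>.  If \<open>L > y\<close>, then \<open>y\<close> lies in a gap, on which both
  functions are constant, and the bound over the whole gap \<open>[g \<tau>, L]\<close> is the pointwise bound.
\<close>
lemma (in integrator) integral_bound_imp_pointwise_bound:
  fixes \<phi> :: "real \<Rightarrow> 'a::euclidean_space" and m :: "real \<Rightarrow> real"
  assumes n: "is_norm nrm" and b: "0 \<le> b"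
    and int\<phi>: "(\<lambda>y. \<phi> (\<gamma> y)) integrable_on {g 0..g b}"
    and intm: "(\<lambda>y. m (\<gamma> y)) integrable_on {g 0..g b}"
    and bound: "\<And>c d. 0 \<le> c \<Longrightarrow> c \<le> d \<Longrightarrow> d \<le> b \<Longrightarrow>
      nrm (integral {g c..g d} (\<lambda>y. \<phi> (\<gamma> y))) \<le> integral {g c..g d} (\<lambda>y. m (\<gamma> y))"
  shows "\<exists>Z. negligible Z \<and> (\<forall>y\<in>{g 0..<g b} - Z. nrm (\<phi> (\<gamma> y)) \<le> m (\<gamma> y))"
proof -
  define \<Psi> where "\<Psi> y = integral {g 0..y} (\<lambda>y. \<phi> (\<gamma> y))" for y
  define \<mu> where "\<mu> y = integral {g 0..y} (\<lambda>y. m (\<gamma> y))" for y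
  have \<Psi>d: "\<Psi> v - \<Psi> u = integral {u..v} (\<lambda>y. \<phi> (\<gamma> y))" and \<mu>d: "\<mu> v - \<mu> u = integral {u..v} (\<lambda>y. m (\<gamma> y))"
    if "g 0 \<le> u" "u \<le> v" "v \<le> g b" for u v
    unfolding \<Psi>_def \<mu>_def using indefinite_integral_diff[OF int\<phi> that] indefinite_integral_diff[OF intm that] .
  have cont: "continuous_on {g 0..g b} \<Psi>" "continuous_on {g 0..g b} \<mu>"
    unfolding \<Psi>_def \<mu>_def by (intro indefinite_integral_continuous_1 int\<phi> intm)+
  note nlim = is_norm_tendsto[OF n]
  obtain Z1 where Z1: "negligible Z1" "\<forall>y\<in>{g 0..g b} - Z1. \<forall>u. (\<forall>n::nat. y < u n \<and> u n \<le> g b) \<longrightarrow> u \<longlonglongrightarrow> y \<longrightarrow>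
    (\<lambda>n. integral {y..u n} (\<lambda>y. \<phi> (\<gamma> y)) /\<^sub>R (u n - y)) \<longlonglongrightarrow> \<phi> (\<gamma> y)"
    using indefinite_integral_right_quotient[OF int\<phi>] by blast
  obtain Z2 where Z2: "negligible Z2" "\<forall>y\<in>{g 0..g b} - Z2. \<forall>u. (\<forall>n::nat. y < u n \<and> u n \<le> g b) \<longrightarrow> u \<longlonglongrightarrow> y \<longrightarrow>
    (\<lambda>n. integral {y..u n} (\<lambda>y. m (\<gamma> y)) /\<^sub>R (u n - y)) \<longlonglongrightarrow> m (\<gamma> y)"
    using indefinite_integral_right_quotient[OF intm] by blast
  show ?thesis
  proof (intro exI[of _ "Z1 \<union> Z2"] conjI ballI)
    show "negligible (Z1 \<union> Z2)" using Z1(1) Z2(1) by simp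
    fix y assume y: "y \<in> {g 0..<g b} - (Z1 \<union> Z2)"
    have yJ: "y \<in> J" using y in_J[of 0 b y] b by auto
    define \<tau> where "\<tau> = \<gamma> y"
    have \<tau>: "0 \<le> \<tau>" "\<tau> < b" "g \<tau> \<le> y"
      unfolding \<tau>_def using \<gamma>_nonneg[OF yJ] \<gamma>_less[OF yJ b] g_\<gamma>_le[OF yJ] y by auto
    define d where "d k = \<tau> + (b - \<tau>) * inverse (real (Suc k))" for k
    have d: "\<tau> < d k" "d k \<le> b" for k
    proof -
      have "(b - \<tau>) * inverse (real (Suc k)) \<le> (b - \<tau>) * 1"
        using \<tau> by (intro mult_left_mono) (auto simp: field_simps)
      then show "d k \<le> b" unfolding d_def by simp
      show "\<tau> < d k" unfolding d_def using \<tau> by simp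
    qed
    have ddec: "d k \<le> d j" if "j \<le> k" for j k
      unfolding d_def using \<tau> that by (intro add_left_mono mult_left_mono) (auto simp: field_simps)
    have "d \<longlonglongrightarrow> \<tau> + (b - \<tau>) * 0" unfolding d_def by (intro tendsto_intros LIMSEQ_inverse_real_of_nat)
    then have dlim: "d \<longlonglongrightarrow> \<tau>" by simp
    define u where "u k = g (d k)" for k
    have u: "y < u k" "u k \<le> g b" for k
      using \<gamma>_less[OF yJ, of "d k"] d[of k] \<tau> mono[of "d k" b] unfolding u_def \<tau>_def by auto
    have d0: "0 \<le> d k" for k using d(1)[of k] \<tau>(1) by simp
    have udec: "decseq u" unfolding decseq_def u_def by (intro allI impI mono ddec d0)
    obtain L where L: "u \<longlonglongrightarrow> L" "\<And>k. L \<le> u k"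
      using decseq_convergent[OF udec, of y] u by (metis less_imp_le)
    have yL: "y \<le> L" using LIMSEQ_le_const[OF L(1), of y] u by (auto intro: less_imp_le)
    have Lb: "L \<le> g b" using L(2)[of 0] u(2)[of 0] by simp
    have g0: "g 0 \<le> g \<tau>" using mono[of 0 \<tau>] \<tau> by simp
    have Lin: "L \<in> {g 0..g b}" "\<And>k. u k \<in> {g 0..g b}" 
    proof -
      show "L \<in> {g 0..g b}" using yL Lb g0 \<tau> by auto
      show "u k \<in> {g 0..g b}" for k using u[of k] g0 \<tau> by auto
    qed
    have \<Psi>lim: "(\<lambda>k. \<Psi> (u k)) \<longlonglongrightarrow> \<Psi> L" and \<mu>lim: "(\<lambda>k. \<mu> (u k)) \<longlonglongrightarrow> \<mu> L"
      using continuous_on_tendsto_compose[OF cont(1) L(1)] continuous_on_tendsto_compose[OF cont(2) L(1)] Lin by auto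
    show "nrm (\<phi> (\<gamma> y)) \<le> m (\<gamma> y)"
    proof (cases "L = y")
      case True
      have le: "nrm (\<Psi> (u k) - \<Psi> y) \<le> \<mu> (u k) - \<mu> y" for k
      proof (rule LIMSEQ_le)
        show "(\<lambda>j. nrm (\<Psi> (u k) - \<Psi> (u j))) \<longlonglongrightarrow> nrm (\<Psi> (u k) - \<Psi> y)"
          by (intro nlim tendsto_intros) (use \<Psi>lim True in simp)
        show "(\<lambda>j. \<mu> (u k) - \<mu> (u j)) \<longlonglongrightarrow> \<mu> (u k) - \<mu> y"
          by (intro tendsto_intros) (use \<mu>lim True in simp)
        show "\<exists>N. \<forall>j\<ge>N. nrm (\<Psi> (u k) - \<Psi> (u j)) \<le> \<mu> (u k) - \<mu> (u j)"
        proof (intro exI[of _ k] allI impI)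
          fix j assume "k \<le> j"
          then have "0 \<le> d j" "d j \<le> d k" "d k \<le> b" "u j \<le> u k"
            using ddec[of k j] d[of j] d[of k] \<tau> decseqD[OF udec] by auto
          then show "nrm (\<Psi> (u k) - \<Psi> (u j)) \<le> \<mu> (u k) - \<mu> (u j)"
            using bound[of "d j" "d k"] \<Psi>d[of "u j" "u k"] \<mu>d[of "u j" "u k"] Lin(2)[of j] Lin(2)[of k]
            unfolding u_def by auto
        qed
      qed
      have lims: "(\<lambda>k. nrm ((\<Psi> (u k) - \<Psi> y) /\<^sub>R (u k - y))) \<longlonglongrightarrow> nrm (\<phi> (\<gamma> y))"
        "(\<lambda>k. (\<mu> (u k) - \<mu> y) /\<^sub>R (u k - y)) \<longlonglongrightarrow> m (\<gamma> y)"
      proof -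
        have eqs: "\<Psi> (u k) - \<Psi> y = integral {y..u k} (\<lambda>y. \<phi> (\<gamma> y))" "\<mu> (u k) - \<mu> y = integral {y..u k} (\<lambda>y. m (\<gamma> y))" for k
          using \<Psi>d[of y "u k"] \<mu>d[of y "u k"] y u[of k] by auto
        have y12: "y \<in> {g 0..g b} - Z1" "y \<in> {g 0..g b} - Z2" using y by auto
        have uy: "u \<longlonglongrightarrow> y" using L(1) True by simp
        show "(\<lambda>k. nrm ((\<Psi> (u k) - \<Psi> y) /\<^sub>R (u k - y))) \<longlonglongrightarrow> nrm (\<phi> (\<gamma> y))"
          unfolding eqs by (rule nlim[OF Z1(2)[rule_format, OF y12(1) conjI[OF u] uy]])
        show "(\<lambda>k. (\<mu> (u k) - \<mu> y) /\<^sub>R (u k - y)) \<longlonglongrightarrow> m (\<gamma> y)"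
          unfolding eqs by (rule Z2(2)[rule_format, OF y12(2) conjI[OF u] uy])
      qed
      show ?thesis
      proof (rule LIMSEQ_le[OF lims], intro exI allI impI)
        fix k
        have "u k - y > 0" using u[of k] by simp
        then show "nrm ((\<Psi> (u k) - \<Psi> y) /\<^sub>R (u k - y)) \<le> (\<mu> (u k) - \<mu> y) /\<^sub>R (u k - y)"
          unfolding is_norm_scaleR[OF n] real_scaleR_def using le[of k] by (simp add: mult_left_mono)
      qed
    next
      case False
      then have "y < L" using yL by simp
      have const: "\<gamma> x = \<tau>" if "g \<tau> \<le> x" "x < L" for x
      proof (rule antisym)
        have xJ: "x \<in> J" using in_J[of \<tau> b x] that \<tau> Lb by auto
        show "\<tau> \<le> \<gamma> x" using \<gamma>_galois[OF xJ \<tau>(1)] that by simp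
        have "\<gamma> x \<le> d k" for k using \<gamma>_less[OF xJ, of "d k"] L(2)[of k] d[of k] \<tau> that unfolding u_def by auto
        then show "\<gamma> x \<le> \<tau>" using LIMSEQ_le_const[OF dlim] by blast
      qed
      have ev: "integral {g \<tau>..L} (\<lambda>y. F (\<gamma> y)) = (L - g \<tau>) *\<^sub>R F \<tau>" for F :: "real \<Rightarrow> 'z::banach"
      proof -
        have "integral {g \<tau>..L} (\<lambda>y. F (\<gamma> y)) = integral {g \<tau>..L} (\<lambda>_. F \<tau>)"
          by (rule integral_spike[of "{L}"]) (use const in auto)
        then show ?thesis using \<tau> \<open>y < L\<close> by simp
      qed
      have "nrm (\<Psi> L - \<Psi> (g \<tau>)) \<le> \<mu> L - \<mu> (g \<tau>)"
      proof (rule LIMSEQ_le)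
        show "(\<lambda>k. nrm (\<Psi> (u k) - \<Psi> (g \<tau>))) \<longlonglongrightarrow> nrm (\<Psi> L - \<Psi> (g \<tau>))" by (intro nlim tendsto_intros \<Psi>lim)
        show "(\<lambda>k. \<mu> (u k) - \<mu> (g \<tau>)) \<longlonglongrightarrow> \<mu> L - \<mu> (g \<tau>)" by (intro tendsto_intros \<mu>lim)
        show "\<exists>N. \<forall>k\<ge>N. nrm (\<Psi> (u k) - \<Psi> (g \<tau>)) \<le> \<mu> (u k) - \<mu> (g \<tau>)"
        proof (intro exI allI impI)
          fix k
          show "nrm (\<Psi> (u k) - \<Psi> (g \<tau>)) \<le> \<mu> (u k) - \<mu> (g \<tau>)"
            using bound[of \<tau> "d k"] \<Psi>d[of "g \<tau>" "u k"] \<mu>d[of "g \<tau>" "u k"] Lin(2)[of k] g0 u[of k] d[of k] \<tau>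
            unfolding u_def by auto
        qed
      qed
      then have "nrm ((L - g \<tau>) *\<^sub>R \<phi> \<tau>) \<le> (L - g \<tau>) *\<^sub>R m \<tau>"
        using \<Psi>d[of "g \<tau>" L] \<mu>d[of "g \<tau>" L] g0 \<tau> \<open>y < L\<close> Lb ev[of \<phi>] ev[of m] by simp
      then show ?thesis using \<open>y < L\<close> \<tau> by (simp add: is_norm_scaleR[OF n] \<tau>_def[symmetric])
    qed
  qed
qed

text \<open>
  Replace \<open>w\<close> by simple functions, each of which selects among finitely many measurable sections of \<open>F\<close>.
\<close>
lemma Caratheodory_measurable:
  fixes F :: "'b \<Rightarrow> 'a::euclidean_space \<Rightarrow> 'c::euclidean_space"
  assumes meas: "\<And>u. (\<lambda>y. F y u) \<in> borel_measurable M"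
    and cont: "\<And>y. continuous_on UNIV (F y)" and w: "w \<in> borel_measurable M"
  shows "(\<lambda>y. F y (w y)) \<in> borel_measurable M"
proof -
  obtain W where W: "\<And>i. simple_function M (W i)" "\<And>y. y \<in> space M \<Longrightarrow> (\<lambda>i. W i y) \<longlonglongrightarrow> w y"
    using borel_measurable_implies_sequence_metric[OF w] by blast
  show ?thesis
  proof (rule borel_measurable_LIMSEQ_metric)
    fix i
    have "W i \<in> M \<rightarrow>\<^sub>M count_space (W i ` space M)"
      using W(1)[of i] by (subst measurable_count_space_eq2) (auto simp: simple_function_def)
    moreover have "countable (W i ` space M)" using W(1)[of i] by (simp add: simple_function_def countable_finite)
    ultimately show "(\<lambda>y. F y (W i y)) \<in> borel_measurable M"
      by (rule measurable_compose_countable'[where f = "\<lambda>u y. F y u" and g = "W i", OF meas])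
  next
    fix y assume "y \<in> space M"
    then show "(\<lambda>i. F y (W i y)) \<longlonglongrightarrow> F y (w y)"
      by (intro continuous_on_tendsto_compose[OF cont W(2)]) auto
  qed
qed

text \<open>
  The right limit \<open>r t\<close> of \<open>X\<close> is a pointwise limit of step functions, since the points \<open>s n t\<close> lie strictly to the
  right of \<open>t\<close>.  The points where \<open>X\<close> differs from \<open>r\<close> by more than a fixed amount do not accumulate, so
  \<open>X\<close> equals \<open>r\<close> off a countable set.
\<close>
lemma one_sided_limits_imp_borel:
  fixes X :: "real \<Rightarrow> 'a::euclidean_space"
  assumes R: "\<And>t. \<exists>L. (X \<longlongrightarrow> L) (at_right t)" and L: "\<And>t. \<exists>L. (X \<longlongrightarrow> L) (at_left t)"
  shows "X \<in> borel_measurable borel"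
proof -
  obtain r where r: "\<And>t. (X \<longlongrightarrow> r t) (at_right t)" using R by metis
  define s where "s n t = (real_of_int \<lfloor>real (Suc n) * t\<rfloor> + 1) / real (Suc n)" for n t
  have s: "t < s n t" "s n t \<le> t + 1 / real (Suc n)" for n t
  proof -
    have 1: "real_of_int \<lfloor>real (Suc n) * t\<rfloor> \<le> real (Suc n) * t" "real (Suc n) * t < real_of_int \<lfloor>real (Suc n) * t\<rfloor> + 1" by linarith+
    show "t < s n t" unfolding s_def using 1(2) by (simp add: field_simps del: of_nat_Suc)
    show "s n t \<le> t + 1 / real (Suc n)" unfolding s_def using 1(1) by (simp add: field_simps del: of_nat_Suc)
  qed
  have slim: "filterlim (\<lambda>n. s n t) (at_right t) sequentially" for t
    unfolding filterlim_at
  proof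
    show "(\<lambda>n. s n t) \<longlonglongrightarrow> t"
    proof (rule tendsto_sandwich)
      show "(\<lambda>_. t) \<longlonglongrightarrow> t" by simp
      have "(\<lambda>n. t + inverse (real (Suc n))) \<longlonglongrightarrow> t + 0" by (intro tendsto_intros LIMSEQ_inverse_real_of_nat)
      then show "(\<lambda>n. t + 1 / real (Suc n)) \<longlonglongrightarrow> t" by (simp add: divide_inverse)
    qed (use s in \<open>auto intro!: always_eventually less_imp_le\<close>)
    have "s n t \<in> {t<..} \<and> s n t \<noteq> t" for n using s(1)[of t n] by simp
    then show "\<forall>\<^sub>F n in sequentially. s n t \<in> {t<..} \<and> s n t \<noteq> t" by simp
  qed
  have r_borel: "r \<in> borel_measurable borel"
  proof (rule borel_measurable_LIMSEQ_metric)
    fix n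
    have "(\<lambda>t. \<lfloor>real (Suc n) * t\<rfloor>) \<in> borel \<rightarrow>\<^sub>M count_space UNIV" by measurable
    then show "(\<lambda>t. X (s n t)) \<in> borel_measurable borel" unfolding s_def
      by (rule measurable_compose[where N = "count_space UNIV" and g = "\<lambda>i. X ((real_of_int i + 1) / real (Suc n))"]) simp
  next
    fix t show "(\<lambda>n. X (s n t)) \<longlonglongrightarrow> r t" using filterlim_compose[OF r slim] .
  qed
  have near: "dist (X t) (r t) \<le> 2 * e" if "\<And>v. v \<in> {t..<u} \<Longrightarrow> dist (X v) l < e" "t < u" for t u l e
  proof -
    have "\<forall>\<^sub>F v in at_right t. v < u" using that(2) by (auto simp: eventually_at_right_field)
    moreover have "\<forall>\<^sub>F v in at_right t. t < v" by (simp add: eventually_at_right_less)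
    ultimately have "\<forall>\<^sub>F v in at_right t. dist (X v) l \<le> e" 
      by eventually_elim (use that(1) in \<open>auto intro: less_imp_le\<close>)
    then have "dist (r t) l \<le> e"
      by (intro tendsto_upperbound[OF tendsto_dist[OF r tendsto_const]]) auto
    moreover have "dist (X t) l < e" using that by auto
    ultimately show ?thesis using dist_triangle2[of "X t" "r t" l] by linarith
  qed
  define D where "D k = {t. dist (X t) (r t) > inverse (real (Suc k))}" for k
  have "countable (D k)" for k
  proof -
    have "D k sparse_in UNIV"
      unfolding sparse_in_eventually_iff[OF open_UNIV]
    proof
      fix t
      define e where "e = inverse (real (Suc k)) / 2"
      have "e > 0" unfolding e_def by simp
      obtain l where l: "(X \<longlongrightarrow> l) (at_left t)" using L by blast
      obtain a where a: "a < t" "\<And>v. a < v \<Longrightarrow> v < t \<Longrightarrow> dist (X v) l < e"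
        using tendstoD[OF l \<open>e > 0\<close>] unfolding eventually_at_left_field by auto
      obtain b where b: "t < b" "\<And>v. t < v \<Longrightarrow> v < b \<Longrightarrow> dist (X v) (r t) < e"
        using tendstoD[OF r \<open>e > 0\<close>] unfolding eventually_at_right_field by auto
      have "v \<notin> D k" if "a < v" "v < b" "v \<noteq> t" for v
      proof -
        have "dist (X v) (r v) \<le> 2 * e"
        proof (cases "v < t")
          case True then show ?thesis using that a by (intro near[of v t l]) auto
        next
          case False then show ?thesis using that b by (intro near[of v b "r t"]) auto
        qed
        then show ?thesis unfolding D_def e_def by simp
      qed
      then show "\<forall>\<^sub>F v in at t. v \<notin> D k" using a(1) b(1)
        unfolding eventually_at_filter eventually_nhds by (intro exI[of _ "{a<..<b}"]) auto
    qed
    then show ?thesis using sparse_imp_countable[OF open_UNIV] by auto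
  qed
  then have "countable (\<Union>k. D k)" by blast
  with r_borel show ?thesis
  proof (rule measurable_discrete_difference)
    fix t assume "t \<notin> (\<Union>k. D k)"
    then have "dist (X t) (r t) \<le> inverse (real (Suc k))" for k unfolding D_def by (auto simp: not_less)
    then have "dist (X t) (r t) \<le> 0" by (intro LIMSEQ_le_const[OF LIMSEQ_inverse_real_of_nat]) auto
    then show "r t = X t" by simp
  qed auto
qed

lemma regulated_imp_borel:
  fixes x :: "real \<Rightarrow> 'a::euclidean_space"
  assumes "regulated x"
  shows "(\<lambda>t. x (max 0 t)) \<in> borel_measurable borel"
proof (rule one_sided_limits_imp_borel)
  fix t :: real
  show "\<exists>L. ((\<lambda>t. x (max 0 t)) \<longlongrightarrow> L) (at_right t)"
  proof (cases "t < 0")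
    case True
    then have "\<forall>\<^sub>F v in at_right t. v < 0" by (auto simp: eventually_at_right_field)
    then have "\<forall>\<^sub>F v in at_right t. x (max 0 v) = x 0" by eventually_elim auto
    then show ?thesis by (intro exI tendsto_eventually)
  next
    case False
    then have "\<exists>l. (x \<longlongrightarrow> l) (at_right t)" using assms unfolding regulated_def by (simp add: not_less not_le)
    then obtain l where "(x \<longlongrightarrow> l) (at_right t)" ..
    moreover have "\<forall>\<^sub>F v in at_right t. t < v" by (simp add: eventually_at_right_less)
    then have "\<forall>\<^sub>F v in at_right t. x v = x (max 0 v)" by eventually_elim (use False in auto)
    ultimately show ?thesis by (intro exI) (rule Lim_transform_eventually)
  qed
  show "\<exists>L. ((\<lambda>t. x (max 0 t)) \<longlongrightarrow> L) (at_left t)"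
  proof (cases "t \<le> 0")
    case True
    have "\<forall>\<^sub>F v in at_left t. v < t" by (simp add: eventually_at_filter)
    then have "\<forall>\<^sub>F v in at_left t. x (max 0 v) = x 0" by eventually_elim (use True in auto)
    then show ?thesis by (intro exI tendsto_eventually)
  next
    case False
    then have "\<exists>l. (x \<longlongrightarrow> l) (at_left t)" using assms unfolding regulated_def by (simp add: not_less not_le)
    then obtain l where "(x \<longlongrightarrow> l) (at_left t)" ..
    moreover have "\<forall>\<^sub>F v in at_left t. 0 < v" using False by (auto simp: eventually_at_left_field intro!: exI[of _ 0])
    then have "\<forall>\<^sub>F v in at_left t. x v = x (max 0 v)" by eventually_elim auto
    ultimately show ?thesis by (intro exI) (rule Lim_transform_eventually)
  qed
qed

lemma borel_imp_lebesgue_on: "f \<in> borel_measurable borel \<Longrightarrow> f \<in> borel_measurable (lebesgue_on S)"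
  by (simp add: measurable_completion measurable_restrict_space1)

context integrator
begin

lemma \<gamma>_measurable:
  assumes "0 \<le> b"
  shows "\<gamma> \<in> borel_measurable (lebesgue_on {g 0..<g b})"
proof -
  define c where "c y = (if y < g 0 then 0 else if y < g b then \<gamma> y else b)" for y
  have "mono c"
  proof (rule monoI)
    fix y y' :: real assume "y \<le> y'"
    have "0 \<le> \<gamma> z \<and> \<gamma> z \<le> b" if "g 0 \<le> z" "z < g b" for z
      using \<gamma>_less[of z b] in_J[of 0 b z] \<gamma>_nonneg[of z] assms that by auto
    moreover have "\<gamma> y \<le> \<gamma> y'" if "g 0 \<le> y" "y' < g b"
    proof -
      have "y \<in> J" "y' \<in> J" using that \<open>y \<le> y'\<close> assms in_J[of 0 b] by auto
      then show ?thesis using \<gamma>_galois[of y' "\<gamma> y"] g_\<gamma>_le[of y] \<gamma>_nonneg[of y] \<open>y \<le> y'\<close> by auto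
    qed
    ultimately show "c y \<le> c y'" unfolding c_def using \<open>y \<le> y'\<close> assms by auto
  qed
  then have "c \<in> borel_measurable (lebesgue_on {g 0..<g b})" by (intro borel_imp_lebesgue_on borel_measurable_mono)
  then show ?thesis by (rule measurable_cong[THEN iffD1, rotated]) (auto simp: c_def)
qed

end

section \<open>The Caratheodory integral equation by Euler polygons\<close>

text \<open>
  The norm is arbitrary, so the inequality is read off from Riemann sums.
\<close>
lemma is_norm_integral_le:
  fixes F :: "real \<Rightarrow> 'a::euclidean_space" and m :: "real \<Rightarrow> real"
  assumes n: "is_norm nrm" and F: "F integrable_on {a..b}" and m: "m integrable_on {a..b}"
    and le: "\<And>y. y \<in> {a..b} \<Longrightarrow> nrm (F y) \<le> m y"
  shows "nrm (integral {a..b} F) \<le> integral {a..b} m"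
proof (rule field_le_epsilon)
  fix e :: real assume "e > 0"
  obtain C where C: "C > 0" "\<And>u. nrm u \<le> C * norm u" using is_norm_le_norm[OF n] by blast
  have "e / (2 * C) > 0" "e / 2 > 0" using \<open>e > 0\<close> C(1) by auto
  obtain \<gamma>1 where 1: "gauge \<gamma>1 \<and> (\<forall>\<D>. \<D> tagged_division_of {a..b} \<and> \<gamma>1 fine \<D> \<longrightarrow>
      norm ((\<Sum>(x,K)\<in>\<D>. measure lborel K *\<^sub>R F x) - integral {a..b} F) < e / (2 * C))"
    using integrable_integral[OF F, unfolded has_integral_real, THEN spec, THEN mp, OF \<open>e / (2 * C) > 0\<close>] ..
  obtain \<gamma>2 where 2: "gauge \<gamma>2 \<and> (\<forall>\<D>. \<D> tagged_division_of {a..b} \<and> \<gamma>2 fine \<D> \<longrightarrow>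
      norm ((\<Sum>(x,K)\<in>\<D>. measure lborel K *\<^sub>R m x) - integral {a..b} m) < e / 2)"
    using integrable_integral[OF m, unfolded has_integral_real, THEN spec, THEN mp, OF \<open>e / 2 > 0\<close>] ..
  have "gauge (\<lambda>x. \<gamma>1 x \<inter> \<gamma>2 x)" using gauge_Int[OF conjunct1[OF 1] conjunct1[OF 2]] .
  then obtain p where p: "p tagged_division_of {a..b}" "(\<lambda>x. \<gamma>1 x \<inter> \<gamma>2 x) fine p"
    by (rule fine_division_exists_real)
  then have "\<gamma>1 fine p" "\<gamma>2 fine p" by (auto simp: fine_Int)
  then have A: "norm ((\<Sum>(x,K)\<in>p. measure lborel K *\<^sub>R F x) - integral {a..b} F) < e / (2 * C)"
    and B: "norm ((\<Sum>(x,K)\<in>p. measure lborel K *\<^sub>R m x) - integral {a..b} m) < e / 2"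
    using 1 2 p(1) by blast+
  have "nrm (integral {a..b} F) \<le> nrm (integral {a..b} F - (\<Sum>(x,K)\<in>p. measure lborel K *\<^sub>R F x)) + nrm (\<Sum>(x,K)\<in>p. measure lborel K *\<^sub>R F x)"
    using is_norm_triangle_diff[OF n, of "integral {a..b} F" 0 "\<Sum>(x,K)\<in>p. measure lborel K *\<^sub>R F x"] by simp
  also have "nrm (integral {a..b} F - (\<Sum>(x,K)\<in>p. measure lborel K *\<^sub>R F x)) \<le> C * norm ((\<Sum>(x,K)\<in>p. measure lborel K *\<^sub>R F x) - integral {a..b} F)"
    using C(2) by (metis norm_minus_commute)
  also have "\<dots> \<le> e / 2" using A C(1) by (simp add: field_simps)
  also have "nrm (\<Sum>(x,K)\<in>p. measure lborel K *\<^sub>R F x) \<le> (\<Sum>z\<in>p. nrm ((\<lambda>(x,K). measure lborel K *\<^sub>R F x) z))"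
    by (rule is_norm_sum[OF n])
  also have "\<dots> \<le> (\<Sum>(x,K)\<in>p. measure lborel K *\<^sub>R m x)"
  proof (rule sum_mono, clarify)
    fix x K assume "(x, K) \<in> p"
    then have "x \<in> {a..b}" using tagged_division_ofD(2,3)[OF p(1)] by blast
    then show "nrm (measure lborel K *\<^sub>R F x) \<le> measure lborel K *\<^sub>R m x"
      using le by (simp add: is_norm_scaleR[OF n] mult_left_mono)
  qed
  also have "\<dots> \<le> integral {a..b} m + e / 2" using B[unfolded real_norm_def] by linarith
  finally show "nrm (integral {a..b} F) \<le> integral {a..b} m + e" by simp
qed

text \<open>
  Helly's selection principle for a common modulus.  The function \<open>\<mu>\<close> may jump; density of the countable set
  \<open>d\<close> is measured through \<open>\<mu>\<close> itself, so that a diagonal subsequence converging on \<open>d\<close> converges everywhere.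
\<close>
lemma equicontinuous_pointwise_subsequence:
  fixes Y :: "nat \<Rightarrow> real \<Rightarrow> 'a::euclidean_space" and \<mu> :: "real \<Rightarrow> real"
  assumes bdd: "\<And>n t. t \<in> T \<Longrightarrow> norm (Y n t) \<le> B"
    and equi: "\<And>n s t. s \<in> T \<Longrightarrow> t \<in> T \<Longrightarrow> norm (Y n t - Y n s) \<le> \<bar>\<mu> t - \<mu> s\<bar>"
  shows "\<exists>r y. strict_mono (r :: nat \<Rightarrow> nat) \<and> (\<forall>t\<in>T. (\<lambda>i. Y (r i) t) \<longlonglongrightarrow> y t)"
proof (cases "T = {}")
  case True
  then show ?thesis by (intro exI[of _ id] exI[of _ "\<lambda>_. 0"]) (auto simp: strict_mono_def)
next
  case False
  obtain Q where Q: "countable Q" "Q \<subseteq> \<mu> ` T" "\<mu> ` T \<subseteq> closure Q" by (rule separable)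
  have Qne: "Q \<noteq> {}" using Q(3) False by auto
  have "\<exists>d\<in>T. \<mu> d = from_nat_into Q k" for k using from_nat_into[OF Qne, of k] Q(2) by force
  then obtain d where d: "\<And>k. d k \<in> T" "\<And>k. \<mu> (d k) = from_nat_into Q k" by metis
  have dense: "\<exists>k. \<bar>\<mu> t - \<mu> (d k)\<bar> < e" if "t \<in> T" "e > 0" for t e
  proof -
    have "\<mu> t \<in> closure Q" using Q(3) that by auto
    then obtain x where "x \<in> Q" "dist x (\<mu> t) < e" using \<open>e > 0\<close> by (auto simp: closure_approachable)
    moreover obtain k where "from_nat_into Q k = x" using from_nat_into_surj[OF Q(1) \<open>x \<in> Q\<close>] by blast
    ultimately have "\<bar>\<mu> t - \<mu> (d k)\<bar> < e" using d(2)[of k] by (simp add: dist_real_def abs_minus_commute)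
    then show ?thesis ..
  qed
  interpret subseqs "\<lambda>k s. convergent (\<lambda>i. Y (s i) (d k))"
  proof
    fix k and s :: "nat \<Rightarrow> nat"
    have "bounded (range (\<lambda>i. Y (s i) (d k)))"
      using bdd[OF d(1)] by (intro boundedI[of _ B]) auto
    then obtain l r where "strict_mono r" "((\<lambda>i. Y (s i) (d k)) \<circ> r) \<longlonglongrightarrow> l"
      using bounded_imp_convergent_subsequence by blast
    then show "\<exists>r'. strict_mono r' \<and> convergent (\<lambda>i. Y ((s \<circ> r') i) (d k))"
      by (intro exI[of _ r]) (auto simp: convergent_def o_def)
  qed
  have conv_d: "convergent (\<lambda>i. Y (diagseq i) (d k))" for k
  proof -
    have "convergent (\<lambda>i. Y ((diagseq \<circ> (+) (Suc k)) i) (d k))"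
    proof (rule diagseq_holds)
      fix r s :: "nat \<Rightarrow> nat" and n
      assume "strict_mono r" "convergent (\<lambda>i. Y (s i) (d n))"
      then show "convergent (\<lambda>i. Y ((s \<circ> r) i) (d n))"
        using convergent_subseq_convergent[of "\<lambda>i. Y (s i) (d n)" r] by (simp add: o_def)
    qed
    then have "convergent (\<lambda>i. Y (diagseq (i + Suc k)) (d k))" by (simp add: o_def add.commute)
    then show ?thesis using convergent_ignore_initial_segment[of "\<lambda>i. Y (diagseq i) (d k)" "Suc k"] by simp
  qed
  have "convergent (\<lambda>i. Y (diagseq i) t)" if t: "t \<in> T" for t
  proof -
    have "Cauchy (\<lambda>i. Y (diagseq i) t)"
    proof (rule metric_CauchyI)
      fix e :: real assume "e > 0"
      then obtain k where k: "\<bar>\<mu> t - \<mu> (d k)\<bar> < e / 3" using dense[OF t, of "e / 3"] by auto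
      have "Cauchy (\<lambda>i. Y (diagseq i) (d k))" using conv_d by (rule convergent_Cauchy)
      then obtain M where M: "\<And>i j. i \<ge> M \<Longrightarrow> j \<ge> M \<Longrightarrow> dist (Y (diagseq i) (d k)) (Y (diagseq j) (d k)) < e / 3"
        using metric_CauchyD[of _ "e / 3"] \<open>e > 0\<close> by (metis zero_less_divide_iff zero_less_numeral)
      show "\<exists>M. \<forall>m\<ge>M. \<forall>n\<ge>M. dist (Y (diagseq m) t) (Y (diagseq n) t) < e"
      proof (intro exI allI impI)
        fix i j assume "M \<le> i" "M \<le> j"
        have near: "dist (Y n t) (Y n (d k)) < e / 3" for n
          using equi[OF d(1) t, of n k] k unfolding dist_norm by linarith
        have "dist (Y (diagseq i) t) (Y (diagseq j) t) \<le> dist (Y (diagseq i) t) (Y (diagseq i) (d k))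
           + dist (Y (diagseq i) (d k)) (Y (diagseq j) (d k)) + dist (Y (diagseq j) (d k)) (Y (diagseq j) t)"
          using dist_triangle[of "Y (diagseq i) t" "Y (diagseq j) t" "Y (diagseq i) (d k)"]
            dist_triangle[of "Y (diagseq i) (d k)" "Y (diagseq j) t" "Y (diagseq j) (d k)"] by linarith
        also have "\<dots> < e / 3 + e / 3 + e / 3"
          using near[of "diagseq i"] near[of "diagseq j"] M[OF \<open>M \<le> i\<close> \<open>M \<le> j\<close>] by (simp add: dist_commute)
        finally show "dist (Y (diagseq i) t) (Y (diagseq j) t) < e" by simp
      qed
    qed
    then show ?thesis by (rule Cauchy_convergent)
  qed
  then have "\<forall>t\<in>T. (\<lambda>i. Y (diagseq i) t) \<longlonglongrightarrow> lim (\<lambda>i. Y (diagseq i) t)"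
    by (simp add: convergent_LIMSEQ_iff)
  then show ?thesis using subseq_diagseq by (intro exI[of _ diagseq] exI[of _ "\<lambda>t. lim (\<lambda>i. Y (diagseq i) t)"]) simp
qed

text \<open>
  Caratheodory conditions for the integral equation \<open>y t = c + \<integral> E v (y (\<gamma> v)) dv\<close> over \<open>[g 0, g t]\<close>, on the ball
  around \<open>c\<close> whose radius \<open>I\<close> bounds the total mass of the majorant \<open>mm\<close>.  An
  indefinite integral that starts at \<open>c\<close> therefore stays in that ball for all times.  Off \<open>J\<close> the times \<open>\<gamma> v\<close> are
  meaningless and \<open>E\<close> is required to vanish.
\<close>
locale caratheodory = integrator +
  fixes nrm :: "'a::euclidean_space \<Rightarrow> real" and E :: "real \<Rightarrow> 'a \<Rightarrow> 'a" and mm :: "real \<Rightarrow> real"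
    and c :: 'a and I :: real
  assumes n: "is_norm nrm"
    and meas: "\<And>u b. nrm (u - c) \<le> I \<Longrightarrow> 0 \<le> b \<Longrightarrow> (\<lambda>y. E y u) \<in> borel_measurable (lebesgue_on {g 0..<g b})"
    and cont: "\<And>y. continuous_on {u. nrm (u - c) \<le> I} (E y)"
    and dom: "\<And>y u. nrm (u - c) \<le> I \<Longrightarrow> nrm (E y u) \<le> mm y"
    and zero: "\<And>y u. y \<notin> J \<Longrightarrow> E y u = 0"
    and intmm: "\<And>b. 0 \<le> b \<Longrightarrow> mm integrable_on {g 0..g b}"
    and tot: "\<And>b. 0 \<le> b \<Longrightarrow> integral {g 0..g b} mm \<le> I"
begin

definition \<mu> :: "real \<Rightarrow> real" where "\<mu> t = integral {g 0..g t} mm"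

lemma \<mu>_0: "\<mu> 0 = 0" unfolding \<mu>_def by simp

lemma I_nonneg: "0 \<le> I" using tot[of 0] by simp

lemma c_in: "nrm (c - c) \<le> I" using I_nonneg is_norm_zero[OF n] by simp

lemma mm_nonneg: "0 \<le> mm y"
  using dom[OF c_in, of y] is_norm_ge_0[OF n, of "E y c"] by linarith

lemma \<mu>_diff: "0 \<le> s \<Longrightarrow> s \<le> t \<Longrightarrow> \<mu> t - \<mu> s = integral {g s..g t} mm"
  unfolding \<mu>_def by (rule indefinite_integral_diff[OF intmm[of t]]) (auto intro: mono)

lemma \<mu>_le: "0 \<le> t \<Longrightarrow> \<mu> t \<le> I" unfolding \<mu>_def by (rule tot)

lemma norm_dominated: "\<exists>C>0. \<forall>u. norm u \<le> C * nrm u" by (rule norm_le_is_norm[OF n])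

lemma integrable_dominated:
  assumes f: "f \<in> borel_measurable (lebesgue_on {g 0..<g b})" and le: "\<And>y. nrm (f y) \<le> mm y" and b: "0 \<le> b"
  shows "f integrable_on {g 0..g b}"
proof -
  obtain C where C: "C > 0" "\<And>u. norm u \<le> C * nrm u" using norm_dominated by blast
  have "mm integrable_on {g 0..<g b}"
    by (rule integrable_spike_set[OF intmm[OF b]]) (auto intro: negligible_subset[of "{g b}"])
  then have "(\<lambda>y. C * mm y) integrable_on {g 0..<g b}" by (rule integrable_on_mult_right)
  then have "f integrable_on {g 0..<g b}"
  proof (rule measurable_bounded_by_integrable_imp_integrable[OF f])
    fix y
    have "norm (f y) \<le> C * nrm (f y)" by (rule C)
    also have "\<dots> \<le> C * mm y" using le C(1) by simp
    finally show "norm (f y) \<le> C * mm y" .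
  qed simp
  then show ?thesis
    by (rule integrable_spike_set) (auto intro: negligible_subset[of "{g b}"])
qed

lemma integral_dominated:
  assumes f: "f integrable_on {g 0..g t}" and le: "\<And>y. nrm (f y) \<le> mm y" and st: "0 \<le> s" "s \<le> t"
  shows "nrm (integral {g s..g t} f) \<le> \<mu> t - \<mu> s"
  unfolding \<mu>_diff[OF st]
  by (rule is_norm_integral_le[OF n]) (use integrable_subinterval_real[OF f, of "g s" "g t"]
      integrable_subinterval_real[OF intmm[of t], of "g s" "g t"] mono[of 0 s] st le in auto)

text \<open>
  The polygon \<open>y\<close> freezes the second argument of \<open>E\<close> at the last point \<open>j/k\<close> of the time grid.  The grid values
  \<open>z j\<close> are defined by recursion; \<open>y\<close> is then the integral of a single measurable function, and \<open>y\<close> takes the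
  values \<open>z j\<close> on the grid because \<open>\<gamma> v\<close> lies in \<open>[j/k, (j+1)/k)\<close> for \<open>v\<close> in \<open>[g (j/k), g ((j+1)/k))\<close>.
\<close>
lemma euler_polygon:
  assumes k: "0 < (k::real)"
  shows "\<exists>y. (\<forall>t\<ge>0. nrm (y t - c) \<le> I) \<and> (\<forall>s t. 0 \<le> s \<longrightarrow> s \<le> t \<longrightarrow> nrm (y t - y s) \<le> \<mu> t - \<mu> s) \<and>
    (\<forall>t\<ge>0. (\<lambda>v. E v (y (of_int \<lfloor>k * \<gamma> v\<rfloor> / k))) integrable_on {g 0..g t} \<and>
       y t = c + integral {g 0..g t} (\<lambda>v. E v (y (of_int \<lfloor>k * \<gamma> v\<rfloor> / k))))"
proof -
  define T where "T j = real j / k" for j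
  have T: "0 \<le> T j" "T j \<le> T (Suc j)" "T 0 = 0" for j unfolding T_def using k by (auto simp: field_simps)
  define z where "z = rec_nat c (\<lambda>j u. u + integral {g (T j)..g (T (Suc j))} (\<lambda>v. E v u))"
  have z0: "z 0 = c" and zS: "z (Suc j) = z j + integral {g (T j)..g (T (Suc j))} (\<lambda>v. E v (z j))" for j
    unfolding z_def by simp_all
  have intE: "(\<lambda>v. E v u) integrable_on {g 0..g b}" if "nrm (u - c) \<le> I" "0 \<le> b" for u b
    using integrable_dominated[OF meas[OF that] _ that(2)] dom[OF that(1)] by blast
  have z\<mu>: "nrm (z j - c) \<le> \<mu> (T j)" for j
  proof (induction j)
    case 0 show ?case using T(3) \<mu>_0 is_norm_zero[OF n] z0 by simp
  next
    case (Suc j)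
    then have zj: "nrm (z j - c) \<le> I" using \<mu>_le[OF T(1)[of j]] by linarith
    have "nrm (integral {g (T j)..g (T (Suc j))} (\<lambda>v. E v (z j))) \<le> \<mu> (T (Suc j)) - \<mu> (T j)"
      by (rule integral_dominated[OF intE[OF zj T(1)] dom[OF zj] T(1,2)])
    then show ?case using Suc is_norm_triangle[OF n, of "z j - c" "integral {g (T j)..g (T (Suc j))} (\<lambda>v. E v (z j))"]
      unfolding zS by (simp add: algebra_simps)
  qed
  have zI: "nrm (z j - c) \<le> I" for j using z\<mu>[of j] \<mu>_le[OF T(1)[of j]] by linarith
  define e where "e v = E v (z (nat \<lfloor>k * \<gamma> v\<rfloor>))" for v
  have e_le: "nrm (e v) \<le> mm v" for v unfolding e_def by (rule dom[OF zI])
  have e_int: "e integrable_on {g 0..g t}" if "0 \<le> t" for t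
  proof (rule integrable_dominated[OF _ e_le that])
    have "(\<lambda>s. nat \<lfloor>k * s\<rfloor>) \<in> borel \<rightarrow>\<^sub>M count_space UNIV" by measurable
    then have "(\<lambda>v. nat \<lfloor>k * \<gamma> v\<rfloor>) \<in> lebesgue_on {g 0..<g t} \<rightarrow>\<^sub>M count_space UNIV"
      by (rule measurable_compose[OF \<gamma>_measurable[OF that]])
    then show "e \<in> borel_measurable (lebesgue_on {g 0..<g t})"
      unfolding e_def using meas[OF zI that] 
      by (intro measurable_compose_countable[where f = "\<lambda>i v. E v (z i)" and g = "\<lambda>v. nat \<lfloor>k * \<gamma> v\<rfloor>"])
  qed
  define y where "y t = c + integral {g 0..g t} e" for t
  have y_diff: "y t - y s = integral {g s..g t} e" if "0 \<le> s" "s \<le> t" for s t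
    unfolding y_def using indefinite_integral_diff[OF e_int[of t], of "g s" "g t"] mono[of 0 s] mono[of s t] that by simp
  have y_mod: "nrm (y t - y s) \<le> \<mu> t - \<mu> s" if "0 \<le> s" "s \<le> t" for s t
    unfolding y_diff[OF that] using integral_dominated[OF e_int e_le that] that by simp
  have yT: "y (T j) = z j" for j
  proof (induction j)
    case 0 show ?case by (simp add: y_def T(3) z0)
  next
    case (Suc j)
    have "integral {g (T j)..g (T (Suc j))} e = integral {g (T j)..g (T (Suc j))} (\<lambda>v. E v (z j))"
    proof (rule integral_spike[of "{g (T (Suc j))}"])
      fix v assume "v \<in> {g (T j)..g (T (Suc j))} - {g (T (Suc j))}"
      then have v: "g (T j) \<le> v" "v < g (T (Suc j))" by auto
      have vJ: "v \<in> J" using in_J[OF T(1) T(1) v] .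
      have "T j \<le> \<gamma> v" "\<gamma> v < T (Suc j)" using \<gamma>_galois[OF vJ T(1)] \<gamma>_less[OF vJ T(1)] v by auto
      then have "real j \<le> k * \<gamma> v" "k * \<gamma> v < real j + 1" unfolding T_def using k by (auto simp: field_simps)
      then have "\<lfloor>k * \<gamma> v\<rfloor> = int j" by (simp add: floor_eq_iff)
      then show "E v (z j) = e v" unfolding e_def by simp
    qed auto
    then show ?case using y_diff[OF T(1,2), of j] Suc unfolding zS by (simp add: algebra_simps)
  qed
  have e_eq: "E v (y (of_int \<lfloor>k * \<gamma> v\<rfloor> / k)) = e v" for v
  proof (cases "v \<in> J")
    case True
    have "0 \<le> k * \<gamma> v" using \<gamma>_nonneg[OF True] k by simp
    then have "of_int \<lfloor>k * \<gamma> v\<rfloor> / k = T (nat \<lfloor>k * \<gamma> v\<rfloor>)" unfolding T_def by simp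
    then show ?thesis unfolding e_def using yT by simp
  next
    case False then show ?thesis unfolding e_def using zero by simp
  qed
  show ?thesis
  proof (intro exI[of _ y] conjI allI impI)
    show "nrm (y t - c) \<le> I" if "0 \<le> t" for t
      using y_mod[of 0 t] that \<mu>_0 \<mu>_le[OF that] by (simp add: y_def)
  qed (use y_mod e_int e_eq in \<open>auto simp: y_def\<close>)
qed

text \<open>
  The polygons share the modulus \<open>\<mu>\<close>, so a subsequence converges pointwise to some \<open>y\<close>.  The grid point
  \<open>a i\<close> to the left of \<open>\<tau> = \<gamma> v\<close> tends to \<open>\<tau>\<close>, and since \<open>g\<close>, hence \<open>\<mu>\<close>, is left-continuous, the frozen
  argument \<open>Y (r i) (a i)\<close> has the same limit as \<open>Y (r i) \<tau>\<close>.  Dominated convergence finishes the proof.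
\<close>
theorem integral_equation_solvable:
  "\<exists>y. (\<forall>t\<ge>0. nrm (y t - c) \<le> I) \<and> (\<forall>s t. 0 \<le> s \<longrightarrow> s \<le> t \<longrightarrow> nrm (y t - y s) \<le> \<mu> t - \<mu> s) \<and>
    (\<forall>t\<ge>0. (\<lambda>v. E v (y (\<gamma> v))) integrable_on {g 0..g t} \<and>
       y t = c + integral {g 0..g t} (\<lambda>v. E v (y (\<gamma> v))))"
proof -
  define \<theta> where "\<theta> i s = of_int \<lfloor>real (Suc i) * s\<rfloor> / real (Suc i)" for i s
  have "\<forall>i. \<exists>y. (\<forall>t\<ge>0. nrm (y t - c) \<le> I) \<and> (\<forall>s t. 0 \<le> s \<longrightarrow> s \<le> t \<longrightarrow> nrm (y t - y s) \<le> \<mu> t - \<mu> s) \<and>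
    (\<forall>t\<ge>0. (\<lambda>v. E v (y (\<theta> i (\<gamma> v)))) integrable_on {g 0..g t} \<and>
       y t = c + integral {g 0..g t} (\<lambda>v. E v (y (\<theta> i (\<gamma> v)))))"
    unfolding \<theta>_def by (intro allI euler_polygon) simp
  from choice[OF this] obtain Y where Y: "\<And>i t. 0 \<le> t \<Longrightarrow> nrm (Y i t - c) \<le> I"
    "\<And>i s t. 0 \<le> s \<Longrightarrow> s \<le> t \<Longrightarrow> nrm (Y i t - Y i s) \<le> \<mu> t - \<mu> s"
    "\<And>i t. 0 \<le> t \<Longrightarrow> (\<lambda>v. E v (Y i (\<theta> i (\<gamma> v)))) integrable_on {g 0..g t}"
    "\<And>i t. 0 \<le> t \<Longrightarrow> Y i t = c + integral {g 0..g t} (\<lambda>v. E v (Y i (\<theta> i (\<gamma> v))))" by blast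
  obtain C where C: "C > 0" "\<And>u. norm u \<le> C * nrm u" using norm_dominated by blast
  have Y_mod: "norm (Y i t - Y i s) \<le> C * (\<mu> t - \<mu> s)" if "0 \<le> s" "s \<le> t" for i s t
    using C(2)[of "Y i t - Y i s"] mult_left_mono[OF Y(2)[OF that, of i], of C] C(1) by linarith
  have "\<exists>r y. strict_mono (r :: nat \<Rightarrow> nat) \<and> (\<forall>t\<in>{0..}. (\<lambda>i. Y (r i) t) \<longlonglongrightarrow> y t)"
  proof (rule equicontinuous_pointwise_subsequence)
    fix i t assume "t \<in> {0::real..}"
    then have "C * nrm (Y i t - c) \<le> C * I" using Y(1)[of t i] C(1) by simp
    then have "norm (Y i t - c) \<le> C * I" using C(2)[of "Y i t - c"] by linarith
    then show "norm (Y i t) \<le> C * I + norm c" using norm_triangle_sub[of "Y i t" c] by linarith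
  next
    fix i s t assume st: "s \<in> {0::real..}" "t \<in> {0::real..}"
    show "norm (Y i t - Y i s) \<le> \<bar>C * \<mu> t - C * \<mu> s\<bar>"
    proof (cases "s \<le> t")
      case True
      then show ?thesis using Y_mod[of s t i] st by (simp add: right_diff_distrib)
    next
      case False
      then have "norm (Y i s - Y i t) \<le> C * (\<mu> s - \<mu> t)" using Y_mod[of t s i] st by auto
      then show ?thesis by (simp add: norm_minus_commute right_diff_distrib)
    qed
  qed
  then obtain r :: "nat \<Rightarrow> nat" and y where r: "strict_mono r" and ylim: "\<And>t. 0 \<le> t \<Longrightarrow> (\<lambda>i. Y (r i) t) \<longlonglongrightarrow> y t" by auto
  note nlim = is_norm_tendsto[OF n]
  have y1: "nrm (y t - c) \<le> I" if "0 \<le> t" for t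
    by (rule LIMSEQ_le_const2[OF nlim[OF tendsto_diff[OF ylim[OF that] tendsto_const]]]) (use Y(1)[OF that] in blast)
  have y2: "nrm (y t - y s) \<le> \<mu> t - \<mu> s" if "0 \<le> s" "s \<le> t" for s t
    by (rule LIMSEQ_le_const2[OF nlim[OF tendsto_diff[OF ylim ylim]]]) (use Y(2)[OF that] that in auto)
  have conv: "(\<lambda>i. E v (Y (r i) (\<theta> (r i) (\<gamma> v)))) \<longlonglongrightarrow> E v (y (\<gamma> v))" for v
  proof (cases "v \<in> J")
    case True
    define \<tau> where "\<tau> = \<gamma> v"
    have \<tau>: "0 \<le> \<tau>" unfolding \<tau>_def by (rule \<gamma>_nonneg[OF True])
    define a where "a i = \<theta> (r i) \<tau>" for i
    have a: "0 \<le> a i" "a i \<le> \<tau>" "\<tau> - inverse (real (Suc (r i))) \<le> a i" for i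
    proof -
      have 1: "real_of_int \<lfloor>real (Suc (r i)) * \<tau>\<rfloor> \<le> real (Suc (r i)) * \<tau>" "real (Suc (r i)) * \<tau> \<le> real_of_int \<lfloor>real (Suc (r i)) * \<tau>\<rfloor> + 1" by linarith+
      have "0 \<le> \<lfloor>real (Suc (r i)) * \<tau>\<rfloor>" using \<tau> by simp
      then show "0 \<le> a i" unfolding a_def \<theta>_def by simp
      show "a i \<le> \<tau>" unfolding a_def \<theta>_def using 1(1) by (simp add: field_simps del: of_nat_Suc)
      have "\<tau> \<le> (real_of_int \<lfloor>real (Suc (r i)) * \<tau>\<rfloor> + 1) / real (Suc (r i))"
        using 1(2) by (simp add: pos_le_divide_eq mult.commute del: of_nat_Suc)
      then show "\<tau> - inverse (real (Suc (r i))) \<le> a i"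
        unfolding a_def \<theta>_def by (simp add: add_divide_distrib inverse_eq_divide del: of_nat_Suc)
    qed
    have "(\<lambda>i. inverse (real (Suc (r i)))) \<longlonglongrightarrow> 0"
      using LIMSEQ_subseq_LIMSEQ[OF LIMSEQ_inverse_real_of_nat r] by (simp add: o_def)
    then have l: "(\<lambda>i. \<tau> - inverse (real (Suc (r i)))) \<longlonglongrightarrow> \<tau> - 0" by (intro tendsto_intros)
    have alim: "a \<longlonglongrightarrow> \<tau>"
      by (rule tendsto_sandwich[OF _ _ l[simplified] tendsto_const]) (use a in \<open>auto intro: always_eventually\<close>)
    have glim: "(\<lambda>i. g (a i)) \<longlonglongrightarrow> g \<tau>" by (rule tendsto_left[OF a(1,2) alim])
    have "(\<lambda>i. integral {g 0..g (a i)} mm) \<longlonglongrightarrow> integral {g 0..g \<tau>} mm"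
      by (rule continuous_on_tendsto_compose[OF indefinite_integral_continuous_1[OF intmm[OF \<tau>]] glim])
        (use mono a \<tau> in \<open>auto intro!: always_eventually\<close>)
    then have \<mu>lim: "(\<lambda>i. C * (\<mu> \<tau> - \<mu> (a i))) \<longlonglongrightarrow> C * (\<mu> \<tau> - \<mu> \<tau>)"
      unfolding \<mu>_def by (intro tendsto_intros)
    have "(\<lambda>i. Y (r i) \<tau> - Y (r i) (a i)) \<longlonglongrightarrow> 0"
      by (rule Lim_null_comparison[OF always_eventually \<mu>lim[simplified]]) (use Y_mod a in auto)
    then have "(\<lambda>i. Y (r i) \<tau> - (Y (r i) \<tau> - Y (r i) (a i))) \<longlonglongrightarrow> y \<tau> - 0"
      by (intro tendsto_diff ylim \<tau>)
    then have "(\<lambda>i. Y (r i) (a i)) \<longlonglongrightarrow> y \<tau>" by simp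
    then show ?thesis unfolding \<tau>_def[symmetric] a_def[symmetric]
      by (rule continuous_on_tendsto_compose[OF cont]) (use y1[OF \<tau>] Y(1)[OF a(1)] in \<open>auto intro!: always_eventually\<close>)
  next
    case False
    then show ?thesis using zero by simp
  qed
  have in_ball: "nrm (Y i (\<theta> i (\<gamma> v)) - c) \<le> I" if "v \<in> J" for i v
    using \<gamma>_nonneg[OF that] by (intro Y(1)) (simp add: \<theta>_def)
  have h: "(\<lambda>v. C * mm v) integrable_on {g 0..g t}" if "0 \<le> t" for t
    by (rule integrable_on_mult_right[OF intmm[OF that]])
  have le: "norm (E v (Y (r i) (\<theta> (r i) (\<gamma> v)))) \<le> C * mm v" for i v
  proof (cases "v \<in> J")
    case True
    have "norm (E v (Y (r i) (\<theta> (r i) (\<gamma> v)))) \<le> C * nrm (E v (Y (r i) (\<theta> (r i) (\<gamma> v))))" by (rule C(2))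
    also have "\<dots> \<le> C * mm v" using dom[OF in_ball[OF True, of "r i"], of v] C(1) by simp
    finally show ?thesis .
  next
    case False
    then show ?thesis using zero mm_nonneg C(1) by simp
  qed
  have dc: "(\<lambda>v. E v (y (\<gamma> v))) integrable_on {g 0..g t}"
    "(\<lambda>i. integral {g 0..g t} (\<lambda>v. E v (Y (r i) (\<theta> (r i) (\<gamma> v))))) \<longlonglongrightarrow> integral {g 0..g t} (\<lambda>v. E v (y (\<gamma> v)))"
    if t: "0 \<le> t" for t
    by (rule dominated_convergence[where f = "\<lambda>i v. E v (Y (r i) (\<theta> (r i) (\<gamma> v)))" and h = "\<lambda>v. C * mm v"];
        (rule Y(3)[OF t] | rule h[OF t] | rule le | rule conv))+
  show ?thesis
  proof (intro exI[of _ y] conjI allI impI y1 y2 dc(1))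
    fix t :: real assume t: "0 \<le> t"
    have "(\<lambda>i. c + integral {g 0..g t} (\<lambda>v. E v (Y (r i) (\<theta> (r i) (\<gamma> v))))) \<longlonglongrightarrow> c + integral {g 0..g t} (\<lambda>v. E v (y (\<gamma> v)))"
      by (intro tendsto_intros dc(2)[OF t])
    then have "(\<lambda>i. Y (r i) t) \<longlonglongrightarrow> c + integral {g 0..g t} (\<lambda>v. E v (y (\<gamma> v)))" using Y(4)[OF t] by simp
    then show "y t = c + integral {g 0..g t} (\<lambda>v. E v (y (\<gamma> v)))" by (rule LIMSEQ_unique[OF ylim[OF t]])
  qed
qed

end

text \<open>
  The indefinite integral is continuous in the level, and \<open>g\<close> itself has one-sided limits.
\<close>
lemma (in integrator) regulated_indefinite_integral:
  fixes F :: "real \<Rightarrow> 'a::euclidean_space"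
  assumes int: "\<And>b. 0 \<le> b \<Longrightarrow> F integrable_on {g 0..g b}"
  shows "regulated (\<lambda>t. integral {g 0..g t} F)"
  unfolding regulated_def
proof (intro conjI allI impI)
  fix t :: real assume t: "0 \<le> t"
  define L where "L = Inf (g ` {t<..})"
  have bdd: "bdd_below (g ` {t<..})" using mono[OF t] by (intro bdd_belowI[of _ "g t"]) auto
  have L1: "L \<le> g s" if "t < s" for s unfolding L_def using that bdd by (intro cInf_lower) auto
  have L2: "g t \<le> L" unfolding L_def using mono[OF t] by (intro cInf_greatest) (auto simp: greaterThan_non_empty)
  have glim: "(g \<longlongrightarrow> L) (at_right t)"
  proof (rule decreasing_tendsto)
    show "\<forall>\<^sub>F s in at_right t. L \<le> g s"
      using eventually_at_right_less[of t] by eventually_elim (rule L1)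
    fix x assume "L < x"
    then have "\<exists>v\<in>g ` {t<..}. v < x" using bdd unfolding L_def by (subst cInf_less_iff[symmetric]) auto
    then obtain s where s: "t < s" "g s < x" by auto
    have "\<forall>\<^sub>F v in at_right t. v < s" using s(1) by (auto simp: eventually_at_right_field)
    with eventually_at_right_less[of t] show "\<forall>\<^sub>F v in at_right t. g v < x"
    proof eventually_elim
      case (elim v)
      then show ?case using mono[of v s] s t by auto
    qed
  qed
  have "((\<lambda>s. integral {g 0..g s} F) \<longlongrightarrow> integral {g 0..L} F) (at_right t)"
  proof (rule continuous_on_tendsto_compose[OF indefinite_integral_continuous_1[OF int] glim])
    show "0 \<le> t + 1" using t by simp
    show "L \<in> {g 0..g (t + 1)}" using L1[of "t + 1"] L2 mono[of 0 t] t by auto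
    have "\<forall>\<^sub>F s in at_right t. s < t + 1" by (auto simp: eventually_at_right_field intro!: exI[of _ "t + 1"])
    with eventually_at_right_less[of t] show "\<forall>\<^sub>F s in at_right t. g s \<in> {g 0..g (t + 1)}"
      by eventually_elim (use mono t in auto)
  qed
  then show "\<exists>L. ((\<lambda>s. integral {g 0..g s} F) \<longlongrightarrow> L) (at_right t)" ..
next
  fix t :: real assume t: "0 < t"
  have glim: "(g \<longlongrightarrow> g t) (at_left t)" using g_left_continuous[OF t] by (simp add: continuous_within)
  have "((\<lambda>s. integral {g 0..g s} F) \<longlongrightarrow> integral {g 0..g t} F) (at_left t)"
  proof (rule continuous_on_tendsto_compose[OF indefinite_integral_continuous_1[OF int] glim])
    show "g t \<in> {g 0..g t}" using mono[of 0 t] t by auto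
    have "\<forall>\<^sub>F s in at_left t. 0 < s \<and> s < t" using t by (auto simp: eventually_at_left_field intro!: exI[of _ 0])
    then show "\<forall>\<^sub>F s in at_left t. g s \<in> {g 0..g t}"
      by eventually_elim (use mono in auto)
  qed (use t in simp)
  then show "\<exists>L. ((\<lambda>s. integral {g 0..g s} F) \<longlongrightarrow> L) (at_left t)" ..
qed

section \<open>The resolvent of the functional part\<close>

definition one_sided :: "real filter set" where
  "one_sided = at_right ` {0..} \<union> at_left ` {0<..}"

lemma regulated_iff_one_sided: "regulated x \<longleftrightarrow> (\<forall>F\<in>one_sided. \<exists>l. (x \<longlongrightarrow> l) F)"
  unfolding regulated_def one_sided_def by auto

lemma one_sidedD:
  assumes "F \<in> one_sided"
  shows "F \<noteq> bot" "\<forall>\<^sub>F t in F. 0 \<le> t"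
proof -
  have "\<forall>\<^sub>F s in at_right t. 0 \<le> s" if "0 \<le> t" for t :: real
    using eventually_at_right_less[of t] by eventually_elim (use that in simp)
  moreover have "\<forall>\<^sub>F s in at_left t. 0 \<le> s" if "0 < t" for t :: real
    using that by (auto simp: eventually_at_left_field intro!: exI[of _ 0])
  ultimately show "\<forall>\<^sub>F t in F. 0 \<le> t" using assms unfolding one_sided_def by auto
  show "F \<noteq> bot" using assms unfolding one_sided_def by (elim UnE imageE) simp_all
qed

locale contraction_ball =
  fixes nrm :: "'a::euclidean_space \<Rightarrow> real" and \<phi> :: "real \<Rightarrow> real" and N :: real
  assumes n: "is_norm nrm" and D: "D_function \<phi>" and less: "\<And>t. 0 < t \<Longrightarrow> \<phi> t < t" and N: "0 \<le> N"
begin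

definition contracting :: "('a \<Rightarrow> 'a) \<Rightarrow> bool" where
  "contracting H \<longleftrightarrow> (\<forall>u v. nrm u \<le> N \<longrightarrow> nrm v \<le> N \<longrightarrow> nrm (H u - H v) \<le> \<phi> (nrm (u - v)))"

lemma \<phi>_le: "0 \<le> t \<Longrightarrow> \<phi> t \<le> t"
  using D less[of t] unfolding D_function_def by (cases "t = 0") auto

text \<open>
  Compactness: \<open>d - \<phi> d\<close> has a positive minimum on \<open>[e, 2N]\<close>.  This converts smallness of \<open>d - \<phi> d\<close>, which is all
  that the perturbation estimate below gives, into smallness of \<open>d\<close>.
\<close>
lemma small_displacement_imp_small:
  assumes e: "0 < e"
  shows "\<exists>\<kappa>>0. \<forall>d. 0 \<le> d \<longrightarrow> d \<le> 2 * N \<longrightarrow> d - \<phi> d < \<kappa> \<longrightarrow> d < e"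
proof (cases "2 * N < e")
  case True
  then show ?thesis by (intro exI[of _ 1]) auto
next
  case False
  have "continuous_on {0..} \<phi>" using D unfolding D_function_def by simp
  then have "continuous_on {e..2 * N} \<phi>" by (rule continuous_on_subset) (use e in auto)
  then have "continuous_on {e..2 * N} (\<lambda>d. d - \<phi> d)" by (intro continuous_intros)
  then obtain d0 where d0: "d0 \<in> {e..2 * N}" "\<And>d. d \<in> {e..2 * N} \<Longrightarrow> d0 - \<phi> d0 \<le> d - \<phi> d"
    using continuous_attains_inf[of "{e..2 * N}" "\<lambda>d. d - \<phi> d"] False by auto
  show ?thesis
  proof (intro exI[of _ "d0 - \<phi> d0"] conjI allI impI)
    show "0 < d0 - \<phi> d0" using less[of d0] d0(1) e by simp
    fix d assume d: "0 \<le> d" "d \<le> 2 * N" "d - \<phi> d < d0 - \<phi> d0"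
    show "d < e"
    proof (rule ccontr)
      assume "\<not> d < e"
      then show False using d0(2)[of d] d by simp
    qed
  qed
qed

lemma diff_le: "nrm u \<le> N \<Longrightarrow> nrm v \<le> N \<Longrightarrow> nrm (u - v) \<le> 2 * N"
  using is_norm_triangle[OF n, of u "- v"] is_norm_minus[OF n, of v] by simp

lemma compact_ball: "compact {u. nrm u \<le> N}"
proof -
  obtain C where C: "C > 0" "\<And>u. norm u \<le> C * nrm u" using norm_le_is_norm[OF n] by blast
  have "norm u \<le> C * N" if "nrm u \<le> N" for u
    using C(2)[of u] mult_left_mono[OF that, of C] C(1) by linarith
  then have "bounded {u. nrm u \<le> N}" by (intro boundedI[of _ "C * N"]) auto
  moreover have "closed {u. nrm u \<le> N}"
    by (rule closed_Collect_le[OF is_norm_continuous[OF n] continuous_on_const])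
  ultimately show ?thesis by (simp add: compact_eq_bounded_closed)
qed

text \<open>
  Edelstein's argument for an arbitrary norm: at a minimum \<open>v\<close> of the displacement over the compact ball, a
  nonzero displacement would strictly decrease on passing to the image of \<open>v\<close>.
\<close>
lemma fixed_point_exists:
  assumes H: "contracting H" and into: "\<And>u. nrm u \<le> N \<Longrightarrow> nrm (z + H u) \<le> N"
  shows "\<exists>v. nrm v \<le> N \<and> v = z + H v"
proof -
  let ?B = "{u. nrm u \<le> N}"
  obtain C where C: "C > 0" "\<And>u. norm u \<le> C * nrm u" using norm_le_is_norm[OF n] by blast
  obtain C' where C': "C' > 0" "\<And>u. nrm u \<le> C' * norm u" using is_norm_le_norm[OF n] by blast
  have "norm (H u - H v) \<le> (C * C') * norm (u - v)" if "nrm u \<le> N" "nrm v \<le> N" for u v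
  proof -
    have "nrm (H u - H v) \<le> nrm (u - v)"
      using H that \<phi>_le[OF is_norm_ge_0[OF n, of "u - v"]] unfolding contracting_def by force
    then have "C * nrm (H u - H v) \<le> C * (C' * norm (u - v))"
      using C(1) C'(2)[of "u - v"] by (intro mult_left_mono) auto
    then show ?thesis using C(2)[of "H u - H v"] by (simp add: mult.assoc)
  qed
  then have "(C * C')-lipschitz_on ?B H" using C(1) C'(1) by (intro lipschitz_onI) (auto simp: dist_norm)
  then have "continuous_on ?B H" by (rule lipschitz_on_continuous_on)
  then have "continuous_on ?B (\<lambda>u. u - (z + H u))" by (intro continuous_intros)
  then have "continuous_on ?B (\<lambda>u. nrm (u - (z + H u)))"
    by (rule continuous_on_compose2[OF is_norm_continuous[OF n, of UNIV]]) auto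
  moreover have "0 \<in> ?B" using N is_norm_zero[OF n] by simp
  ultimately obtain v where v: "nrm v \<le> N" "\<And>u. nrm u \<le> N \<Longrightarrow> nrm (v - (z + H v)) \<le> nrm (u - (z + H u))"
    using continuous_attains_inf[OF compact_ball, of "\<lambda>u. nrm (u - (z + H u))"] by auto
  define w where "w = z + H v"
  have "v = w"
  proof (rule ccontr)
    assume "v \<noteq> w"
    then have "0 < nrm (v - w)" using is_norm_ge_0[OF n, of "v - w"] is_norm_eq_0[OF n, of "v - w"] by force
    have wN: "nrm w \<le> N" unfolding w_def by (rule into[OF v(1)])
    have "nrm (v - w) \<le> nrm (w - (z + H w))" using v(2)[OF wN] unfolding w_def .
    also have "w - (z + H w) = H v - H w" unfolding w_def by simp
    also have "nrm (H v - H w) \<le> \<phi> (nrm (v - w))" using H v(1) wN unfolding contracting_def by blast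
    also have "\<dots> < nrm (v - w)" by (rule less) fact
    finally show False by simp
  qed
  then show ?thesis using v(1) unfolding w_def by blast
qed

lemma resolvent_perturbation:
  assumes H: "contracting H" and u: "nrm u \<le> N" "u = y + K u" and v: "nrm v \<le> N" "v = z + H v"
  shows "nrm (u - v) - \<phi> (nrm (u - v)) \<le> nrm (y - z) + nrm (K u - H u)"
proof -
  have "u - v = (y + K u) - (z + H v)" using u(2) v(2) by simp
  then have "u - v = (y - z) + ((K u - H u) + (H u - H v))" by (simp add: algebra_simps)
  then have "nrm (u - v) \<le> nrm (y - z) + (nrm (K u - H u) + nrm (H u - H v))"
    using is_norm_triangle[OF n, of "y - z" "(K u - H u) + (H u - H v)"]
      is_norm_triangle[OF n, of "K u - H u" "H u - H v"] by simp
  moreover have "nrm (H u - H v) \<le> \<phi> (nrm (u - v))" using H u(1) v(1) unfolding contracting_def by blast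
  ultimately show ?thesis by linarith
qed

lemma fixed_point_unique:
  assumes H: "contracting H" and u: "nrm u \<le> N" "u = z + H u" and v: "nrm v \<le> N" "v = z + H v"
  shows "u = v"
proof (rule ccontr)
  assume "u \<noteq> v"
  then have "0 < nrm (u - v)" using is_norm_ge_0[OF n, of "u - v"] is_norm_eq_0[OF n, of "u - v"] by force
  from less[OF this] show False
    using resolvent_perturbation[where K = H and y = z and z = z, OF H u v] is_norm_zero[OF n] by simp
qed

lemma resolvent_continuous:
  assumes H: "contracting H" and R: "\<And>z. z \<in> S \<Longrightarrow> nrm (R z) \<le> N \<and> R z = z + H (R z)"
  shows "continuous_on S R"
  unfolding continuous_on_iff
proof (intro ballI allI impI)
  fix z and e :: real assume z: "z \<in> S" and "0 < e"
  obtain C where C: "C > 0" "\<And>u. norm u \<le> C * nrm u" using norm_le_is_norm[OF n] by blast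
  obtain C' where C': "C' > 0" "\<And>u. nrm u \<le> C' * norm u" using is_norm_le_norm[OF n] by blast
  obtain \<kappa> where \<kappa>: "\<kappa> > 0" "\<And>d. 0 \<le> d \<Longrightarrow> d \<le> 2 * N \<Longrightarrow> d - \<phi> d < \<kappa> \<Longrightarrow> d < e / C"
    using small_displacement_imp_small[of "e / C"] \<open>0 < e\<close> C(1) by auto
  show "\<exists>d>0. \<forall>y\<in>S. dist y z < d \<longrightarrow> dist (R y) (R z) < e"
  proof (intro exI[of _ "\<kappa> / C'"] conjI ballI impI)
    show "0 < \<kappa> / C'" using \<kappa>(1) C'(1) by simp
    fix y assume y: "y \<in> S" "dist y z < \<kappa> / C'"
    have "nrm (y - z) < \<kappa>"
      using C'(2)[of "y - z"] y(2) C'(1) by (simp add: dist_norm field_simps)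
    moreover have "nrm (R y - R z) - \<phi> (nrm (R y - R z)) \<le> nrm (y - z) + nrm (H (R y) - H (R y))"
      by (rule resolvent_perturbation[where K = H, OF H]) (use R[OF y(1)] R[OF z] in auto)
    ultimately have "nrm (R y - R z) < e / C"
      using \<kappa>(2)[OF is_norm_ge_0[OF n] diff_le] R[OF y(1)] R[OF z] is_norm_zero[OF n] by auto
    then show "dist (R y) (R z) < e" using C(2)[of "R y - R z"] C(1) by (simp add: dist_norm field_simps)
  qed
qed

text \<open>
  The limits \<open>k v\<close> of \<open>h t v\<close> inherit the contraction estimate, so the limiting equation \<open>v = yl + k v\<close> has a
  solution; by the perturbation estimate, evaluated at that solution, \<open>x t\<close> tends to it.
\<close>
lemma resolvent_limit:
  fixes F :: "real filter"
  assumes F: "F \<noteq> bot" and y: "(y \<longlongrightarrow> yl) F"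
    and h: "\<And>v. nrm v \<le> N \<Longrightarrow> \<exists>l. ((\<lambda>t. h t v) \<longlongrightarrow> l) F"
    and ev: "\<forall>\<^sub>F t in F. contracting (h t) \<and> (\<forall>u. nrm u \<le> N \<longrightarrow> nrm (y t + h t u) \<le> N) \<and>
       nrm (x t) \<le> N \<and> x t = y t + h t (x t)"
  shows "\<exists>l. (x \<longlongrightarrow> l) F"
proof -
  obtain k where k: "\<And>v. nrm v \<le> N \<Longrightarrow> ((\<lambda>t. h t v) \<longlongrightarrow> k v) F" using h by metis
  note nlim = is_norm_tendsto[OF n]
  have K: "contracting k" unfolding contracting_def
  proof (intro allI impI)
    fix u v assume uv: "nrm u \<le> N" "nrm v \<le> N"
    show "nrm (k u - k v) \<le> \<phi> (nrm (u - v))"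
    proof (rule tendsto_upperbound[OF nlim[OF tendsto_diff[OF k[OF uv(1)] k[OF uv(2)]]] _ F])
      show "\<forall>\<^sub>F t in F. nrm (h t u - h t v) \<le> \<phi> (nrm (u - v))"
        using ev by eventually_elim (use uv in \<open>auto simp: contracting_def\<close>)
    qed
  qed
  have "nrm (yl + k u) \<le> N" if u: "nrm u \<le> N" for u
  proof (rule tendsto_upperbound[OF nlim[OF tendsto_add[OF y k[OF u]]] _ F])
    show "\<forall>\<^sub>F t in F. nrm (y t + h t u) \<le> N" using ev by eventually_elim (use u in auto)
  qed
  from fixed_point_exists[OF K this] obtain v where v: "nrm v \<le> N" "v = yl + k v" by blast
  obtain C where C: "C > 0" "\<And>u. norm u \<le> C * nrm u" using norm_le_is_norm[OF n] by blast
  have "(x \<longlongrightarrow> v) F"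
  proof (rule tendstoI)
    fix e :: real assume "0 < e"
    then obtain \<kappa> where \<kappa>: "\<kappa> > 0" "\<And>d. 0 \<le> d \<Longrightarrow> d \<le> 2 * N \<Longrightarrow> d - \<phi> d < \<kappa> \<Longrightarrow> d < e / C"
      using small_displacement_imp_small[of "e / C"] C(1) by auto
    have "((\<lambda>t. nrm (yl - y t) + nrm (k v - h t v)) \<longlongrightarrow> nrm (yl - yl) + nrm (k v - k v)) F"
      by (intro tendsto_add nlim tendsto_diff tendsto_const y k[OF v(1)])
    then have "\<forall>\<^sub>F t in F. nrm (yl - y t) + nrm (k v - h t v) < \<kappa>"
      using \<kappa>(1) is_norm_zero[OF n] by (intro order_tendstoD(2)) auto
    with ev show "\<forall>\<^sub>F t in F. dist (x t) v < e"
    proof eventually_elim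
      case (elim t)
      have "nrm (v - x t) - \<phi> (nrm (v - x t)) \<le> nrm (yl - y t) + nrm (k v - h t v)"
        by (rule resolvent_perturbation[where H = "h t" and K = k and y = yl and z = "y t", OF _ v]) (use elim in auto)
      then have "nrm (v - x t) < e / C"
        using \<kappa>(2)[OF is_norm_ge_0[OF n] diff_le[OF v(1)]] elim by force
      then show ?case using C(2)[of "v - x t"] C(1) by (simp add: dist_norm norm_minus_commute field_simps)
    qed
  qed
  then show ?thesis ..
qed

lemma regulated_resolvent:
  assumes y: "regulated y" and h: "\<And>v. regulated (\<lambda>t. h t v)"
    and H: "\<And>t. 0 \<le> t \<Longrightarrow> contracting (h t)"
    and into: "\<And>t u. 0 \<le> t \<Longrightarrow> nrm u \<le> N \<Longrightarrow> nrm (y t + h t u) \<le> N"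
    and x: "\<And>t. 0 \<le> t \<Longrightarrow> nrm (x t) \<le> N \<and> x t = y t + h t (x t)"
  shows "regulated x"
  unfolding regulated_iff_one_sided
proof
  fix F :: "real filter" assume F: "F \<in> one_sided"
  obtain yl where "(y \<longlongrightarrow> yl) F" using y F unfolding regulated_iff_one_sided by blast
  then show "\<exists>l. (x \<longlongrightarrow> l) F"
  proof (rule resolvent_limit[OF one_sidedD(1)[OF F]])
    show "\<exists>l. ((\<lambda>t. h t v) \<longlongrightarrow> l) F" for v using h[of v] F unfolding regulated_iff_one_sided by blast
    show "\<forall>\<^sub>F t in F. contracting (h t) \<and> (\<forall>u. nrm u \<le> N \<longrightarrow> nrm (y t + h t u) \<le> N) \<and>
       nrm (x t) \<le> N \<and> x t = y t + h t (x t)"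
      using one_sidedD(2)[OF F] by eventually_elim (use H into x in blast)
  qed
qed

end

lemma regulated_diff:
  fixes x y :: "real \<Rightarrow> 'a::real_normed_vector"
  assumes "regulated x" "regulated y" and eq: "\<And>t. 0 \<le> t \<Longrightarrow> z t = x t - y t"
  shows "regulated z"
  unfolding regulated_iff_one_sided
proof
  fix F :: "real filter" assume F: "F \<in> one_sided"
  obtain a b where "(x \<longlongrightarrow> a) F" "(y \<longlongrightarrow> b) F"
    using assms(1,2) F unfolding regulated_iff_one_sided by blast
  then have l: "((\<lambda>t. x t - y t) \<longlongrightarrow> a - b) F" by (rule tendsto_diff)
  have "\<forall>\<^sub>F s in F. x s - y s = z s"
    using one_sidedD(2)[OF F] by eventually_elim (use eq in auto)
  from Lim_transform_eventually[OF l this] show "\<exists>l. (z \<longlongrightarrow> l) F" ..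
qed

lemma ks_integral_infinity_eq_SUP:
  assumes "\<And>s t. 0 \<le> s \<Longrightarrow> s \<le> t \<Longrightarrow> ks_integral abs m g 0 s \<le> ks_integral abs m g 0 t"
  shows "ks_integral_infinity m g = (SUP t\<in>{0..}. ereal (ks_integral abs m g 0 t))"
  unfolding ks_integral_infinity_def
proof (intro tendsto_Lim increasing_tendsto)
  show "\<forall>\<^sub>F t in at_top. ereal (ks_integral abs m g 0 t) \<le> (SUP t\<in>{0..}. ereal (ks_integral abs m g 0 t))"
    using eventually_ge_at_top[of 0] by eventually_elim (auto intro: SUP_upper)
  fix x assume "x < (SUP t\<in>{0..}. ereal (ks_integral abs m g 0 t))"
  then obtain s where s: "0 \<le> s" "x < ereal (ks_integral abs m g 0 s)" by (auto simp: less_SUP_iff)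
  show "\<forall>\<^sub>F t in at_top. x < ereal (ks_integral abs m g 0 t)"
    using eventually_ge_at_top[of s]
  proof eventually_elim
    case (elim t)
    then have "ereal (ks_integral abs m g 0 s) \<le> ereal (ks_integral abs m g 0 t)" using assms s by simp
    with s(2) show ?case by (rule less_le_trans)
  qed
qed simp

text \<open>
  The limit inferior lies below some \<open>r < 1\<close>, so \<open>S N + I N < r N\<close> for arbitrarily large \<open>N\<close>, and the slack
  \<open>(1 - r) N\<close> eventually exceeds the constant \<open>K\<close>.
\<close>
lemma liminf_growth_selects_radius:
  fixes S I :: "real \<Rightarrow> ereal"
  assumes lim: "Liminf at_top (\<lambda>N. ereal (1 / N) * (S N + I N)) < 1"
    and S: "\<And>N. 0 \<le> N \<Longrightarrow> 0 \<le> S N" and I: "\<And>N. 0 \<le> N \<Longrightarrow> 0 \<le> I N"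
  shows "\<exists>N a b. N \<ge> K \<and> N > 0 \<and> S N = ereal a \<and> I N = ereal b \<and> K + a + b \<le> N"
proof -
  obtain r where r: "Liminf at_top (\<lambda>N. ereal (1 / N) * (S N + I N)) < ereal r" "ereal r < 1"
    using ereal_dense2[OF lim] by blast
  then have "r < 1" by simp
  have "\<exists>\<^sub>F N in at_top. ereal (1 / N) * (S N + I N) < ereal r"
  proof (rule ccontr)
    assume "\<not> ?thesis"
    then have "\<forall>\<^sub>F N in at_top. ereal r \<le> ereal (1 / N) * (S N + I N)"
      by (simp add: not_frequently not_less)
    from Liminf_bounded[OF this] show False using r(1) by simp
  qed
  moreover have "\<forall>\<^sub>F N in at_top. max 1 (max K (K / (1 - r))) \<le> N" by (rule eventually_ge_at_top)
  ultimately have "\<exists>\<^sub>F N in at_top. ereal (1 / N) * (S N + I N) < ereal r \<and> max 1 (max K (K / (1 - r))) \<le> N"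
    by (rule frequently_eventually_frequently)
  then obtain N where N: "ereal (1 / N) * (S N + I N) < ereal r" "1 \<le> N" "K \<le> N" "K / (1 - r) \<le> N"
    using frequently_ex by fastforce
  have pos: "0 \<le> S N" "0 \<le> I N" using S I N(2) by auto
  have "S N + I N \<noteq> \<infinity>"
  proof
    assume inf: "S N + I N = \<infinity>"
    show False using N(1) N(2) unfolding inf by simp
  qed
  then obtain a b where ab: "S N = ereal a" "I N = ereal b" using pos by (cases "S N"; cases "I N") auto
  have "(a + b) / N < r" using N(1) unfolding ab by simp
  then have "a + b < r * N" using N(2) by (simp add: field_simps)
  moreover have "K \<le> N * (1 - r)" using N(4) \<open>r < 1\<close> by (simp add: field_simps)
  ultimately have "K + a + b \<le> N" by (simp add: algebra_simps)
  then show ?thesis using N ab by (intro exI[of _ N] exI[of _ a] exI[of _ b]) auto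
qed

section \<open>Existence of bounded solutions\<close>

text \<open>
  The exceptional set depends on \<open>u\<close> and on the right end of the interval; it suffices to let \<open>u\<close> range over a countable
  dense subset of the ball and the right end over the naturals, and to extend to all \<open>u\<close> by continuity.
\<close>
lemma (in integrator) domination_off_null_set:
  fixes f :: "real \<Rightarrow> 'a::euclidean_space \<Rightarrow> 'a"
  assumes n: "is_norm nrm"
    and cont: "\<And>t. 0 \<le> t \<Longrightarrow> continuous_on UNIV (f t)"
    and intf: "\<And>u b. 0 \<le> b \<Longrightarrow> (\<lambda>y. f (\<gamma> y) u) integrable_on {g 0..g b}"
    and intM: "\<And>\<alpha> b. 0 \<le> \<alpha> \<Longrightarrow> 0 \<le> b \<Longrightarrow> (\<lambda>y. M (\<gamma> y) \<alpha>) integrable_on {g 0..g b}"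
    and bound: "\<And>u c d. 0 \<le> c \<Longrightarrow> c \<le> d \<Longrightarrow>
       nrm (integral {g c..g d} (\<lambda>y. f (\<gamma> y) u)) \<le> integral {g c..g d} (\<lambda>y. M (\<gamma> y) (nrm u))"
    and M_mono: "\<And>s \<alpha> \<beta>. 0 \<le> s \<Longrightarrow> 0 \<le> \<alpha> \<Longrightarrow> \<alpha> \<le> \<beta> \<Longrightarrow> M s \<alpha> \<le> M s \<beta>"
  shows "\<exists>Z. negligible Z \<and> (\<forall>y\<in>J - Z. \<forall>u. nrm u \<le> N \<longrightarrow> nrm (f (\<gamma> y) u) \<le> M (\<gamma> y) N)"
proof -
  obtain Q where Q: "countable Q" "Q \<subseteq> {u. nrm u \<le> N}" "{u. nrm u \<le> N} \<subseteq> closure Q" by (rule separable)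
  have "\<exists>Z. negligible Z \<and> (\<forall>y\<in>{g 0..<g (real b)} - Z. nrm (f (\<gamma> y) u) \<le> M (\<gamma> y) (nrm u))" for u and b :: nat
    by (rule integral_bound_imp_pointwise_bound[OF n])
      (use intf[of "real b" u] intM[of "nrm u" "real b"] is_norm_ge_0[OF n, of u] bound in auto)
  then have "\<exists>Z. \<forall>u (b::nat). negligible (Z u b) \<and> (\<forall>y\<in>{g 0..<g (real b)} - Z u b. nrm (f (\<gamma> y) u) \<le> M (\<gamma> y) (nrm u))"
    by (intro choice allI)
  then obtain Z where Z: "\<And>u b. negligible (Z u b)"
    "\<And>u b y. y \<in> {g 0..<g (real (b::nat))} - Z u b \<Longrightarrow> nrm (f (\<gamma> y) u) \<le> M (\<gamma> y) (nrm u)" by blast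
  define Z0 where "Z0 = (\<Union>(u, b)\<in>Q \<times> UNIV. Z u b)"
  have "countable (Q \<times> (UNIV :: nat set))" using Q(1) by simp
  then have "countable ((\<lambda>(u, b). Z u b) ` (Q \<times> UNIV))" by (rule countable_image)
  then have "negligible Z0" unfolding Z0_def by (rule negligible_countable_Union) (use Z(1) in auto)
  moreover have "nrm (f (\<gamma> y) u) \<le> M (\<gamma> y) N" if y: "y \<in> J - Z0" and u: "nrm u \<le> N" for y u
  proof -
    obtain b where b: "0 \<le> b" "y < g b" "g 0 \<le> y" using y unfolding J_def by auto
    have "g b \<le> g (real (nat \<lceil>b\<rceil>))" using mono[of b "real (nat \<lceil>b\<rceil>)"] b(1) by linarith
    then have y_in: "y \<in> {g 0..<g (real (nat \<lceil>b\<rceil>))}" using b by auto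
    have \<gamma>0: "0 \<le> \<gamma> y" using \<gamma>_nonneg y by simp
    have onQ: "nrm (f (\<gamma> y) q) \<le> M (\<gamma> y) N" if "q \<in> Q" for q
    proof -
      have "y \<notin> Z q (nat \<lceil>b\<rceil>)" using y that unfolding Z0_def by auto
      then have "nrm (f (\<gamma> y) q) \<le> M (\<gamma> y) (nrm q)" using Z(2)[of y "nat \<lceil>b\<rceil>" q] y_in by simp
      also have "\<dots> \<le> M (\<gamma> y) N" using M_mono[OF \<gamma>0 is_norm_ge_0[OF n]] Q(2) that by auto
      finally show ?thesis .
    qed
    have "continuous_on UNIV (\<lambda>u. nrm (f (\<gamma> y) u))"
      by (rule continuous_on_compose2[OF is_norm_continuous[OF n, of UNIV] cont[OF \<gamma>0]]) simp
    then have "closed {u. nrm (f (\<gamma> y) u) \<le> M (\<gamma> y) N}"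
      by (intro closed_Collect_le continuous_on_const)
    then have "closure Q \<subseteq> {u. nrm (f (\<gamma> y) u) \<le> M (\<gamma> y) N}"
      by (rule closure_minimal[rotated]) (use onQ in auto)
    then show ?thesis using Q(3) u by auto
  qed
  ultimately show ?thesis by blast
qed

theorem theorem4p3:
  fixes nrm :: "real^'n \<Rightarrow> real"
    and g :: "real \<Rightarrow> real"
    and x0 :: "real^'n"
    and f h :: "real \<Rightarrow> real^'n \<Rightarrow> real^'n"
    and M :: "real \<Rightarrow> real \<Rightarrow> real"
  assumes nrm: "is_norm nrm"
    and g_mono: "mono_on {0..} g"
    and g_left_cont: "\<forall>t>0. continuous (at_left t) g"
    and A0: "\<forall>t\<ge>0. continuous_on UNIV (f t)"
    and A1: "\<forall>u. \<forall>a>0. ks_integrable nrm (\<lambda>s. f s u) g 0 a"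
    and A2_nonneg: "\<forall>s\<ge>0. \<forall>\<alpha>\<ge>0. 0 \<le> M s \<alpha>"
    and A2_integrable: "\<forall>\<alpha>\<ge>0. \<forall>a>0. ks_integrable abs (\<lambda>s. M s \<alpha>) g 0 a"
    and A2_mono: "\<forall>s\<ge>0. mono_on {0..} (M s)"
    and A2_bound: "\<forall>u c d. 0 \<le> c \<and> c \<le> d \<longrightarrow>
          nrm (ks_integral nrm (\<lambda>s. f s u) g c d) \<le> ks_integral abs (\<lambda>s. M s (nrm u)) g c d"
    and A3_regulated: "\<forall>v. bounded ((\<lambda>t. h t v) ` {0..}) \<and> regulated (\<lambda>t. h t v)"
    and A3_contraction: "\<exists>\<phi> :: real \<Rightarrow> real \<Rightarrow> real. \<forall>r\<ge>0.
          D_function (\<lambda>t. \<phi> t r) \<and> (\<forall>t>0. \<phi> t r < t) \<and>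
          (\<forall>u v. nrm u \<le> r \<and> nrm v \<le> r \<longrightarrow>
             (\<forall>t\<ge>0. nrm (h t u - h t v) \<le> \<phi> (nrm (u - v)) r))"
    and growth: "Liminf at_top (\<lambda>N::real. ereal (1 / N) *
          ((SUP (t, u)\<in>{(t, u). 0 \<le> t \<and> nrm u \<le> N}. ereal (nrm (h t u))) +
           ks_integral_infinity (\<lambda>s. M s N) g)) < 1"
  shows "\<exists>x. bounded (x ` {0..}) \<and> is_solution nrm g f h x0 x"
proof -
  interpret integrator g
    by unfold_locales (use g_mono g_left_cont in auto)
  have abs_norm: "is_norm (abs :: real \<Rightarrow> real)"
    unfolding is_norm_def by (auto simp: abs_mult abs_triangle_ineq)
  have intf: "(\<lambda>y. f (\<gamma> y) u) integrable_on {g 0..g b}" if "0 \<le> b" for u b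
  proof (cases "b = 0")
    case False
    then have "ks_integrable nrm (\<lambda>s. f s u) g 0 b" using A1 that by simp
    then show ?thesis using ks_integrable_iff[OF nrm _ that] by simp
  qed (use has_integral_refl(2) in \<open>force simp: integrable_on_def\<close>)
  have intM: "(\<lambda>y. M (\<gamma> y) \<alpha>) integrable_on {g 0..g b}" if "0 \<le> \<alpha>" "0 \<le> b" for \<alpha> b
  proof (cases "b = 0")
    case False
    then have "ks_integrable abs (\<lambda>s. M s \<alpha>) g 0 b" using A2_integrable that by simp
    then show ?thesis using ks_integrable_iff[OF abs_norm _ that(2)] by simp
  qed (use has_integral_refl(2) in \<open>force simp: integrable_on_def\<close>)
  have ksf: "ks_integral nrm (\<lambda>s. f s u) g a b = integral {g a..g b} (\<lambda>y. f (\<gamma> y) u)" if "0 \<le> a" "a \<le> b" for u a b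
    using that mono[of 0 a] by (intro ks_integral_eq[OF nrm] integrable_subinterval_real[OF intf[of b]]) auto
  have ksM: "ks_integral abs (\<lambda>s. M s \<alpha>) g a b = integral {g a..g b} (\<lambda>y. M (\<gamma> y) \<alpha>)" if "0 \<le> \<alpha>" "0 \<le> a" "a \<le> b" for \<alpha> a b
    using that mono[of 0 a] by (intro ks_integral_eq[OF abs_norm] integrable_subinterval_real[OF intM[of \<alpha> b]]) auto
  have M_mono: "M s \<alpha> \<le> M s \<beta>" if "0 \<le> s" "0 \<le> \<alpha>" "\<alpha> \<le> \<beta>" for s \<alpha> \<beta>
    using A2_mono that by (auto simp: mono_on_def)
  have spike_J: "(\<lambda>y. if y \<in> J - Z then F y else G y) integrable_on {g 0..g b} \<and>
      integral {g 0..g b} (\<lambda>y. if y \<in> J - Z then F y else G y) = integral {g 0..g b} F"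
    if "negligible Z" "F integrable_on {g 0..g b}" "0 \<le> b" for Z b and F G :: "real \<Rightarrow> 'z::euclidean_space"
  proof -
    have neg: "negligible (insert (g b) Z)" using that(1) by simp
    have eq: "F y = (if y \<in> J - Z then F y else G y)" if "y \<in> {g 0..g b} - insert (g b) Z" for y
      using in_J[of 0 b y] \<open>0 \<le> b\<close> that by auto
    show ?thesis
      using integrable_spike[OF that(2) neg, of "\<lambda>y. if y \<in> J - Z then F y else G y"]
        integral_spike[OF neg, of "{g 0..g b}" "\<lambda>y. if y \<in> J - Z then F y else G y" F] eq by auto
  qed

  \<comment> \<open>the radius \<open>N\<close> is chosen so that \<open>nrm x0\<close> as well as \<open>nrm c\<close>, \<open>a\<close> and \<open>A\<close> fit in together; the ball
    then contains \<open>x0\<close> and all values \<open>z + h t u\<close> with \<open>nrm (z - c) \<le> A\<close>\<close>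
  define c where "c = x0 - h 0 x0"
  have ks_mono: "ks_integral abs (\<lambda>s. M s \<alpha>) g 0 s \<le> ks_integral abs (\<lambda>s. M s \<alpha>) g 0 t"
    if "0 \<le> \<alpha>" "0 \<le> s" "s \<le> t" for \<alpha> s t
  proof -
    have "integral {g 0..g s} (\<lambda>y. M (\<gamma> y) \<alpha>) = integral {g 0..g s} (\<lambda>y. if y \<in> J - {} then M (\<gamma> y) \<alpha> else 0)"
      "integral {g 0..g t} (\<lambda>y. M (\<gamma> y) \<alpha>) = integral {g 0..g t} (\<lambda>y. if y \<in> J - {} then M (\<gamma> y) \<alpha> else 0)"
      using spike_J[of "{}" "\<lambda>y. M (\<gamma> y) \<alpha>" s "\<lambda>_. 0"] spike_J[of "{}" "\<lambda>y. M (\<gamma> y) \<alpha>" t "\<lambda>_. 0"] intM that by auto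
    moreover have "integral {g 0..g s} (\<lambda>y. if y \<in> J - {} then M (\<gamma> y) \<alpha> else 0) \<le> integral {g 0..g t} (\<lambda>y. if y \<in> J - {} then M (\<gamma> y) \<alpha> else 0)"
      using spike_J[of "{}" "\<lambda>y. M (\<gamma> y) \<alpha>" s "\<lambda>_. 0"] spike_J[of "{}" "\<lambda>y. M (\<gamma> y) \<alpha>" t "\<lambda>_. 0"] intM that mono[of s t]
      by (intro integral_subset_le) (auto simp: A2_nonneg \<gamma>_nonneg)
    ultimately show ?thesis using ksM that by simp
  qed
  have SUP_ge: "ereal (nrm (h t u)) \<le> (SUP (t, u)\<in>{(t, u). 0 \<le> t \<and> nrm u \<le> N}. ereal (nrm (h t u)))"
    if "0 \<le> t" "nrm u \<le> N" for t u N
    using SUP_upper[of "(t, u)" "{(t, u). 0 \<le> t \<and> nrm u \<le> N}" "\<lambda>(t, u). ereal (nrm (h t u))"] that by simp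
  have inf_ge: "ereal (ks_integral abs (\<lambda>s. M s N) g 0 t) \<le> ks_integral_infinity (\<lambda>s. M s N) g" if "0 \<le> N" "0 \<le> t" for N t
  proof -
    have "ks_integral_infinity (\<lambda>s. M s N) g = (SUP t\<in>{0..}. ereal (ks_integral abs (\<lambda>s. M s N) g 0 t))"
      by (rule ks_integral_infinity_eq_SUP) (rule ks_mono[OF \<open>0 \<le> N\<close>])
    then show ?thesis using \<open>0 \<le> t\<close> by (auto intro: SUP_upper)
  qed
  have "\<exists>N a b. N \<ge> nrm x0 + nrm c \<and> N > 0 \<and>
      (SUP (t, u)\<in>{(t, u). 0 \<le> t \<and> nrm u \<le> N}. ereal (nrm (h t u))) = ereal a \<and>
      ks_integral_infinity (\<lambda>s. M s N) g = ereal b \<and> nrm x0 + nrm c + a + b \<le> N"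
  proof (rule liminf_growth_selects_radius[OF growth])
    fix N :: real assume N: "0 \<le> N"
    have "ereal 0 \<le> ereal (nrm (h 0 0))" using is_norm_ge_0[OF nrm] by simp
    also have "\<dots> \<le> (SUP (t, u)\<in>{(t, u). 0 \<le> t \<and> nrm u \<le> N}. ereal (nrm (h t u)))"
      using SUP_ge[of 0 0 N] is_norm_zero[OF nrm] N by simp
    finally show "0 \<le> (SUP (t, u)\<in>{(t, u). 0 \<le> t \<and> nrm u \<le> N}. ereal (nrm (h t u)))"
      unfolding zero_ereal_def .
    show "0 \<le> ks_integral_infinity (\<lambda>s. M s N) g"
      using inf_ge[OF N, of 0] ksM[OF N, of 0 0] by (simp add: zero_ereal_def)
  qed
  then obtain N a A where rad: "nrm x0 + nrm c \<le> N" "0 < N" "nrm x0 + nrm c + a + A \<le> N"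
    and SN: "(SUP (t, u)\<in>{(t, u). 0 \<le> t \<and> nrm u \<le> N}. ereal (nrm (h t u))) = ereal a"
    and IN: "ks_integral_infinity (\<lambda>s. M s N) g = ereal A" by blast
  have ha: "nrm (h t u) \<le> a" if "0 \<le> t" "nrm u \<le> N" for t u
    using SUP_ge[OF that] unfolding SN by simp
  have x0N: "nrm x0 \<le> N" using rad(1) is_norm_ge_0[OF nrm, of c] by linarith
  have intA: "integral {g 0..g b} (\<lambda>y. M (\<gamma> y) N) \<le> A" if "0 \<le> b" for b
    using inf_ge[of N b] ksM[of N 0 b] rad(2) that unfolding IN by simp

  obtain \<phi> where \<phi>: "\<And>r. 0 \<le> r \<Longrightarrow> D_function (\<lambda>t. \<phi> t r)" "\<And>r t. 0 \<le> r \<Longrightarrow> 0 < t \<Longrightarrow> \<phi> t r < t"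
    "\<And>r u v t. 0 \<le> r \<Longrightarrow> nrm u \<le> r \<Longrightarrow> nrm v \<le> r \<Longrightarrow> 0 \<le> t \<Longrightarrow> nrm (h t u - h t v) \<le> \<phi> (nrm (u - v)) r"
    using A3_contraction by blast
  interpret contraction_ball nrm "\<lambda>t. \<phi> t N" N
    by unfold_locales (use \<phi>(1,2)[of N] rad(2) nrm in auto)
  have H: "contracting (h t)" if "0 \<le> t" for t
    unfolding contracting_def using \<phi>(3)[of N] rad(2) that by auto
  have into: "nrm (z + h t u) \<le> N" if "0 \<le> t" "nrm u \<le> N" "nrm (z - c) \<le> A" for t u z
  proof -
    have "nrm z \<le> nrm (z - c) + nrm c" using is_norm_triangle[OF nrm, of "z - c" c] by simp
    then show ?thesis
      using is_norm_triangle[OF nrm, of z "h t u"] ha[OF that(1,2)] that(3) rad(3) is_norm_ge_0[OF nrm, of x0] by linarith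
  qed
  define R where "R t z = (SOME v. nrm v \<le> N \<and> v = z + h t v)" for t z
  have R: "nrm (R t z) \<le> N \<and> R t z = z + h t (R t z)" if "0 \<le> t" "nrm (z - c) \<le> A" for t z
    unfolding R_def by (rule someI_ex) (rule fixed_point_exists[OF H[OF that(1)] into[OF that(1) _ that(2)]])
  have reg_h: "regulated (\<lambda>t. h t v)" for v using A3_regulated by blast

  have "\<exists>Z. negligible Z \<and> (\<forall>y\<in>J - Z. \<forall>u. nrm u \<le> N \<longrightarrow> nrm (f (\<gamma> y) u) \<le> M (\<gamma> y) N)"
  proof (rule domination_off_null_set[OF nrm _ intf intM _ M_mono])
    show "continuous_on UNIV (f t)" if "0 \<le> t" for t using A0 that by blast
    show "nrm (integral {g c..g d} (\<lambda>y. f (\<gamma> y) u)) \<le> integral {g c..g d} (\<lambda>y. M (\<gamma> y) (nrm u))"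
      if "0 \<le> c" "c \<le> d" for u c d
      using A2_bound that ksf[OF that] ksM[OF is_norm_ge_0[OF nrm] that] by metis
  qed
  then obtain Z where Z: "negligible Z" "\<And>y u. y \<in> J - Z \<Longrightarrow> nrm u \<le> N \<Longrightarrow> nrm (f (\<gamma> y) u) \<le> M (\<gamma> y) N" by blast
  \<comment> \<open>setting the integrand to zero on the null set makes the domination hold everywhere\<close>
  define F where "F y u = (if y \<in> J - Z then f (\<gamma> y) u else 0)" for y u
  define E where "E y z = F y (R (\<gamma> y) z)" for y z
  define m where "m y = (if y \<in> J then M (\<gamma> y) N else 0)" for y
  have m: "m integrable_on {g 0..g b}" "integral {g 0..g b} m = integral {g 0..g b} (\<lambda>y. M (\<gamma> y) N)" if "0 \<le> b" for b
    using spike_J[of "{}" "\<lambda>y. M (\<gamma> y) N" b "\<lambda>_. 0"] intM[of N b] rad(2) that unfolding m_def by auto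
  interpret caratheodory g nrm E m c A
  proof
    show "is_norm nrm" by (rule nrm)
    show "m integrable_on {g 0..g b}" "integral {g 0..g b} m \<le> A" if "0 \<le> b" for b
      using m[OF that] intA[OF that] by auto
    show "E y z = 0" if "y \<notin> J" for y z using that unfolding E_def F_def by simp
    show "nrm (E y z) \<le> m y" if "nrm (z - c) \<le> A" for y z
      using Z(2)[of y "R (\<gamma> y) z"] R[OF \<gamma>_nonneg that] is_norm_zero[OF nrm] A2_nonneg \<gamma>_nonneg rad(2)
      unfolding E_def F_def m_def by auto
    show "continuous_on {z. nrm (z - c) \<le> A} (E y)" for y
    proof (cases "y \<in> J - Z")
      case True
      then have \<gamma>0: "0 \<le> \<gamma> y" using \<gamma>_nonneg by simp
      have cR: "continuous_on {z. nrm (z - c) \<le> A} (R (\<gamma> y))"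
        by (rule resolvent_continuous[OF H[OF \<gamma>0]]) (use R[OF \<gamma>0] in auto)
      have cf: "continuous_on UNIV (f (\<gamma> y))" using A0 \<gamma>0 by blast
      have "continuous_on {z. nrm (z - c) \<le> A} (\<lambda>z. f (\<gamma> y) (R (\<gamma> y) z))"
        by (rule continuous_on_compose2[OF cf cR]) simp
      moreover have "E y = (\<lambda>z. f (\<gamma> y) (R (\<gamma> y) z))" using True unfolding E_def F_def by auto
      ultimately show ?thesis by simp
    next
      case False
      then have "E y = (\<lambda>z. 0)" unfolding E_def F_def by auto
      then show ?thesis by simp
    qed
    show "(\<lambda>y. E y z) \<in> borel_measurable (lebesgue_on {g 0..<g b})" if z: "nrm (z - c) \<le> A" and b: "0 \<le> b" for z b
      unfolding E_def
    proof (rule Caratheodory_measurable[where F = F and w = "\<lambda>y. R (\<gamma> y) z"])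
      fix u
      have "(\<lambda>y. F y u) integrable_on {g 0..g b}"
        using spike_J[OF Z(1) intf[OF b, of u] b, of "\<lambda>_. 0"] unfolding F_def by simp
      then have "(\<lambda>y. F y u) integrable_on {g 0..<g b}"
        by (rule integrable_spike_set) (auto intro: negligible_subset[of "{g b}"])
      then show "(\<lambda>y. F y u) \<in> borel_measurable (lebesgue_on {g 0..<g b})"
        by (rule integrable_imp_measurable)
    next
      fix y
      show "continuous_on UNIV (F y)"
      proof (cases "y \<in> J - Z")
        case True
        then have "F y = f (\<gamma> y)" unfolding F_def by auto
        then show ?thesis using A0 \<gamma>_nonneg True by auto
      next
        case False
        then have "F y = (\<lambda>u. 0)" unfolding F_def by auto
        then show ?thesis by simp
      qed
    next
      \<comment> \<open>the solution for a constant right-hand side \<open>z\<close> is regulated in time, hence Borel\<close>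
      have "regulated (\<lambda>t. R t z)"
      proof (rule regulated_resolvent[of "\<lambda>_. z" h, OF _ reg_h H])
        show "regulated (\<lambda>_. z)" unfolding regulated_def by (auto intro: tendsto_const)
      qed (use into R z in auto)
      then have "(\<lambda>t. R (max 0 t) z) \<in> borel_measurable borel" by (rule regulated_imp_borel)
      then have "(\<lambda>y. R (max 0 (\<gamma> y)) z) \<in> borel_measurable (lebesgue_on {g 0..<g b})"
        by (rule measurable_compose[OF \<gamma>_measurable[OF b]])
      then show "(\<lambda>y. R (\<gamma> y) z) \<in> borel_measurable (lebesgue_on {g 0..<g b})"
      proof (rule measurable_cong[THEN iffD1, rotated])
        fix y assume "y \<in> space (lebesgue_on {g 0..<g b})"
        then have "0 \<le> \<gamma> y" using in_J[of 0 b y] b \<gamma>_nonneg by auto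
        then show "R (max 0 (\<gamma> y)) z = R (\<gamma> y) z" by simp
      qed
    qed
  qed
  obtain y where y: "\<And>t. 0 \<le> t \<Longrightarrow> nrm (y t - c) \<le> A"
    "\<And>t. 0 \<le> t \<Longrightarrow> (\<lambda>v. E v (y (\<gamma> v))) integrable_on {g 0..g t}"
    "\<And>t. 0 \<le> t \<Longrightarrow> y t = c + integral {g 0..g t} (\<lambda>v. E v (y (\<gamma> v)))"
    using integral_equation_solvable by blast
  define x where "x t = R t (y t)" for t
  have x: "nrm (x t) \<le> N" "x t = y t + h t (x t)" if "0 \<le> t" for t
    using R[OF that y(1)[OF that]] unfolding x_def by auto
  have E_eq: "E v (y (\<gamma> v)) = (if v \<in> J - Z then f (\<gamma> v) (x (\<gamma> v)) else 0)" for v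
    unfolding E_def F_def x_def by simp
  have fx: "(\<lambda>v. f (\<gamma> v) (x (\<gamma> v))) integrable_on {g 0..g t}"
    "integral {g 0..g t} (\<lambda>v. f (\<gamma> v) (x (\<gamma> v))) = integral {g 0..g t} (\<lambda>v. E v (y (\<gamma> v)))" if t: "0 \<le> t" for t
  proof -
    have "(if v \<in> J - Z then E v (y (\<gamma> v)) else f (\<gamma> v) (x (\<gamma> v))) = f (\<gamma> v) (x (\<gamma> v))" for v
      unfolding E_eq by simp
    then show "(\<lambda>v. f (\<gamma> v) (x (\<gamma> v))) integrable_on {g 0..g t}"
      "integral {g 0..g t} (\<lambda>v. f (\<gamma> v) (x (\<gamma> v))) = integral {g 0..g t} (\<lambda>v. E v (y (\<gamma> v)))"
      using spike_J[OF Z(1) y(2)[OF t] t, of "\<lambda>v. f (\<gamma> v) (x (\<gamma> v))"] by simp_all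
  qed
  have reg_y: "regulated y"
  proof (rule regulated_diff[where y = "\<lambda>_. - c"])
    show "regulated (\<lambda>t. integral {g 0..g t} (\<lambda>v. E v (y (\<gamma> v))))"
      by (rule regulated_indefinite_integral[OF y(2)])
    show "regulated (\<lambda>_. - c)" unfolding regulated_def by (auto intro: tendsto_const)
    show "y t = integral {g 0..g t} (\<lambda>v. E v (y (\<gamma> v))) - - c" if "0 \<le> t" for t
      using y(3)[OF that] by (simp add: algebra_simps)
  qed
  have reg_x: "regulated x"
    by (rule regulated_resolvent[OF reg_y reg_h H]) (use into y(1) x in auto)
  have reg_hx: "regulated (\<lambda>t. h t (x t))"
  proof (rule regulated_diff[OF reg_x reg_y])
    show "h t (x t) = x t - y t" if "0 \<le> t" for t using x(2)[OF that] by (metis add_diff_cancel_left')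
  qed
  have y0: "y 0 = c" using y(3)[of 0] by simp
  have x00: "x 0 = x0"
  proof (rule fixed_point_unique[OF H[of 0] x(1)[of 0] _ x0N])
    show "x 0 = c + h 0 (x 0)" using x(2)[of 0] y0 by simp
    show "x0 = c + h 0 x0" unfolding c_def by simp
  qed simp_all
  have "is_solution nrm g f h x0 x"
    unfolding is_solution_def
  proof (intro conjI allI impI reg_x reg_hx x00)
    fix t :: real assume t: "0 \<le> t"
    show "ks_integrable nrm (\<lambda>s. f s (x s)) g 0 t"
      using ks_integrable_iff[OF nrm order.refl t, where f = "\<lambda>s. f s (x s)"] fx(1)[OF t] by simp
    have "ks_integral nrm (\<lambda>s. f s (x s)) g 0 t = integral {g 0..g t} (\<lambda>v. E v (y (\<gamma> v)))"
      using ks_integral_eq[OF nrm order.refl t, where f = "\<lambda>s. f s (x s)"] fx[OF t] by simp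
    then have "y t = x0 - h 0 (x 0) + ks_integral nrm (\<lambda>s. f s (x s)) g 0 t"
      using y(3)[OF t] x00 unfolding c_def by simp
    then show "x t = x0 - h 0 (x 0) + h t (x t) + ks_integral nrm (\<lambda>s. f s (x s)) g 0 t"
      using x(2)[OF t] by (metis add.assoc add.commute)
  qed
  moreover have "bounded (x ` {0..})"
  proof (rule bounded_subset)
    show "bounded {u. nrm u \<le> N}" using compact_ball by (rule compact_imp_bounded)
    show "x ` {0..} \<subseteq> {u. nrm u \<le> N}" using x(1) by auto
  qed
  ultimately show ?thesis by blast
qed

end
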